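(* Let $(\mathscr{F},\mathbb{E},\mathfrak{s})$ be a Frobenius extriangulated category satisfying Condition (WIC), with $\mathcal{I}=\mathrm{Inj}(\mathscr{F})$. Then its stable category, namely the ideal quotient $\mathscr{F}/\mathcal{I}$, becomes triangulated.
   Context: Extriangulated categories. Let $\mathscr{C}$ be an additive category and $\mathbb{E}\colon\mathscr{C}^{\mathrm{op}}\times\mathscr{C}\to\mathit{Ab}$ a functor. Elements $\delta\in\mathbb{E}(C,A)$ are called $\mathbb{E}$-extensions; for $a\colon A\to A'$ and $c\colon C'\to C$ put $a_*\delta=\mathbb{E}(C,a)(\delta)$ and $c^*\delta=\mathbb{E}(c,A)(\delta)$. A morphism $(a,c)\colon\delta\to\delta'$ from $\delta\in\mathbb{E}(C,A)$ to $\delta'\in\mathbb{E}(C',A')$ is a pair $a\colon A\to A'$, $c\colon C\to C'$ with $a_*\delta=c^*\delta'$. Sequences $A\xrightarrow{x}B\xrightarrow{y}C$ and $A\xrightarrow{x'}B'\xrightarrow{y'}C$ are equivalent if there is an isomorphism $b\colon B\to B'$ with $bx=x'$, $y'b=y$; the class is written $[A\xrightarrow{x}B\xrightarrow{y}C]$. A realization $\mathfrak{s}$ assigns to each $\delta\in\mathbb{E}(C,A)$ such a class $\mathfrak{s}(\delta)=[A\xrightarrow{x}B\xrightarrow{y}C]$ so that for every morphism $(a,c)\colon\delta\to\delta'$, with $\mathfrak{s}(\delta')=[A'\xrightarrow{x'}B'\xrightarrow{y'}C']$, there is $b\colon B\to B'$ with $bx=x'a$, $y'b=cy$ (then $(a,b,c)$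 is said to realize $(a,c)$). It is additive if $\mathfrak{s}(0)=[A\to A\oplus C\to C]$ (canonical inclusion and projection) and $\mathfrak{s}(\delta\oplus\delta')=[A\oplus A'\xrightarrow{x\oplus x'}B\oplus B'\xrightarrow{y\oplus y'}C\oplus C']$, where $\delta\oplus\delta'\in\mathbb{E}(C\oplus C',A\oplus A')$ corresponds to $(\delta,0,0,\delta')$. If $\mathfrak{s}(\delta)=[A\xrightarrow{x}B\xrightarrow{y}C]$, the sequence is called a conflation, $x$ an inflation, $y$ a deflation, and one speaks of the $\mathbb{E}$-triangle $A\xrightarrow{x}B\xrightarrow{y}C\overset{\delta}{\dashrightarrow}$. The triple $(\mathscr{C},\mathbb{E},\mathfrak{s})$ is an extriangulated category if: (ET1) $\mathbb{E}$ is biadditive; (ET2) $\mathfrak{s}$ is an additive realization; (ET3) for $\mathbb{E}$-triangles $A\xrightarrow{x}B\xrightarrow{y}C\overset{\delta}{\dashrightarrow}$, $A'\xrightarrow{x'}B'\xrightarrow{y'}C'\overset{\delta'}{\dashrightarrow}$ and $a,b$ with $bx=x'a$ there is $c$ such that $(a,c)\colon\delta\to\delta'$ is a morphism realized by $(a,b,c)$; (ET3)$^{\mathrm{op}}$ for $b,c$ with $y'b=cy$ there is $a$ such that $(a,c)\colon\delta\to\delta'$ is a morphism realized by $(a,b,c)$; (ET4) for $\mathbb{E}$-triangles $A\xrightarrow{f}B\xrightarrow{f'}D\overset{\delta}{\dashrightarrow}$ and $B\xrightarrow{g}C\xrightarrow{g'}F\overset{\delta'}{\dashrightarrow}$ there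 are an $\mathbb{E}$-triangle $A\xrightarrow{h}C\xrightarrow{h'}E\overset{\delta''}{\dashrightarrow}$ with $h=gf$ and $d\colon D\to E$, $e\colon E\to F$ with $df'=h'g$, $eh'=g'$, such that $D\xrightarrow{d}E\xrightarrow{e}F$ realizes $f'_*\delta'$, $d^*\delta''=\delta$ and $f_*\delta''=e^*\delta'$; (ET4)$^{\mathrm{op}}$ for $\mathbb{E}$-triangles $D\xrightarrow{f'}A\xrightarrow{f}B\overset{\delta}{\dashrightarrow}$ and $F\xrightarrow{g'}B\xrightarrow{g}C\overset{\delta'}{\dashrightarrow}$ there are an $\mathbb{E}$-triangle $E\xrightarrow{h'}A\xrightarrow{h}C\overset{\delta''}{\dashrightarrow}$ with $h=gf$ and $d\colon D\to E$, $e\colon E\to F$ with $h'd=f'$, $fh'=g'e$, such that $D\xrightarrow{d}E\xrightarrow{e}F$ realizes $g'^*\delta$, $\delta'=e_*\delta''$ and $d_*\delta=g^*\delta''$. Condition (WIC): for all composable $f\colon A\to B$, $g\colon B\to C$: if $gf$ is an inflation then so is $f$; if $gf$ is a deflation then so is $g$. An object $P$ is projective if for every deflation $y\colon B\to C$ and every $c\colon P\to C$ there is $b\colon P\to B$ with $yb=c$; injective objects are defined dually. $\mathrm{Proj}$ and $\mathrm{Inj}$ denote the full subcategories of projectives and injectives. There are enough projectives if every object $C$ admits a conflation $A\to P\to C$ with $P$ projective; enough injectives is dual (every $A$ admits a conflation $A\to I\to C$ with $I$ injective). An extriangulated category is Frobenius if it has enough projectives and enough injectives and $\mathrm{Proj}=\mathrm{Inj}$.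 The ideal quotient $\mathscr{F}/\mathcal{I}$ is the quotient by the ideal of morphisms factoring through objects of $\mathcal{I}$. "Becomes triangulated" means that it admits the structure of a triangulated category. *)

theory Defs
  imports "HOL-Algebra.Coset"
begin

section \<open>Additive categories\<close>

text \<open>
  Abelian groups are the (multiplicatively written) \<open>comm_group\<close>s of HOL-Algebra, so in a hom-group
  or a group of extensions the operation \<open>\<otimes>\<close> is the sum, \<open>\<one>\<close> is zero and \<open>inv\<close> is the negative.
  Values of the record fields on objects or morphisms outside the category carry no meaning.
\<close>

record ('o, 'm) cat =
  obj   :: "'o set"
  Hom   :: "'o \<Rightarrow> 'o \<Rightarrow> 'm monoid"
  comp  :: "'m \<Rightarrow> 'm \<Rightarrow> 'm"  (infixl "\<cdot>\<index>" 70)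
  ident :: "'o \<Rightarrow> 'm"

abbreviation Mor :: "('o, 'm, 'z) cat_scheme \<Rightarrow> 'o \<Rightarrow> 'o \<Rightarrow> 'm set"
  where "Mor K A B \<equiv> carrier (Hom K A B)"

abbreviation mzero :: "('o, 'm, 'z) cat_scheme \<Rightarrow> 'o \<Rightarrow> 'o \<Rightarrow> 'm"
  where "mzero K A B \<equiv> \<one>\<^bsub>Hom K A B\<^esub>"

text \<open>Hom-sets are pairwise disjoint, so that a morphism determines its domain and codomain.\<close>

locale category =
  fixes K :: "('o, 'm, 'z) cat_scheme" (structure)
  assumes Hom_disjoint:
      "\<lbrakk>A \<in> obj K; B \<in> obj K; A' \<in> obj K; B' \<in> obj K; f \<in> Mor K A B; f \<in> Mor K A' B'\<rbrakk>
        \<Longrightarrow> A = A' \<and> B = B'"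
    and comp_closed:
      "\<lbrakk>A \<in> obj K; B \<in> obj K; C \<in> obj K; f \<in> Mor K A B; g \<in> Mor K B C\<rbrakk> \<Longrightarrow> g \<cdot> f \<in> Mor K A C"
    and comp_assoc:
      "\<lbrakk>A \<in> obj K; B \<in> obj K; C \<in> obj K; D \<in> obj K;
        f \<in> Mor K A B; g \<in> Mor K B C; h \<in> Mor K C D\<rbrakk> \<Longrightarrow> h \<cdot> g \<cdot> f = h \<cdot> (g \<cdot> f)"
    and ident_closed: "A \<in> obj K \<Longrightarrow> ident K A \<in> Mor K A A"
    and comp_ident_right: "\<lbrakk>A \<in> obj K; B \<in> obj K; f \<in> Mor K A B\<rbrakk> \<Longrightarrow> f \<cdot> ident K A = f"
    and comp_ident_left: "\<lbrakk>A \<in> obj K; B \<in> obj K; f \<in> Mor K A B\<rbrakk> \<Longrightarrow> ident K B \<cdot> f = f"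

locale preadditive_category = category K
  for K :: "('o, 'm, 'z) cat_scheme" (structure) +
  assumes Hom_group: "\<lbrakk>A \<in> obj K; B \<in> obj K\<rbrakk> \<Longrightarrow> comm_group (Hom K A B)"
    and comp_add_right:
      "\<lbrakk>A \<in> obj K; B \<in> obj K; C \<in> obj K; f \<in> Mor K A B; f' \<in> Mor K A B; g \<in> Mor K B C\<rbrakk>
        \<Longrightarrow> g \<cdot> (f \<otimes>\<^bsub>Hom K A B\<^esub> f') = (g \<cdot> f) \<otimes>\<^bsub>Hom K A C\<^esub> (g \<cdot> f')"
    and comp_add_left:
      "\<lbrakk>A \<in> obj K; B \<in> obj K; C \<in> obj K; f \<in> Mor K A B; g \<in> Mor K B C; g' \<in> Mor K B C\<rbrakk>
        \<Longrightarrow> (g \<otimes>\<^bsub>Hom K B C\<^esub> g') \<cdot> f = (g \<cdot> f) \<otimes>\<^bsub>Hom K A C\<^esub> (g' \<cdot> f)"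

definition is_iso :: "('o, 'm, 'z) cat_scheme \<Rightarrow> 'o \<Rightarrow> 'o \<Rightarrow> 'm \<Rightarrow> bool" where
  "is_iso K A B f \<longleftrightarrow> f \<in> Mor K A B \<and>
     (\<exists>g \<in> Mor K B A. g \<cdot>\<^bsub>K\<^esub> f = ident K A \<and> f \<cdot>\<^bsub>K\<^esub> g = ident K B)"

definition is_zero_obj :: "('o, 'm, 'z) cat_scheme \<Rightarrow> 'o \<Rightarrow> bool" where
  "is_zero_obj K Z \<longleftrightarrow> Z \<in> obj K \<and>
     (\<forall>A \<in> obj K. (\<exists>!f. f \<in> Mor K A Z) \<and> (\<exists>!f. f \<in> Mor K Z A))"

record ('o, 'm) biprod =
  dsum :: "'o"
  inl  :: "'m"
  inr  :: "'m"
  prl  :: "'m"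
  prr  :: "'m"

definition is_biproduct :: "('o, 'm, 'z) cat_scheme \<Rightarrow> 'o \<Rightarrow> 'o \<Rightarrow> ('o, 'm) biprod \<Rightarrow> bool" where
  "is_biproduct K A B S \<longleftrightarrow>
     A \<in> obj K \<and> B \<in> obj K \<and> dsum S \<in> obj K \<and>
     inl S \<in> Mor K A (dsum S) \<and> inr S \<in> Mor K B (dsum S) \<and>
     prl S \<in> Mor K (dsum S) A \<and> prr S \<in> Mor K (dsum S) B \<and>
     prl S \<cdot>\<^bsub>K\<^esub> inl S = ident K A \<and> prr S \<cdot>\<^bsub>K\<^esub> inr S = ident K B \<and>
     prl S \<cdot>\<^bsub>K\<^esub> inr S = mzero K B A \<and> prr S \<cdot>\<^bsub>K\<^esub> inl S = mzero K A B \<and>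
     (inl S \<cdot>\<^bsub>K\<^esub> prl S) \<otimes>\<^bsub>Hom K (dsum S) (dsum S)\<^esub> (inr S \<cdot>\<^bsub>K\<^esub> prr S) = ident K (dsum S)"

locale additive_category = preadditive_category K
  for K :: "('o, 'm, 'z) cat_scheme" (structure) +
  assumes zero_obj_exists: "\<exists>Z. is_zero_obj K Z"
    and biproduct_exists: "\<lbrakk>A \<in> obj K; B \<in> obj K\<rbrakk> \<Longrightarrow> \<exists>S. is_biproduct K A B S"

text \<open>The direct sum \<open>f \<oplus> g : A \<oplus> A' \<rightarrow> B \<oplus> B'\<close> of \<open>f : A \<rightarrow> B\<close> and \<open>g : A' \<rightarrow> B'\<close>, relative to
  chosen biproducts \<open>S\<close> of \<open>A, A'\<close> and \<open>T\<close> of \<open>B, B'\<close>.\<close>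

definition dsum_mor ::
    "('o, 'm, 'z) cat_scheme \<Rightarrow> ('o, 'm) biprod \<Rightarrow> ('o, 'm) biprod \<Rightarrow> 'm \<Rightarrow> 'm \<Rightarrow> 'm" where
  "dsum_mor K S T f g =
     (inl T \<cdot>\<^bsub>K\<^esub> f \<cdot>\<^bsub>K\<^esub> prl S) \<otimes>\<^bsub>Hom K (dsum S) (dsum T)\<^esub> (inr T \<cdot>\<^bsub>K\<^esub> g \<cdot>\<^bsub>K\<^esub> prr S)"


section \<open>Ideal quotients\<close>

definition fact_ideal :: "('o, 'm, 'z) cat_scheme \<Rightarrow> 'o set \<Rightarrow> 'o \<Rightarrow> 'o \<Rightarrow> 'm set" where
  "fact_ideal K I A B = {g \<cdot>\<^bsub>K\<^esub> f | f g X. X \<in> I \<and> f \<in> Mor K A X \<and> g \<in> Mor K X B}"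

text \<open>Since hom-sets are disjoint, the union in the composition below ranges over one and the same
  coset for composable classes \<open>P\<close> and \<open>Q\<close> (compare \<open>FactRing\<close>).\<close>

definition ideal_quotient :: "('o, 'm, 'z) cat_scheme \<Rightarrow> 'o set \<Rightarrow> ('o, 'm set) cat" where
  "ideal_quotient K I =
     \<lparr> obj = obj K,
       Hom = (\<lambda>A B. Hom K A B Mod fact_ideal K I A B),
       comp = (\<lambda>Q P. \<Union> {fact_ideal K I A C #>\<^bsub>Hom K A C\<^esub> (g \<cdot>\<^bsub>K\<^esub> f) | A C f g.
                 A \<in> obj K \<and> C \<in> obj K \<and> f \<in> P \<and> g \<in> Q \<and> g \<cdot>\<^bsub>K\<^esub> f \<in> Mor K A C}),
       ident = (\<lambda>A. fact_ideal K I A A #>\<^bsub>Hom K A A\<^esub> ident K A) \<rparr>"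


section \<open>Extriangulated categories\<close>

text \<open>\<open>Ext F C A\<close> is the group \<open>\<bbbE>(C, A)\<close>, \<open>ExtMap F c a\<close> is \<open>\<bbbE>(c, a)\<close>, and \<open>Real F C A \<delta>\<close> is the
  class \<open>\<ss>(\<delta>)\<close> for \<open>\<delta> \<in> \<bbbE>(C, A)\<close>, a set of triples \<open>(B, x, y)\<close> standing for sequences
  \<open>A \<rightarrow> B \<rightarrow> C\<close>.\<close>

record ('o, 'm, 'e) extcat = "('o, 'm) cat" +
  Ext    :: "'o \<Rightarrow> 'o \<Rightarrow> 'e monoid"
  ExtMap :: "'m \<Rightarrow> 'm \<Rightarrow> 'e \<Rightarrow> 'e"
  Real   :: "'o \<Rightarrow> 'o \<Rightarrow> 'e \<Rightarrow> ('o \<times> 'm \<times> 'm) set"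

abbreviation Exts :: "('o, 'm, 'e, 'z) extcat_scheme \<Rightarrow> 'o \<Rightarrow> 'o \<Rightarrow> 'e set"
  where "Exts F C A \<equiv> carrier (Ext F C A)"

abbreviation ezero :: "('o, 'm, 'e, 'z) extcat_scheme \<Rightarrow> 'o \<Rightarrow> 'o \<Rightarrow> 'e"
  where "ezero F C A \<equiv> \<one>\<^bsub>Ext F C A\<^esub>"

text \<open>\<open>push F C a \<delta>\<close> is \<open>a\<^sub>*\<delta>\<close> for \<open>\<delta> \<in> \<bbbE>(C, A)\<close>; \<open>pull F A c \<delta>\<close> is \<open>c\<^sup>*\<delta>\<close>.\<close>

definition push :: "('o, 'm, 'e, 'z) extcat_scheme \<Rightarrow> 'o \<Rightarrow> 'm \<Rightarrow> 'e \<Rightarrow> 'e" where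
  "push F C a \<delta> = ExtMap F (ident F C) a \<delta>"

definition pull :: "('o, 'm, 'e, 'z) extcat_scheme \<Rightarrow> 'o \<Rightarrow> 'm \<Rightarrow> 'e \<Rightarrow> 'e" where
  "pull F A c \<delta> = ExtMap F c (ident F A) \<delta>"

definition ext_mor ::
    "('o, 'm, 'e, 'z) extcat_scheme \<Rightarrow> 'o \<Rightarrow> 'o \<Rightarrow> 'e \<Rightarrow> 'o \<Rightarrow> 'o \<Rightarrow> 'e \<Rightarrow> 'm \<Rightarrow> 'm \<Rightarrow> bool" where
  "ext_mor F A C \<delta> A' C' \<delta>' a c \<longleftrightarrow>
     a \<in> Mor F A A' \<and> c \<in> Mor F C C' \<and> push F C a \<delta> = pull F A' c \<delta>'"

definition seqs :: "('o, 'm, 'z) cat_scheme \<Rightarrow> 'o \<Rightarrow> 'o \<Rightarrow> ('o \<times> 'm \<times> 'm) set" where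
  "seqs K A C = {(B, x, y). B \<in> obj K \<and> x \<in> Mor K A B \<and> y \<in> Mor K B C}"

definition seq_equiv ::
    "('o, 'm, 'z) cat_scheme \<Rightarrow> 'o \<Rightarrow> 'o \<Rightarrow> (('o \<times> 'm \<times> 'm) \<times> ('o \<times> 'm \<times> 'm)) set" where
  "seq_equiv K A C =
     {((B, x, y), (B', x', y')). (B, x, y) \<in> seqs K A C \<and> (B', x', y') \<in> seqs K A C \<and>
        (\<exists>b. is_iso K B B' b \<and> b \<cdot>\<^bsub>K\<^esub> x = x' \<and> y' \<cdot>\<^bsub>K\<^esub> b = y)}"

text \<open>\<open>realizes F A C \<delta> B x y\<close> says \<open>\<ss>(\<delta>) = [A \<rightarrow> B \<rightarrow> C]\<close> with maps \<open>x\<close> and \<open>y\<close>.\<close>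

definition realizes ::
    "('o, 'm, 'e, 'z) extcat_scheme \<Rightarrow> 'o \<Rightarrow> 'o \<Rightarrow> 'e \<Rightarrow> 'o \<Rightarrow> 'm \<Rightarrow> 'm \<Rightarrow> bool" where
  "realizes F A C \<delta> B x y \<longleftrightarrow>
     (B, x, y) \<in> seqs F A C \<and> Real F C A \<delta> = seq_equiv F A C `` {(B, x, y)}"

definition etriangle ::
    "('o, 'm, 'e, 'z) extcat_scheme \<Rightarrow> 'o \<Rightarrow> 'o \<Rightarrow> 'o \<Rightarrow> 'm \<Rightarrow> 'm \<Rightarrow> 'e \<Rightarrow> bool" where
  "etriangle F A B C x y \<delta> \<longleftrightarrow>
     A \<in> obj F \<and> B \<in> obj F \<and> C \<in> obj F \<and> \<delta> \<in> Exts F C A \<and> realizes F A C \<delta> B x y"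

text \<open>\<open>\<epsilon> = \<delta> \<oplus> \<delta>'\<close>: the element of \<open>\<bbbE>(C \<oplus> C', A \<oplus> A')\<close> with components
  \<open>(\<delta>, 0, 0, \<delta>')\<close> in \<open>\<bbbE>(C, A) \<oplus> \<bbbE>(C, A') \<oplus> \<bbbE>(C', A) \<oplus> \<bbbE>(C', A')\<close>.
  Here \<open>S\<close> and \<open>T\<close> are biproducts of \<open>A, A'\<close> and of \<open>C, C'\<close>.\<close>

definition is_ext_sum ::
    "('o, 'm, 'e, 'z) extcat_scheme \<Rightarrow> ('o, 'm) biprod \<Rightarrow> ('o, 'm) biprod \<Rightarrow>
     'o \<Rightarrow> 'o \<Rightarrow> 'e \<Rightarrow> 'o \<Rightarrow> 'o \<Rightarrow> 'e \<Rightarrow> 'e \<Rightarrow> bool" where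
  "is_ext_sum F S T A C \<delta> A' C' \<delta>' \<epsilon> \<longleftrightarrow>
     \<epsilon> \<in> Exts F (dsum T) (dsum S) \<and>
     ExtMap F (inl T) (prl S) \<epsilon> = \<delta> \<and>
     ExtMap F (inl T) (prr S) \<epsilon> = ezero F C A' \<and>
     ExtMap F (inr T) (prl S) \<epsilon> = ezero F C' A \<and>
     ExtMap F (inr T) (prr S) \<epsilon> = \<delta>'"

text \<open>A functor \<open>\<bbbE> : \<C>\<^sup>o\<^sup>p \<times> \<C> \<rightarrow> Ab\<close>.\<close>

locale ext_bifunctor = additive_category F
  for F :: "('o, 'm, 'e, 'z) extcat_scheme" (structure) +
  assumes Ext_group: "\<lbrakk>C \<in> obj F; A \<in> obj F\<rbrakk> \<Longrightarrow> comm_group (Ext F C A)"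
    and ExtMap_hom:
      "\<lbrakk>A \<in> obj F; A' \<in> obj F; C \<in> obj F; C' \<in> obj F; c \<in> Mor F C' C; a \<in> Mor F A A'\<rbrakk>
        \<Longrightarrow> ExtMap F c a \<in> hom (Ext F C A) (Ext F C' A')"
    and ExtMap_ident:
      "\<lbrakk>A \<in> obj F; C \<in> obj F; \<delta> \<in> Exts F C A\<rbrakk> \<Longrightarrow> ExtMap F (ident F C) (ident F A) \<delta> = \<delta>"
    and ExtMap_comp:
      "\<lbrakk>A \<in> obj F; A' \<in> obj F; A'' \<in> obj F; C \<in> obj F; C' \<in> obj F; C'' \<in> obj F;
        c \<in> Mor F C' C; c' \<in> Mor F C'' C'; a \<in> Mor F A A'; a' \<in> Mor F A' A''; \<delta> \<in> Exts F C A\<rbrakk>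
        \<Longrightarrow> ExtMap F (c \<cdot> c') (a' \<cdot> a) \<delta> = ExtMap F c' a' (ExtMap F c a \<delta>)"

locale extriangulated_category = ext_bifunctor F
  for F :: "('o, 'm, 'e, 'z) extcat_scheme" (structure) +
  assumes ET1_covariant:
      "\<lbrakk>A \<in> obj F; A' \<in> obj F; C \<in> obj F; a \<in> Mor F A A'; a' \<in> Mor F A A'; \<delta> \<in> Exts F C A\<rbrakk>
        \<Longrightarrow> push F C (a \<otimes>\<^bsub>Hom F A A'\<^esub> a') \<delta> = push F C a \<delta> \<otimes>\<^bsub>Ext F C A'\<^esub> push F C a' \<delta>"
    and ET1_contravariant:
      "\<lbrakk>A \<in> obj F; C \<in> obj F; C' \<in> obj F; c \<in> Mor F C' C; c' \<in> Mor F C' C; \<delta> \<in> Exts F C A\<rbrakk>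
        \<Longrightarrow> pull F A (c \<otimes>\<^bsub>Hom F C' C\<^esub> c') \<delta> = pull F A c \<delta> \<otimes>\<^bsub>Ext F C' A\<^esub> pull F A c' \<delta>"
    and ET2_class:
      "\<lbrakk>A \<in> obj F; C \<in> obj F; \<delta> \<in> Exts F C A\<rbrakk>
        \<Longrightarrow> Real F C A \<delta> \<in> seqs F A C // seq_equiv F A C"
    and ET2_realization:
      "\<lbrakk>etriangle F A B C x y \<delta>; etriangle F A' B' C' x' y' \<delta>'; ext_mor F A C \<delta> A' C' \<delta>' a c\<rbrakk>
        \<Longrightarrow> \<exists>b \<in> Mor F B B'. b \<cdot> x = x' \<cdot> a \<and> y' \<cdot> b = c \<cdot> y"
    and ET2_zero:
      "is_biproduct F A C S \<Longrightarrow> realizes F A C (ezero F C A) (dsum S) (inl S) (prr S)"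
    and ET2_sum:
      "\<lbrakk>etriangle F A B C x y \<delta>; etriangle F A' B' C' x' y' \<delta>';
        is_biproduct F A A' S\<^sub>A; is_biproduct F B B' S\<^sub>B; is_biproduct F C C' S\<^sub>C;
        is_ext_sum F S\<^sub>A S\<^sub>C A C \<delta> A' C' \<delta>' \<epsilon>\<rbrakk>
        \<Longrightarrow> realizes F (dsum S\<^sub>A) (dsum S\<^sub>C) \<epsilon>
              (dsum S\<^sub>B) (dsum_mor F S\<^sub>A S\<^sub>B x x') (dsum_mor F S\<^sub>B S\<^sub>C y y')"
    and ET3:
      "\<lbrakk>etriangle F A B C x y \<delta>; etriangle F A' B' C' x' y' \<delta>';
        a \<in> Mor F A A'; b \<in> Mor F B B'; b \<cdot> x = x' \<cdot> a\<rbrakk>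
        \<Longrightarrow> \<exists>c. ext_mor F A C \<delta> A' C' \<delta>' a c \<and> y' \<cdot> b = c \<cdot> y"
    and ET3_op:
      "\<lbrakk>etriangle F A B C x y \<delta>; etriangle F A' B' C' x' y' \<delta>';
        b \<in> Mor F B B'; c \<in> Mor F C C'; y' \<cdot> b = c \<cdot> y\<rbrakk>
        \<Longrightarrow> \<exists>a. ext_mor F A C \<delta> A' C' \<delta>' a c \<and> b \<cdot> x = x' \<cdot> a"
    and ET4:
      "\<lbrakk>etriangle F A B D f f' \<delta>; etriangle F B C G g g' \<delta>'\<rbrakk>
        \<Longrightarrow> \<exists>E h h' \<delta>'' d e.
              etriangle F A C E h h' \<delta>'' \<and> h = g \<cdot> f \<and>
              d \<in> Mor F D E \<and> e \<in> Mor F E G \<and>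
              d \<cdot> f' = h' \<cdot> g \<and> e \<cdot> h' = g' \<and>
              realizes F D G (push F G f' \<delta>') E d e \<and>
              pull F A d \<delta>'' = \<delta> \<and>
              push F E f \<delta>'' = pull F B e \<delta>'"
    and ET4_op:
      "\<lbrakk>etriangle F D A B f' f \<delta>; etriangle F G B C g' g \<delta>'\<rbrakk>
        \<Longrightarrow> \<exists>E h h' \<delta>'' d e.
              etriangle F E A C h' h \<delta>'' \<and> h = g \<cdot> f \<and>
              d \<in> Mor F D E \<and> e \<in> Mor F E G \<and>
              h' \<cdot> d = f' \<and> f \<cdot> h' = g' \<cdot> e \<and>
              realizes F D G (pull F D g' \<delta>) E d e \<and>
              \<delta>' = push F C e \<delta>'' \<and>
              push F B d \<delta> = pull F E g \<delta>''"

definition is_conflation ::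
    "('o, 'm, 'e, 'z) extcat_scheme \<Rightarrow> 'o \<Rightarrow> 'o \<Rightarrow> 'o \<Rightarrow> 'm \<Rightarrow> 'm \<Rightarrow> bool" where
  "is_conflation F A B C x y \<longleftrightarrow> (\<exists>\<delta>. etriangle F A B C x y \<delta>)"

definition is_inflation :: "('o, 'm, 'e, 'z) extcat_scheme \<Rightarrow> 'o \<Rightarrow> 'o \<Rightarrow> 'm \<Rightarrow> bool" where
  "is_inflation F A B x \<longleftrightarrow> (\<exists>C y. is_conflation F A B C x y)"

definition is_deflation :: "('o, 'm, 'e, 'z) extcat_scheme \<Rightarrow> 'o \<Rightarrow> 'o \<Rightarrow> 'm \<Rightarrow> bool" where
  "is_deflation F B C y \<longleftrightarrow> (\<exists>A x. is_conflation F A B C x y)"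

definition WIC :: "('o, 'm, 'e, 'z) extcat_scheme \<Rightarrow> bool" where
  "WIC F \<longleftrightarrow>
     (\<forall>A \<in> obj F. \<forall>B \<in> obj F. \<forall>C \<in> obj F. \<forall>f \<in> Mor F A B. \<forall>g \<in> Mor F B C.
        (is_inflation F A C (g \<cdot>\<^bsub>F\<^esub> f) \<longrightarrow> is_inflation F A B f) \<and>
        (is_deflation F A C (g \<cdot>\<^bsub>F\<^esub> f) \<longrightarrow> is_deflation F B C g))"

definition Proj :: "('o, 'm, 'e, 'z) extcat_scheme \<Rightarrow> 'o set" where
  "Proj F = {P \<in> obj F. \<forall>B C y c. is_deflation F B C y \<longrightarrow> c \<in> Mor F P C \<longrightarrow>
                (\<exists>b \<in> Mor F P B. y \<cdot>\<^bsub>F\<^esub> b = c)}"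

definition Inj :: "('o, 'm, 'e, 'z) extcat_scheme \<Rightarrow> 'o set" where
  "Inj F = {J \<in> obj F. \<forall>A B x a. is_inflation F A B x \<longrightarrow> a \<in> Mor F A J \<longrightarrow>
                (\<exists>b \<in> Mor F B J. b \<cdot>\<^bsub>F\<^esub> x = a)}"

definition enough_projectives :: "('o, 'm, 'e, 'z) extcat_scheme \<Rightarrow> bool" where
  "enough_projectives F \<longleftrightarrow> (\<forall>C \<in> obj F. \<exists>A P x y. P \<in> Proj F \<and> is_conflation F A P C x y)"

definition enough_injectives :: "('o, 'm, 'e, 'z) extcat_scheme \<Rightarrow> bool" where
  "enough_injectives F \<longleftrightarrow> (\<forall>A \<in> obj F. \<exists>J C x y. J \<in> Inj F \<and> is_conflation F A J C x y)"

locale frobenius_extriangulated_category = extriangulated_category F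
  for F :: "('o, 'm, 'e, 'z) extcat_scheme" (structure) +
  assumes enough_proj: "enough_projectives F"
    and enough_inj: "enough_injectives F"
    and Proj_eq_Inj: "Proj F = Inj F"


section \<open>Triangulated categories\<close>

definition is_additive_endofunctor ::
    "('o, 'm, 'z) cat_scheme \<Rightarrow> ('o \<Rightarrow> 'o) \<Rightarrow> ('m \<Rightarrow> 'm) \<Rightarrow> bool" where
  "is_additive_endofunctor K So Sm \<longleftrightarrow>
     (\<forall>A \<in> obj K. So A \<in> obj K \<and> Sm (ident K A) = ident K (So A)) \<and>
     (\<forall>A \<in> obj K. \<forall>B \<in> obj K. Sm \<in> hom (Hom K A B) (Hom K (So A) (So B))) \<and>
     (\<forall>A \<in> obj K. \<forall>B \<in> obj K. \<forall>C \<in> obj K. \<forall>f \<in> Mor K A B. \<forall>g \<in> Mor K B C.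
        Sm (g \<cdot>\<^bsub>K\<^esub> f) = Sm g \<cdot>\<^bsub>K\<^esub> Sm f)"

definition is_natural_iso ::
    "('o, 'm, 'z) cat_scheme \<Rightarrow> ('o \<Rightarrow> 'o) \<Rightarrow> ('m \<Rightarrow> 'm) \<Rightarrow> ('o \<Rightarrow> 'o) \<Rightarrow> ('m \<Rightarrow> 'm) \<Rightarrow>
     ('o \<Rightarrow> 'm) \<Rightarrow> bool" where
  "is_natural_iso K So Sm To Tm \<eta> \<longleftrightarrow>
     (\<forall>A \<in> obj K. is_iso K (So A) (To A) (\<eta> A)) \<and>
     (\<forall>A \<in> obj K. \<forall>B \<in> obj K. \<forall>f \<in> Mor K A B. \<eta> B \<cdot>\<^bsub>K\<^esub> Sm f = Tm f \<cdot>\<^bsub>K\<^esub> \<eta> A)"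

definition is_additive_autoequivalence ::
    "('o, 'm, 'z) cat_scheme \<Rightarrow> ('o \<Rightarrow> 'o) \<Rightarrow> ('m \<Rightarrow> 'm) \<Rightarrow> bool" where
  "is_additive_autoequivalence K So Sm \<longleftrightarrow>
     is_additive_endofunctor K So Sm \<and>
     (\<exists>To Tm \<eta> \<epsilon>. is_additive_endofunctor K To Tm \<and>
        is_natural_iso K id id (To \<circ> So) (Tm \<circ> Sm) \<eta> \<and>
        is_natural_iso K (So \<circ> To) (Sm \<circ> Tm) id id \<epsilon>)"

text \<open>Verdier's axioms. The shift is an additive autoequivalence, not necessarily an automorphism.
  A tuple \<open>(X, Y, Z, u, v, w)\<close> stands for a triangle \<open>X \<rightarrow> Y \<rightarrow> Z \<rightarrow> \<Sigma>X\<close> with maps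
  \<open>u\<close>, \<open>v\<close>, \<open>w\<close>.\<close>

definition triangles ::
    "('o, 'm, 'z) cat_scheme \<Rightarrow> ('o \<Rightarrow> 'o) \<Rightarrow> ('o \<times> 'o \<times> 'o \<times> 'm \<times> 'm \<times> 'm) set" where
  "triangles K So = {(X, Y, Z, u, v, w). X \<in> obj K \<and> Y \<in> obj K \<and> Z \<in> obj K \<and>
     u \<in> Mor K X Y \<and> v \<in> Mor K Y Z \<and> w \<in> Mor K Z (So X)}"

locale triangulated_category = additive_category K
  for K :: "('o, 'm, 'z) cat_scheme" (structure) +
  fixes So :: "'o \<Rightarrow> 'o"
    and Sm :: "'m \<Rightarrow> 'm"
    and Dist :: "('o \<times> 'o \<times> 'o \<times> 'm \<times> 'm \<times> 'm) set"
  assumes shift: "is_additive_autoequivalence K So Sm"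
    and Dist_triangles: "Dist \<subseteq> triangles K So"
    and TR1_iso:
      "\<lbrakk>(X, Y, Z, u, v, w) \<in> Dist; (X', Y', Z', u', v', w') \<in> triangles K So;
        is_iso K X X' a; is_iso K Y Y' b; is_iso K Z Z' c;
        b \<cdot> u = u' \<cdot> a; c \<cdot> v = v' \<cdot> b; Sm a \<cdot> w = w' \<cdot> c\<rbrakk>
        \<Longrightarrow> (X', Y', Z', u', v', w') \<in> Dist"
    and TR1_ident:
      "\<lbrakk>X \<in> obj K; is_zero_obj K Z\<rbrakk>
        \<Longrightarrow> (X, X, Z, ident K X, mzero K X Z, mzero K Z (So X)) \<in> Dist"
    and TR1_complete:
      "\<lbrakk>X \<in> obj K; Y \<in> obj K; u \<in> Mor K X Y\<rbrakk> \<Longrightarrow> \<exists>Z v w. (X, Y, Z, u, v, w) \<in> Dist"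
    and TR2:
      "(X, Y, Z, u, v, w) \<in> triangles K So \<Longrightarrow>
        (X, Y, Z, u, v, w) \<in> Dist \<longleftrightarrow>
        (Y, Z, So X, v, w, inv\<^bsub>Hom K (So X) (So Y)\<^esub> (Sm u)) \<in> Dist"
    and TR3:
      "\<lbrakk>(X, Y, Z, u, v, w) \<in> Dist; (X', Y', Z', u', v', w') \<in> Dist;
        a \<in> Mor K X X'; b \<in> Mor K Y Y'; b \<cdot> u = u' \<cdot> a\<rbrakk>
        \<Longrightarrow> \<exists>c \<in> Mor K Z Z'. c \<cdot> v = v' \<cdot> b \<and> Sm a \<cdot> w = w' \<cdot> c"
    and TR4:
      "\<lbrakk>(X, Y, Z', u, i, i') \<in> Dist; (Y, Z, X', v, j, j') \<in> Dist;
        (X, Z, Y', v \<cdot> u, k, k') \<in> Dist\<rbrakk>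
        \<Longrightarrow> \<exists>f \<in> Mor K Z' Y'. \<exists>g \<in> Mor K Y' X'.
              (Z', Y', X', f, g, Sm i \<cdot> j') \<in> Dist \<and>
              f \<cdot> i = k \<cdot> v \<and> k' \<cdot> f = i' \<and>
              g \<cdot> k = j \<and> j' \<cdot> g = Sm u \<cdot> k'"

end

theory Submission
  imports Defs
begin

text \<open>
  An extension with projective-injective middle term \<open>A \<rightarrow> J \<rightarrow> S\<close>, with class
  \<open>\<omega> \<in> \<bbbE>(S, A)\<close>, is universal modulo \<open>\<I>\<close>: every element of \<open>\<bbbE>(C, A)\<close> is \<open>c\<^sup>*\<omega>\<close> and every
  element of \<open>\<bbbE>(S, B)\<close> is \<open>a\<^sub>*\<omega>\<close>, for \<open>c\<close> and \<open>a\<close> unique in the stable category. Hence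
  \<open>\<bbbE>(C, A)\<close> is the group of stable morphisms \<open>C \<rightarrow> \<Sigma>A\<close>, where \<open>\<Sigma>A = S\<close>, and \<open>\<Sigma>\<close> is an
  autoequivalence. The stable category is again extriangulated, up to the additivity of the
  realization, and there the objects of \<open>\<I>\<close> are zero. Its \<open>\<bbbE>\<close>-triangles
  \<open>A \<rightarrow> B \<rightarrow> C\<close> with class \<open>w\<^sup>*\<omega>\<close> are the distinguished triangles \<open>A \<rightarrow> B \<rightarrow> C \<rightarrow> \<Sigma>A\<close> with
  last map \<open>w\<close>: (TR3) is (ET3), the octahedral axiom is (ET4), and rotation and the existence of
  triangles both follow from a backward rotation, itself obtained by using (ET4) twice. The five
  lemma is not needed in full: a morphism \<open>(1, 1, c)\<close> from a triangle to itself satisfies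
  \<open>(c - 1)\<^sup>2 = 0\<close>, so that \<open>c\<close> is invertible.
\<close>

section \<open>Morphisms and extensions with implicit domains\<close>

text \<open>In \<open>F\<close> itself, comparison maps between sequences are determined only up to
  maps through \<I>, and a construction of cones there would carry these choices along. The quotient
  is therefore formed before any triangle is built: once the objects of \<I> are zero,
  factorizations through universal extensions are unique, and every identity that involves the shift
  can be tested as an equation between extensions. The price is a transport of structure. The
  extension groups stay the same, so equations between extensions pass to the quotient unchanged; a
  square that commutes in the quotient, however, has to be made commutative in \<open>F\<close>
  before (ET3) applies, and composable maps of the quotient need not come from composable sequences,
  which is the difficulty in (ET4). Arguments needed both in \<open>F\<close> and in its quotient
  are stated for an abstract relation \<open>D\<close> between a pair of maps and an extension.
  Closure under change of middle term (\<open>D_mid\<close>) stands in for equivalence classes of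
  sequences, and additivity of the realization enters through the split sequences
  (\<open>D_split\<close>), both inclusions of one direct sum being used in the backward
  rotation.\<close>

context category
begin

text \<open>Since hom-sets are disjoint, domain and codomain can be read off from the morphism;
  typing conditions then become equations that rewriting can discharge.\<close>

definition arr :: "'m \<Rightarrow> bool" where
  "arr f \<longleftrightarrow> (\<exists>A\<in>obj K. \<exists>B\<in>obj K. f \<in> Mor K A B)"

definition dm :: "'m \<Rightarrow> 'o" where
  "dm f = (THE A. A \<in> obj K \<and> (\<exists>B\<in>obj K. f \<in> Mor K A B))"

definition cd :: "'m \<Rightarrow> 'o" where
  "cd f = (THE B. B \<in> obj K \<and> (\<exists>A\<in>obj K. f \<in> Mor K A B))"

lemma dm_cd_eq:
  assumes "A \<in> obj K" "B \<in> obj K" "f \<in> Mor K A B"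
  shows "dm f = A" "cd f = B"
  unfolding dm_def cd_def using assms Hom_disjoint by (blast intro!: the_equality)+

lemma Mor_iff: "A \<in> obj K \<Longrightarrow> B \<in> obj K \<Longrightarrow> f \<in> Mor K A B \<longleftrightarrow> arr f \<and> dm f = A \<and> cd f = B"
  using dm_cd_eq unfolding arr_def by metis

lemma dm_obj [simp]: "arr f \<Longrightarrow> dm f \<in> obj K" and cd_obj [simp]: "arr f \<Longrightarrow> cd f \<in> obj K"
  using dm_cd_eq unfolding arr_def by metis+

lemma arr_mem: "arr f \<Longrightarrow> f \<in> Mor K (dm f) (cd f)"
  by (simp add: Mor_iff)

lemma arr_comp [simp]:
  assumes "arr f" "arr g" "dm g = cd f"
  shows "arr (g \<cdot> f)" "dm (g \<cdot> f) = dm f" "cd (g \<cdot> f) = cd g"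
proof -
  have "g \<cdot> f \<in> Mor K (dm f) (cd g)"
    using comp_closed[OF _ _ _ arr_mem, of f "cd g" g] arr_mem[of g] assms by simp
  then show "arr (g \<cdot> f)" "dm (g \<cdot> f) = dm f" "cd (g \<cdot> f) = cd g"
    using assms by (simp_all add: Mor_iff)
qed

lemma arr_ident [simp]: "A \<in> obj K \<Longrightarrow> arr (ident K A)"
  and dm_ident [simp]: "A \<in> obj K \<Longrightarrow> dm (ident K A) = A"
  and cd_ident [simp]: "A \<in> obj K \<Longrightarrow> cd (ident K A) = A"
  using ident_closed[of A] by (simp_all add: Mor_iff)

lemma assoc [simp]:
  "\<lbrakk>arr f; arr g; arr h; dm g = cd f; dm h = cd g\<rbrakk> \<Longrightarrow> (h \<cdot> g) \<cdot> f = h \<cdot> (g \<cdot> f)"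
  by (rule comp_assoc[of "dm f" "cd f" "cd g" "cd h"]) (simp_all add: Mor_iff)

lemma comp_ident [simp]: "arr f \<Longrightarrow> A = dm f \<Longrightarrow> f \<cdot> ident K A = f"
  "arr f \<Longrightarrow> A = cd f \<Longrightarrow> ident K A \<cdot> f = f"
  using comp_ident_right[of "dm f" "cd f" f] comp_ident_left[of "dm f" "cd f" f]
  by (simp_all add: Mor_iff)

text \<open>Composites are normalized to the right, so an equation between two composites no longer
  matches after precomposition; this is the same equation in the form in which it then
  occurs.\<close>

lemma comp_eqD:
  assumes "g \<cdot> f = g' \<cdot> f'" "arr f" "arr g" "dm g = cd f" "arr f'" "arr g'" "dm g' = cd f'"
    "arr h" "cd h = dm f"
  shows "g \<cdot> (f \<cdot> h) = g' \<cdot> (f' \<cdot> h)"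
proof -
  have "dm f' = dm f" using assms arr_comp(2) by metis
  then have "(g \<cdot> f) \<cdot> h = g \<cdot> (f \<cdot> h)" "(g' \<cdot> f') \<cdot> h = g' \<cdot> (f' \<cdot> h)"
    using assms(2-) by simp_all
  then show ?thesis using assms(1) by metis
qed

lemma comp_ident_cancel:
  assumes "g \<cdot> f = ident K (dm f)" "arr f" "arr g" "dm g = cd f" "arr h" "cd h = dm f"
  shows "g \<cdot> (f \<cdot> h) = h"
  using assoc[of h f g] assms by simp

definition inverses :: "'m \<Rightarrow> 'm \<Rightarrow> bool" where
  "inverses f g \<longleftrightarrow> arr f \<and> arr g \<and> dm g = cd f \<and> cd g = dm f \<and>
    g \<cdot> f = ident K (dm f) \<and> f \<cdot> g = ident K (cd f)"

lemma inversesD: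
  assumes "inverses f g"
  shows "arr f" "arr g" "dm g = cd f" "cd g = dm f" "g \<cdot> f = ident K (dm f)"
    "f \<cdot> g = ident K (cd f)"
    "\<And>h. arr h \<Longrightarrow> cd h = dm f \<Longrightarrow> g \<cdot> (f \<cdot> h) = h"
    "\<And>h. arr h \<Longrightarrow> cd h = cd f \<Longrightarrow> f \<cdot> (g \<cdot> h) = h"
  using assms comp_ident_cancel[of g f] comp_ident_cancel[of f g] unfolding inverses_def by auto

lemma inverses_sym: "inverses f g \<Longrightarrow> inverses g f"
  unfolding inverses_def by simp

lemma inverses_ident: "A \<in> obj K \<Longrightarrow> inverses (ident K A) (ident K A)"
  unfolding inverses_def by simp

lemma inverses_comp:
  assumes f: "inverses f f'" and g: "inverses g g'" and "dm g = cd f"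
  shows "inverses (g \<cdot> f) (f' \<cdot> g')"
  using assms(3) inversesD[OF f] inversesD[OF g] unfolding inverses_def by simp

lemma inverses_left_right:
  assumes "arr f" "arr g" "arr h" "dm g = cd f" "cd g = dm f" "dm h = cd f" "cd h = dm f"
    and "g \<cdot> f = ident K (dm f)" "f \<cdot> h = ident K (cd f)"
  shows "inverses f g"
proof -
  have "g = g \<cdot> (f \<cdot> h)" using assms by simp
  also have "\<dots> = h" using assms comp_ident_cancel[of g f h] by simp
  finally show ?thesis using assms unfolding inverses_def by simp
qed

lemma is_iso_iff:
  assumes "A \<in> obj K" "B \<in> obj K"
  shows "is_iso K A B f \<longleftrightarrow> dm f = A \<and> cd f = B \<and> (\<exists>g. inverses f g)"
  using assms unfolding is_iso_def inverses_def by (auto simp: Mor_iff)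

end

section \<open>Additive calculus of morphisms\<close>

context preadditive_category
begin

text \<open>The hom-group is taken from the first summand alone, so that sums carry no annotation;
  the value is meaningful only for parallel morphisms.\<close>

definition pl :: "'m \<Rightarrow> 'm \<Rightarrow> 'm" (infixl "\<boxplus>" 65) where
  "f \<boxplus> g = f \<otimes>\<^bsub>Hom K (dm f) (cd f)\<^esub> g"

definition ng :: "'m \<Rightarrow> 'm" where
  "ng f = inv\<^bsub>Hom K (dm f) (cd f)\<^esub> f"

abbreviation zr :: "'o \<Rightarrow> 'o \<Rightarrow> 'm" where
  "zr \<equiv> mzero K"

lemma mult_eq: "\<lbrakk>A \<in> obj K; B \<in> obj K; dm f = A; cd f = B\<rbrakk> \<Longrightarrow> f \<otimes>\<^bsub>Hom K A B\<^esub> g = f \<boxplus> g"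
  by (simp add: pl_def)

lemma arr_pl [simp]:
  assumes "arr f" "arr g" "dm g = dm f" "cd g = cd f"
  shows "arr (f \<boxplus> g)" "dm (f \<boxplus> g) = dm f" "cd (f \<boxplus> g) = cd f"
proof -
  interpret comm_group "Hom K (dm f) (cd f)" using assms by (simp add: Hom_group)
  have "f \<boxplus> g \<in> Mor K (dm f) (cd f)"
    unfolding pl_def using arr_mem[of f] arr_mem[of g] assms by simp
  then show "arr (f \<boxplus> g)" "dm (f \<boxplus> g) = dm f" "cd (f \<boxplus> g) = cd f"
    using assms by (simp_all add: Mor_iff)
qed

lemma arr_ng [simp]:
  assumes "arr f"
  shows "arr (ng f)" "dm (ng f) = dm f" "cd (ng f) = cd f"
proof -
  interpret comm_group "Hom K (dm f) (cd f)" using assms by (simp add: Hom_group)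
  have "ng f \<in> Mor K (dm f) (cd f)"
    unfolding ng_def using arr_mem[of f] assms by simp
  then show "arr (ng f)" "dm (ng f) = dm f" "cd (ng f) = cd f"
    using assms by (simp_all add: Mor_iff)
qed

lemma arr_zr [simp]:
  assumes "A \<in> obj K" "B \<in> obj K"
  shows "arr (zr A B)" "dm (zr A B) = A" "cd (zr A B) = B"
proof -
  interpret comm_group "Hom K A B" using assms by (simp add: Hom_group)
  show "arr (zr A B)" "dm (zr A B) = A" "cd (zr A B) = B"
    using one_closed unfolding Mor_iff[OF assms] by blast+
qed

lemma pl_assoc:
  "\<lbrakk>arr f; arr g; arr h; dm g = dm f; cd g = cd f; dm h = dm f; cd h = cd f\<rbrakk>
    \<Longrightarrow> f \<boxplus> g \<boxplus> h = f \<boxplus> (g \<boxplus> h)"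
proof -
  assume a: "arr f" "arr g" "arr h" "dm g = dm f" "cd g = cd f" "dm h = dm f" "cd h = cd f"
  then interpret comm_group "Hom K (dm f) (cd f)" by (simp add: Hom_group)
  show ?thesis
    using m_assoc[of f g h] arr_mem[of f] arr_mem[of g] arr_mem[of h] a
    by (metis arr_pl pl_def)
qed

lemma pl_comm:
  "\<lbrakk>arr f; arr g; dm g = dm f; cd g = cd f\<rbrakk> \<Longrightarrow> f \<boxplus> g = g \<boxplus> f"
proof -
  assume a: "arr f" "arr g" "dm g = dm f" "cd g = cd f"
  then interpret comm_group "Hom K (dm f) (cd f)" by (simp add: Hom_group)
  show ?thesis
    using m_comm[of f g] arr_mem[of f] arr_mem[of g] a unfolding pl_def by metis
qed

lemma pl_lcomm:
  "\<lbrakk>arr f; arr g; arr h; dm g = dm f; cd g = cd f; dm h = dm f; cd h = cd f\<rbrakk>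
    \<Longrightarrow> f \<boxplus> (g \<boxplus> h) = g \<boxplus> (f \<boxplus> h)"
  using pl_assoc[of f g h] pl_assoc[of g f h] pl_comm[of f g] by simp

lemmas pl_ac = pl_assoc pl_comm pl_lcomm

lemma pl_zr [simp]:
  assumes "arr f" "A = dm f" "B = cd f"
  shows "f \<boxplus> zr A B = f" "zr A B \<boxplus> f = f"
proof -
  interpret comm_group "Hom K (dm f) (cd f)" using assms by (simp add: Hom_group)
  show "f \<boxplus> zr A B = f" "zr A B \<boxplus> f = f"
    using r_one[OF arr_mem] l_one[OF arr_mem] assms by (simp_all add: pl_def)
qed

lemma pl_ng [simp]:
  assumes "arr f"
  shows "f \<boxplus> ng f = zr (dm f) (cd f)" "ng f \<boxplus> f = zr (dm f) (cd f)"
proof -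
  interpret comm_group "Hom K (dm f) (cd f)" using assms by (simp add: Hom_group)
  show "f \<boxplus> ng f = zr (dm f) (cd f)" "ng f \<boxplus> f = zr (dm f) (cd f)"
    using r_inv[OF arr_mem] l_inv[OF arr_mem] assms
    by (simp_all add: pl_def flip: ng_def)
qed

lemma pl_ng_cancel [simp]:
  assumes "arr f" "arr g" "dm g = dm f" "cd g = cd f"
  shows "f \<boxplus> (ng f \<boxplus> g) = g" "ng f \<boxplus> (f \<boxplus> g) = g"
  using assms by (simp_all add: pl_assoc[symmetric])

lemma ng_unique:
  assumes "f \<boxplus> g = zr (dm f) (cd f)" "arr f" "arr g" "dm g = dm f" "cd g = cd f"
  shows "g = ng f"
  using pl_ng_cancel(2)[of f g] assms by simp

lemma ng_zr [simp]: "A \<in> obj K \<Longrightarrow> B \<in> obj K \<Longrightarrow> ng (zr A B) = zr A B"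
  by (rule ng_unique[symmetric]) simp_all

lemma diff_zr_iff:
  assumes "arr f" "arr g" "dm g = dm f" "cd g = cd f"
  shows "f \<boxplus> ng g = zr (dm f) (cd f) \<longleftrightarrow> f = g"
proof
  assume "f \<boxplus> ng g = zr (dm f) (cd f)"
  then have "f \<boxplus> ng g \<boxplus> g = g" using assms by simp
  then show "f = g" using assms by (simp add: pl_assoc del: pl_ng(1))
qed (use assms in simp)

lemma comp_pl [simp]:
  assumes "arr f" "arr f'" "dm f' = dm f" "cd f' = cd f" "arr g" "dm g = cd f"
  shows "g \<cdot> (f \<boxplus> f') = g \<cdot> f \<boxplus> g \<cdot> f'"
  using comp_add_right[of "dm f" "cd f" "cd g" f f' g] assms by (simp add: pl_def Mor_iff)

lemma pl_comp [simp]: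
  assumes "arr g" "arr g'" "dm g' = dm g" "cd g' = cd g" "arr f" "dm g = cd f"
  shows "(g \<boxplus> g') \<cdot> f = g \<cdot> f \<boxplus> g' \<cdot> f"
  using comp_add_left[of "dm f" "cd f" "cd g" f g g'] assms by (simp add: pl_def Mor_iff)

lemma pl_idem_zr:
  assumes "f \<boxplus> f = f" "arr f" shows "f = zr (dm f) (cd f)"
  using pl_ng_cancel(2)[of f f] assms by simp

lemma comp_zr [simp]:
  assumes "arr f" "A \<in> obj K"
  shows "dm f = B \<Longrightarrow> f \<cdot> zr A B = zr A (cd f)" "cd f = B \<Longrightarrow> zr B A \<cdot> f = zr (dm f) A"
proof -
  assume B: "dm f = B"
  have "f \<cdot> zr A (dm f) \<boxplus> f \<cdot> zr A (dm f) = f \<cdot> zr A (dm f)"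
    using assms comp_pl[of "zr A (dm f)" "zr A (dm f)" f] by (simp del: comp_pl)
  then show "f \<cdot> zr A B = zr A (cd f)"
    unfolding B[symmetric] using pl_idem_zr[of "f \<cdot> zr A (dm f)"] assms by simp
next
  assume B: "cd f = B"
  have "zr (cd f) A \<cdot> f \<boxplus> zr (cd f) A \<cdot> f = zr (cd f) A \<cdot> f"
    using assms pl_comp[of "zr (cd f) A" "zr (cd f) A" f] by (simp del: pl_comp)
  then show "zr B A \<cdot> f = zr (dm f) A"
    unfolding B[symmetric] using pl_idem_zr[of "zr (cd f) A \<cdot> f"] assms by simp
qed

lemma comp_ng [simp]:
  assumes "arr f" "arr g" "dm g = cd f"
  shows "g \<cdot> ng f = ng (g \<cdot> f)" "ng g \<cdot> f = ng (g \<cdot> f)"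
proof -
  have "g \<cdot> f \<boxplus> g \<cdot> ng f = zr (dm f) (cd g)" "g \<cdot> f \<boxplus> ng g \<cdot> f = zr (dm f) (cd g)"
    using assms comp_pl[of f "ng f" g] pl_comp[of g "ng g" f] by (simp_all del: comp_pl pl_comp)
  then show "g \<cdot> ng f = ng (g \<cdot> f)" "ng g \<cdot> f = ng (g \<cdot> f)"
    using assms by (auto intro!: ng_unique)
qed

lemma zero_objD:
  assumes "is_zero_obj K Z" "arr f"
  shows "dm f = Z \<Longrightarrow> f = zr Z (cd f)" "cd f = Z \<Longrightarrow> f = zr (dm f) Z"
  using assms arr_mem[of f] arr_mem[of "zr Z (cd f)"] arr_mem[of "zr (dm f) Z"]
  unfolding is_zero_obj_def by (metis arr_zr cd_obj dm_obj)+

lemma zero_objI: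
  assumes Z: "Z \<in> obj K" "ident K Z = zr Z Z"
  shows "is_zero_obj K Z"
proof -
  have "f = zr A Z" if "A \<in> obj K" "f \<in> Mor K A Z" for f A
  proof -
    have "f = ident K Z \<cdot> f" using that Z(1) by (simp add: Mor_iff)
    also have "\<dots> = zr A Z" unfolding Z(2) using that Z(1) by (simp add: Mor_iff)
    finally show ?thesis .
  qed
  moreover have "f = zr Z A" if "A \<in> obj K" "f \<in> Mor K Z A" for f A
  proof -
    have "f = f \<cdot> ident K Z" using that Z(1) by (simp add: Mor_iff)
    also have "\<dots> = zr Z A" unfolding Z(2) using that Z(1) by (simp add: Mor_iff)
    finally show ?thesis .
  qed
  moreover have "zr A Z \<in> Mor K A Z \<and> zr Z A \<in> Mor K Z A" if "A \<in> obj K" for A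
    using that Z(1) by (simp add: Mor_iff)
  ultimately show ?thesis
    unfolding is_zero_obj_def using Z(1) by blast
qed

lemma zero_obj_ident: "is_zero_obj K Z \<Longrightarrow> Z \<in> obj K" "is_zero_obj K Z \<Longrightarrow> ident K Z = zr Z Z"
  using zero_objD(1)[of Z "ident K Z"] by (simp_all add: is_zero_obj_def)

text \<open>Writing \<open>f = n \<boxplus> i\<close> with \<open>i\<close> the identity and
  \<open>n \<cdot> n\<close> zero, the inverse is \<open>i \<boxplus> ng n\<close>.\<close>

lemma inverses_unipotent:
  assumes "arr f" "cd f = dm f"
    and "(f \<boxplus> ng (ident K (dm f))) \<cdot> (f \<boxplus> ng (ident K (dm f))) = zr (dm f) (dm f)"
  shows "\<exists>g. inverses f g"
proof -
  define i where "i = ident K (dm f)"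
  define n where "n = f \<boxplus> ng i"
  have i: "arr i" "dm i = dm f" "cd i = dm f" "\<And>h. arr h \<Longrightarrow> cd h = dm f \<Longrightarrow> i \<cdot> h = h"
     "\<And>h. arr h \<Longrightarrow> dm h = dm f \<Longrightarrow> h \<cdot> i = h"
    using assms by (auto simp: i_def)
  have n: "arr n" "dm n = dm f" "cd n = dm f" using assms i by (auto simp: n_def)
  have nn: "n \<cdot> n = zr (dm f) (dm f)" using assms(3) by (simp add: n_def i_def)
  have f: "f = n \<boxplus> i" using assms i by (simp add: n_def pl_assoc)
  have "(i \<boxplus> ng n) \<cdot> (n \<boxplus> i) = i" "(n \<boxplus> i) \<cdot> (i \<boxplus> ng n) = i"
    using i n nn assms by (simp_all add: pl_ac)
  then have "inverses (n \<boxplus> i) (i \<boxplus> ng n)"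
    unfolding inverses_def using i n by (simp add: i_def)
  then show ?thesis using f by auto
qed

lemma biproductD:
  assumes "is_biproduct K A B S"
  shows "A \<in> obj K" "B \<in> obj K" "dsum S \<in> obj K"
    "arr (inl S)" "dm (inl S) = A" "cd (inl S) = dsum S"
    "arr (inr S)" "dm (inr S) = B" "cd (inr S) = dsum S"
    "arr (prl S)" "dm (prl S) = dsum S" "cd (prl S) = A"
    "arr (prr S)" "dm (prr S) = dsum S" "cd (prr S) = B"
    "prl S \<cdot> inl S = ident K A" "prr S \<cdot> inr S = ident K B"
    "prl S \<cdot> inr S = zr B A" "prr S \<cdot> inl S = zr A B"
    "inl S \<cdot> prl S \<boxplus> inr S \<cdot> prr S = ident K (dsum S)"
proof -
  show a: "A \<in> obj K" "B \<in> obj K" "dsum S \<in> obj K"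
    "arr (inl S)" "dm (inl S) = A" "cd (inl S) = dsum S"
    "arr (inr S)" "dm (inr S) = B" "cd (inr S) = dsum S"
    "arr (prl S)" "dm (prl S) = dsum S" "cd (prl S) = A"
    "arr (prr S)" "dm (prr S) = dsum S" "cd (prr S) = B"
    "prl S \<cdot> inl S = ident K A" "prr S \<cdot> inr S = ident K B"
    "prl S \<cdot> inr S = zr B A" "prr S \<cdot> inl S = zr A B"
    using assms unfolding is_biproduct_def by (auto simp: Mor_iff)
  show "inl S \<cdot> prl S \<boxplus> inr S \<cdot> prr S = ident K (dsum S)"
    using assms a unfolding is_biproduct_def by (simp add: pl_def)
qed

lemma biproductI:
  assumes "A \<in> obj K" "B \<in> obj K" "dsum S \<in> obj K"
    "arr (inl S)" "dm (inl S) = A" "cd (inl S) = dsum S"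
    "arr (inr S)" "dm (inr S) = B" "cd (inr S) = dsum S"
    "arr (prl S)" "dm (prl S) = dsum S" "cd (prl S) = A"
    "arr (prr S)" "dm (prr S) = dsum S" "cd (prr S) = B"
    "prl S \<cdot> inl S = ident K A" "prr S \<cdot> inr S = ident K B"
    "prl S \<cdot> inr S = zr B A" "prr S \<cdot> inl S = zr A B"
    "inl S \<cdot> prl S \<boxplus> inr S \<cdot> prr S = ident K (dsum S)"
  shows "is_biproduct K A B S"
  using assms unfolding is_biproduct_def by (simp add: Mor_iff pl_def)

end

text \<open>An element \<open>e\<close> of \<open>\<bbbE>(C, A)\<close> is carried around as the triple \<open>(C, A, e)\<close>, because the
  groups \<open>\<bbbE>(C, A)\<close> need not be disjoint. Below, \<open>a \<triangleleft> d\<close> is \<open>a\<^sub>*d\<close> and \<open>d \<triangleright> c\<close> is \<open>c\<^sup>*d\<close>.\<close>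

definition und :: "'o \<times> 'o \<times> 'e \<Rightarrow> 'e" where "und d = snd (snd d)"
definition eb :: "'o \<times> 'o \<times> 'e \<Rightarrow> 'o" where "eb d = fst d"
definition ea :: "'o \<times> 'o \<times> 'e \<Rightarrow> 'o" where "ea d = fst (snd d)"

lemma ext_triple [simp]: "eb (C, A, e) = C" "ea (C, A, e) = A" "und (C, A, e) = e"
  by (simp_all add: und_def eb_def ea_def)

lemma ext_eqI: "eb d = eb d' \<Longrightarrow> ea d = ea d' \<Longrightarrow> und d = und d' \<Longrightarrow> d = d'"
  by (cases d; cases d') simp

text \<open>Separates the biadditive functor from the realization, so that the calculus of
  extensions holds for \<open>F\<close> and for its quotient alike. In the quotient the groups
  \<open>Ex\<close> are kept and only the action \<open>EM\<close> is replaced, by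
  \<open>QEM\<close>.\<close>

locale biadditive = additive_category K
  for K :: "('o, 'm, 'z) cat_scheme" (structure) +
  fixes Ex :: "'o \<Rightarrow> 'o \<Rightarrow> 'e monoid" and EM :: "'m \<Rightarrow> 'm \<Rightarrow> 'e \<Rightarrow> 'e"
  assumes Ex_group: "\<lbrakk>C \<in> obj K; A \<in> obj K\<rbrakk> \<Longrightarrow> comm_group (Ex C A)"
    and EM_hom: "\<lbrakk>arr c; arr a\<rbrakk> \<Longrightarrow> EM c a \<in> hom (Ex (cd c) (dm a)) (Ex (dm c) (cd a))"
    and EM_ident: "\<lbrakk>A \<in> obj K; C \<in> obj K; e \<in> carrier (Ex C A)\<rbrakk>
      \<Longrightarrow> EM (ident K C) (ident K A) e = e"
    and EM_comp: "\<lbrakk>arr c; arr c'; cd c' = dm c; arr a; arr a'; dm a' = cd a;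
        e \<in> carrier (Ex (cd c) (dm a))\<rbrakk>
      \<Longrightarrow> EM (c \<cdot> c') (a' \<cdot> a) e = EM c' a' (EM c a e)"
    and EM_covariant: "\<lbrakk>arr a; arr a'; dm a' = dm a; cd a' = cd a; C \<in> obj K;
        e \<in> carrier (Ex C (dm a))\<rbrakk>
      \<Longrightarrow> EM (ident K C) (a \<boxplus> a') e
        = EM (ident K C) a e \<otimes>\<^bsub>Ex C (cd a)\<^esub> EM (ident K C) a' e"
    and EM_contravariant: "\<lbrakk>arr c; arr c'; dm c' = dm c; cd c' = cd c; A \<in> obj K;
        e \<in> carrier (Ex (cd c) A)\<rbrakk>
      \<Longrightarrow> EM (c \<boxplus> c') (ident K A) e
        = EM c (ident K A) e \<otimes>\<^bsub>Ex (dm c) A\<^esub> EM c' (ident K A) e"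
begin

definition xt :: "'o \<times> 'o \<times> 'e \<Rightarrow> bool" where
  "xt d \<longleftrightarrow> ea d \<in> obj K \<and> eb d \<in> obj K \<and> und d \<in> carrier (Ex (eb d) (ea d))"

definition la :: "'m \<Rightarrow> 'o \<times> 'o \<times> 'e \<Rightarrow> 'o \<times> 'o \<times> 'e" (infixr "\<triangleleft>" 72) where
  "a \<triangleleft> d = (eb d, cd a, EM (ident K (eb d)) a (und d))"

definition ra :: "'o \<times> 'o \<times> 'e \<Rightarrow> 'm \<Rightarrow> 'o \<times> 'o \<times> 'e" (infixl "\<triangleright>" 73) where
  "d \<triangleright> c = (dm c, ea d, EM c (ident K (ea d)) (und d))"

definition epl :: "'o \<times> 'o \<times> 'e \<Rightarrow> 'o \<times> 'o \<times> 'e \<Rightarrow> 'o \<times> 'o \<times> 'e" (infixl "\<oplus>" 65) where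
  "d \<oplus> d' = (eb d, ea d, und d \<otimes>\<^bsub>Ex (eb d) (ea d)\<^esub> und d')"

definition eng :: "'o \<times> 'o \<times> 'e \<Rightarrow> 'o \<times> 'o \<times> 'e" where
  "eng d = (eb d, ea d, inv\<^bsub>Ex (eb d) (ea d)\<^esub> und d)"

definition ezr :: "'o \<Rightarrow> 'o \<Rightarrow> 'o \<times> 'o \<times> 'e" where
  "ezr C A = (C, A, \<one>\<^bsub>Ex C A\<^esub>)"

lemma xt_obj [simp]: "xt d \<Longrightarrow> ea d \<in> obj K" "xt d \<Longrightarrow> eb d \<in> obj K"
  by (simp_all add: xt_def)

lemma xt_und: "xt d \<Longrightarrow> ea d = A \<Longrightarrow> eb d = C \<Longrightarrow> und d \<in> carrier (Ex C A)"
  unfolding xt_def by blast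

lemma xt_triple: "xt (C, A, e) \<longleftrightarrow> A \<in> obj K \<and> C \<in> obj K \<and> e \<in> carrier (Ex C A)"
  unfolding xt_def by simp

lemma EM_closed:
  "\<lbrakk>arr c; arr a; e \<in> carrier (Ex (cd c) (dm a))\<rbrakk> \<Longrightarrow> EM c a e \<in> carrier (Ex (dm c) (cd a))"
  by (rule hom_in_carrier[OF EM_hom])

lemma xt_la [simp]:
  assumes "xt d" "arr a" "dm a = ea d"
  shows "xt (a \<triangleleft> d)" "ea (a \<triangleleft> d) = cd a" "eb (a \<triangleleft> d) = eb d"
  using assms EM_closed[of "ident K (eb d)" a "und d"] by (simp_all add: la_def xt_triple xt_und)

lemma xt_ra [simp]:
  assumes "xt d" "arr c" "cd c = eb d"
  shows "xt (d \<triangleright> c)" "ea (d \<triangleright> c) = ea d" "eb (d \<triangleright> c) = dm c"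
  using assms EM_closed[of c "ident K (ea d)" "und d"] by (simp_all add: ra_def xt_triple xt_und)

lemma xt_epl [simp]:
  assumes "xt d" "xt d'" "ea d' = ea d" "eb d' = eb d"
  shows "xt (d \<oplus> d')" "ea (d \<oplus> d') = ea d" "eb (d \<oplus> d') = eb d"
proof -
  interpret comm_group "Ex (eb d) (ea d)" using assms by (simp add: Ex_group)
  show "xt (d \<oplus> d')" "ea (d \<oplus> d') = ea d" "eb (d \<oplus> d') = eb d"
    using assms by (simp_all add: epl_def xt_triple xt_und)
qed

lemma xt_eng [simp]:
  assumes "xt d"
  shows "xt (eng d)" "ea (eng d) = ea d" "eb (eng d) = eb d"
proof -
  interpret comm_group "Ex (eb d) (ea d)" using assms by (simp add: Ex_group)
  show "xt (eng d)" "ea (eng d) = ea d" "eb (eng d) = eb d"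
    using assms by (simp_all add: eng_def xt_triple xt_und)
qed

lemma xt_ezr [simp]:
  assumes "C \<in> obj K" "A \<in> obj K"
  shows "xt (ezr C A)" "ea (ezr C A) = A" "eb (ezr C A) = C"
proof -
  interpret comm_group "Ex C A" using assms by (simp add: Ex_group)
  show "xt (ezr C A)" "ea (ezr C A) = A" "eb (ezr C A) = C"
    using assms by (simp_all add: ezr_def xt_triple xt_und)
qed

lemma epl_ezr [simp]:
  assumes "xt d" "A = ea d" "C = eb d"
  shows "d \<oplus> ezr C A = d" "ezr C A \<oplus> d = d"
proof -
  interpret comm_group "Ex (eb d) (ea d)" using assms by (simp add: Ex_group)
  show "d \<oplus> ezr C A = d" "ezr C A \<oplus> d = d"
    using assms by (auto intro!: ext_eqI simp: epl_def xt_triple xt_und ezr_def)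
qed

lemma epl_assoc:
  assumes "xt d" "xt d'" "xt d''" "ea d' = ea d" "eb d' = eb d" "ea d'' = ea d" "eb d'' = eb d"
  shows "d \<oplus> d' \<oplus> d'' = d \<oplus> (d' \<oplus> d'')"
proof -
  interpret comm_group "Ex (eb d) (ea d)" using assms by (simp add: Ex_group)
  show ?thesis using assms by (simp add: epl_def xt_triple xt_und m_assoc)
qed

lemma epl_eng [simp]:
  assumes "xt d"
  shows "d \<oplus> eng d = ezr (eb d) (ea d)" "eng d \<oplus> d = ezr (eb d) (ea d)"
proof -
  interpret comm_group "Ex (eb d) (ea d)" using assms by (simp add: Ex_group)
  show "d \<oplus> eng d = ezr (eb d) (ea d)" "eng d \<oplus> d = ezr (eb d) (ea d)"
    using assms by (simp_all add: epl_def xt_triple xt_und eng_def ezr_def)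
qed

lemma eng_unique:
  assumes "d \<oplus> d' = ezr (eb d) (ea d)" "xt d" "xt d'" "ea d' = ea d" "eb d' = eb d"
  shows "d' = eng d"
proof -
  have "(eng d \<oplus> d) \<oplus> d' = eng d \<oplus> (d \<oplus> d')"
    by (rule epl_assoc) (use assms in simp_all)
  then show ?thesis using assms by simp
qed

lemma eng_unique':
  assumes "d \<oplus> d' = ezr (eb d) (ea d)" "xt d" "xt d'" "ea d' = ea d" "eb d' = eb d"
  shows "d = eng d'"
proof -
  have "(d \<oplus> d') \<oplus> eng d' = d \<oplus> (d' \<oplus> eng d')"
    by (rule epl_assoc) (use assms in simp_all)
  then show ?thesis using assms by simp
qed

lemma eng_eng [simp]: "xt d \<Longrightarrow> eng (eng d) = d"
  by (rule eng_unique[symmetric]) simp_all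

lemma epl_idem:
  assumes "d \<oplus> d = d" "xt d" shows "d = ezr (eb d) (ea d)"
proof -
  have "(eng d \<oplus> d) \<oplus> d = eng d \<oplus> (d \<oplus> d)"
    by (rule epl_assoc) (use assms in simp_all)
  then show ?thesis using assms by simp
qed

lemma diff_ezrD:
  assumes "d \<oplus> eng d' = ezr (eb d) (ea d)" "xt d" "xt d'" "ea d' = ea d" "eb d' = eb d"
  shows "d = d'"
proof -
  have "d = eng (eng d')" by (rule eng_unique') (use assms in simp_all)
  then show ?thesis using eng_eng[OF assms(3)] by (rule trans)
qed

lemma la_comp [simp]:
  assumes "xt d" "arr a" "dm a = ea d" "arr b" "dm b = cd a"
  shows "(b \<cdot> a) \<triangleleft> d = b \<triangleleft> a \<triangleleft> d"
  using assms EM_comp[of "ident K (eb d)" "ident K (eb d)" a b "und d"]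
  by (simp add: la_def xt_triple xt_und)

lemma ra_comp [simp]:
  assumes "xt d" "arr c" "cd c = eb d" "arr c'" "cd c' = dm c"
  shows "d \<triangleright> (c \<cdot> c') = d \<triangleright> c \<triangleright> c'"
  using assms EM_comp[of c c' "ident K (ea d)" "ident K (ea d)" "und d"]
  by (simp add: ra_def xt_triple xt_und)

text \<open>Bifunctoriality: \<open>EM c a\<close> factors through identities in either order. Used
  as a rewrite rule, the second part moves every pullback inside every pushout, which is the normal
  form of an extension acted on from both sides.\<close>

lemma la_ra:
  assumes "xt d" "arr a" "dm a = ea d" "arr c" "cd c = eb d"
  shows "a \<triangleleft> d \<triangleright> c = (dm c, cd a, EM c a (und d))"
    and "(a \<triangleleft> d) \<triangleright> c = a \<triangleleft> d \<triangleright> c"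
  using assms EM_comp[of c "ident K (dm c)" "ident K (ea d)" a "und d"]
    EM_comp[of "ident K (eb d)" c a "ident K (cd a)" "und d"]
  by (simp_all add: ra_def la_def xt_triple xt_und)

declare la_ra(2) [simp]

lemma la_ident [simp]: "xt d \<Longrightarrow> A = ea d \<Longrightarrow> ident K A \<triangleleft> d = d"
  and ra_ident [simp]: "xt d \<Longrightarrow> C = eb d \<Longrightarrow> d \<triangleright> ident K C = d"
  by (auto intro!: ext_eqI simp: la_def ra_def xt_triple xt_und EM_ident)

lemma la_pl [simp]:
  assumes "xt d" "arr a" "dm a = ea d" "arr a'" "dm a' = dm a" "cd a' = cd a"
  shows "(a \<boxplus> a') \<triangleleft> d = a \<triangleleft> d \<oplus> a' \<triangleleft> d"
  using assms EM_covariant[of a a' "eb d" "und d"] by (simp add: la_def epl_def xt_triple xt_und)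

lemma ra_pl [simp]:
  assumes "xt d" "arr c" "cd c = eb d" "arr c'" "dm c' = dm c" "cd c' = cd c"
  shows "d \<triangleright> (c \<boxplus> c') = d \<triangleright> c \<oplus> d \<triangleright> c'"
  using assms EM_contravariant[of c c' "ea d" "und d"] by (simp add: ra_def epl_def xt_triple xt_und)

lemma la_epl [simp]:
  assumes "xt d" "xt d'" "ea d' = ea d" "eb d' = eb d" "arr a" "dm a = ea d"
  shows "a \<triangleleft> (d \<oplus> d') = a \<triangleleft> d \<oplus> a \<triangleleft> d'"
  using assms EM_hom[of "ident K (eb d)" a] by (simp add: la_def epl_def xt_triple xt_und hom_mult)

lemma ra_epl [simp]:
  assumes "xt d" "xt d'" "ea d' = ea d" "eb d' = eb d" "arr c" "cd c = eb d"
  shows "(d \<oplus> d') \<triangleright> c = d \<triangleright> c \<oplus> d' \<triangleright> c"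
  using assms EM_hom[of c "ident K (ea d)"] by (simp add: ra_def epl_def xt_triple xt_und hom_mult)

lemma la_zr [simp]:
  assumes "xt d" "A = ea d" "B \<in> obj K"
  shows "zr A B \<triangleleft> d = ezr (eb d) B"
  using epl_idem[of "zr A B \<triangleleft> d"] la_pl[of d "zr A B" "zr A B"] assms by (simp del: la_pl)

lemma ra_zr [simp]:
  assumes "xt d" "C = eb d" "B \<in> obj K"
  shows "d \<triangleright> zr B C = ezr B (ea d)"
  using epl_idem[of "d \<triangleright> zr B C"] ra_pl[of d "zr B C" "zr B C"] assms by (simp del: ra_pl)

lemma la_ezr [simp]:
  assumes "C \<in> obj K" "arr a" "dm a = A"
  shows "a \<triangleleft> ezr C A = ezr C (cd a)"
  using epl_idem[of "a \<triangleleft> ezr C A"] la_epl[of "ezr C A" "ezr C A" a] assms by (auto simp del: la_epl)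

lemma ra_ezr [simp]:
  assumes "A \<in> obj K" "arr c" "cd c = C"
  shows "ezr C A \<triangleright> c = ezr (dm c) A"
  using epl_idem[of "ezr C A \<triangleright> c"] ra_epl[of "ezr C A" "ezr C A" c] assms by (auto simp del: ra_epl)

lemma la_ng [simp]:
  assumes "xt d" "arr a" "dm a = ea d"
  shows "ng a \<triangleleft> d = eng (a \<triangleleft> d)" "a \<triangleleft> eng d = eng (a \<triangleleft> d)"
proof -
  show "ng a \<triangleleft> d = eng (a \<triangleleft> d)"
    using assms la_pl[of d a "ng a"] by (intro eng_unique) (simp_all del: la_pl)
  show "a \<triangleleft> eng d = eng (a \<triangleleft> d)"
    using assms la_epl[of d "eng d" a] by (intro eng_unique) (simp_all del: la_epl)
qed

lemma ra_ng [simp]: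
  assumes "xt d" "arr c" "cd c = eb d"
  shows "d \<triangleright> ng c = eng (d \<triangleright> c)" "eng d \<triangleright> c = eng (d \<triangleright> c)"
proof -
  show "d \<triangleright> ng c = eng (d \<triangleright> c)"
    using assms ra_pl[of d c "ng c"] by (intro eng_unique) (simp_all del: ra_pl)
  show "eng d \<triangleright> c = eng (d \<triangleright> c)"
    using assms ra_epl[of d "eng d" c] by (intro eng_unique) (simp_all del: ra_epl)
qed

text \<open>The identity of a zero object is also a zero morphism, so it acts on extensions both
  trivially and as zero.\<close>

lemma xt_zero_obj:
  assumes "is_zero_obj K Z" "xt d"
  shows "ea d = Z \<Longrightarrow> d = ezr (eb d) Z" "eb d = Z \<Longrightarrow> d = ezr Z (ea d)"
  using assms la_ident[of d Z] ra_ident[of d Z] la_zr[of d Z Z] ra_zr[of d Z Z]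
  by (auto simp: zero_obj_ident simp del: la_ident ra_ident la_zr ra_zr)

end

section \<open>Sequences realizing extensions\<close>

text \<open>\<open>D x y d\<close> says that \<open>d\<close> is realized by the sequence with maps \<open>x\<close> and \<open>y\<close>.\<close>

locale pre_extriangulated = biadditive K Ex EM
  for K :: "('o, 'm, 'z) cat_scheme" (structure)
    and Ex :: "'o \<Rightarrow> 'o \<Rightarrow> 'e monoid" and EM :: "'m \<Rightarrow> 'm \<Rightarrow> 'e \<Rightarrow> 'e" +
  fixes D :: "'m \<Rightarrow> 'm \<Rightarrow> 'o \<times> 'o \<times> 'e \<Rightarrow> bool"
  assumes D_arr: "D x y d \<Longrightarrow>
      arr x \<and> arr y \<and> dm y = cd x \<and> xt d \<and> ea d = dm x \<and> eb d = cd y"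
    and D_exists: "xt d \<Longrightarrow> \<exists>x y. D x y d"
    and D_mid: "\<lbrakk>D x y d; inverses b b'; dm b = cd x\<rbrakk> \<Longrightarrow> D (b \<cdot> x) (y \<cdot> b') d"
    and D_split: "\<lbrakk>A \<in> obj K; C \<in> obj K\<rbrakk> \<Longrightarrow> \<exists>S. is_biproduct K A C S \<and>
      D (inl S) (prr S) (ezr C A) \<and> D (inr S) (prl S) (ezr A C)"
    and D_lift: "\<lbrakk>D x y d; D x' y' d'; arr a; dm a = dm x; cd a = dm x';
        arr c; dm c = cd y; cd c = cd y'; a \<triangleleft> d = d' \<triangleright> c\<rbrakk>
      \<Longrightarrow> \<exists>b. arr b \<and> dm b = cd x \<and> cd b = cd x' \<and> b \<cdot> x = x' \<cdot> a \<and> y' \<cdot> b = c \<cdot> y"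
    and D_ET3: "\<lbrakk>D x y d; D x' y' d'; arr a; dm a = dm x; cd a = dm x';
        arr b; dm b = cd x; cd b = cd x'; b \<cdot> x = x' \<cdot> a\<rbrakk>
      \<Longrightarrow> \<exists>c. arr c \<and> dm c = cd y \<and> cd c = cd y' \<and> y' \<cdot> b = c \<cdot> y \<and> a \<triangleleft> d = d' \<triangleright> c"
    and D_ET3_op: "\<lbrakk>D x y d; D x' y' d'; arr b; dm b = cd x; cd b = cd x';
        arr c; dm c = cd y; cd c = cd y'; y' \<cdot> b = c \<cdot> y\<rbrakk>
      \<Longrightarrow> \<exists>a. arr a \<and> dm a = dm x \<and> cd a = dm x' \<and> b \<cdot> x = x' \<cdot> a \<and> a \<triangleleft> d = d' \<triangleright> c"
begin

text \<open>A split sequence with a zero summand, moved along the isomorphism \<open>prl S\<close>.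
  Exactness below is obtained by comparing a given sequence with these two.\<close>

lemma D_trivial:
  assumes "X \<in> obj K" "is_zero_obj K Z"
  shows "D (ident K X) (zr X Z) (ezr Z X)" "D (zr Z X) (ident K X) (ezr X Z)"
proof -
  note Z [simp] = zero_obj_ident[OF assms(2)]
  obtain S where S: "is_biproduct K X Z S" "D (inl S) (prr S) (ezr Z X)"
    "D (inr S) (prl S) (ezr X Z)"
    using D_split[of X Z] assms by auto
  note B [simp] = biproductD(1-19)[OF S(1)]
  have r: "inr S = zr Z (dsum S)" "prr S = zr (dsum S) Z"
    using zero_objD[OF assms(2)] B by (metis, metis)
  have "inl S \<cdot> prl S = ident K (dsum S)"
    using biproductD(20)[OF S(1)] by (simp add: r)
  then have i: "inverses (prl S) (inl S)" unfolding inverses_def by simp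
  show "D (ident K X) (zr X Z) (ezr Z X)" "D (zr Z X) (ident K X) (ezr X Z)"
    using D_mid[OF S(2) i] D_mid[OF S(3) i] by simp_all
qed

section \<open>Exactness of a sequence that realizes an extension\<close>

lemma D_zero:
  assumes "D x y d"
  shows "y \<cdot> x = zr (dm x) (cd y)" "x \<triangleleft> d = ezr (cd y) (cd x)" "d \<triangleright> y = ezr (cd x) (dm x)"
proof -
  note [simp] = D_arr[OF assms]
  obtain Z where Z: "is_zero_obj K Z" using zero_obj_exists by blast
  note [simp] = zero_obj_ident[OF Z]
  \<comment> \<open>Each of the three vanishings is read off from a morphism to or from a trivial
    sequence, where the corresponding map or extension is zero.\<close>
  obtain c where c: "arr c" "dm c = Z" "cd c = cd y" "y \<cdot> x = c \<cdot> zr (dm x) Z"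
    using D_ET3[OF D_trivial(1)[of "dm x" Z] assms, of "ident K (dm x)" x] Z by auto
  then show "y \<cdot> x = zr (dm x) (cd y)" by simp
  obtain c where c: "arr c" "dm c = cd y" "cd c = Z" "x \<triangleleft> d = ezr Z (cd x) \<triangleright> c"
    using D_ET3[OF assms D_trivial(1)[of "cd x" Z], of x "ident K (cd x)"] Z by auto
  then show "x \<triangleleft> d = ezr (cd y) (cd x)" by simp
  obtain a where a: "arr a" "dm a = Z" "cd a = dm x" "a \<triangleleft> ezr (cd x) Z = d \<triangleright> y"
    using D_ET3_op[OF D_trivial(2)[of "cd x" Z] assms, of "ident K (cd x)" y] Z by auto
  then show "d \<triangleright> y = ezr (cd x) (dm x)" by simp
qed

text \<open>The pair of a zero map and \<open>f\<close> is the beginning of a morphism to the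
  trivial sequence \<open>0 \<rightarrow> B \<rightarrow> B\<close>, and (ET3) completes it. With
  the next three lemmas this is exactness of the long sequences at their hom terms.\<close>

lemma factor_cokernel:
  assumes "D x y d" "arr f" "dm f = cd x" "f \<cdot> x = zr (dm x) (cd f)"
  obtains g where "arr g" "dm g = cd y" "cd g = cd f" "f = g \<cdot> y"
proof -
  note [simp] = D_arr[OF assms(1)] assms(2,3)
  obtain Z where Z: "is_zero_obj K Z" using zero_obj_exists by blast
  note [simp] = zero_obj_ident[OF Z]
  show ?thesis
    using D_ET3[OF assms(1) D_trivial(2)[of "cd f" Z], of "zr (dm x) Z" f] Z that assms(4) by auto
qed

lemma factor_kernel:
  assumes "D x y d" "arr f" "cd f = cd x" "y \<cdot> f = zr (dm f) (cd y)"
  obtains g where "arr g" "dm g = dm f" "cd g = dm x" "f = x \<cdot> g"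
proof -
  note [simp] = D_arr[OF assms(1)] assms(2,3)
  obtain Z where Z: "is_zero_obj K Z" using zero_obj_exists by blast
  note [simp] = zero_obj_ident[OF Z]
  show ?thesis
    using D_ET3_op[OF D_trivial(1)[of "dm f" Z] assms(1), of f "zr Z (cd y)"] Z that assms(4) by auto
qed

lemma factor_left:
  assumes "D x y d" "arr f" "dm f = dm x" "f \<triangleleft> d = ezr (cd y) (cd f)"
  obtains g where "arr g" "dm g = cd x" "cd g = cd f" "f = g \<cdot> x"
proof -
  note [simp] = D_arr[OF assms(1)] assms(2,3)
  obtain Z where Z: "is_zero_obj K Z" using zero_obj_exists by blast
  note [simp] = zero_obj_ident[OF Z]
  show ?thesis
    using D_lift[OF assms(1) D_trivial(1)[of "cd f" Z], of f "zr (cd y) Z"] Z that assms(4) by auto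
qed

lemma factor_right:
  assumes "D x y d" "arr f" "cd f = cd y" "d \<triangleright> f = ezr (dm f) (dm x)"
  obtains g where "arr g" "dm g = dm f" "cd g = cd x" "f = y \<cdot> g"
proof -
  note [simp] = D_arr[OF assms(1)] assms(2,3)
  obtain Z where Z: "is_zero_obj K Z" using zero_obj_exists by blast
  note [simp] = zero_obj_ident[OF Z]
  show ?thesis
    using D_lift[OF D_trivial(2)[of "dm f" Z] assms(1), of "zr Z (dm x)" f] Z that assms(4)
    by auto
qed

text \<open>Exactness at an extension term: \<open>x\<close> extends over the middle term of a
  sequence realizing \<open>e\<close>, and (ET3), applied to this extension and the identity of the
  first term, produces \<open>c\<close>. The next lemma is the dual.\<close>

lemma ext_pullback:
  assumes "D x y d" "xt e" "ea e = dm x" "x \<triangleleft> e = ezr (eb e) (cd x)"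
  obtains c where "arr c" "dm c = eb e" "cd c = cd y" "e = d \<triangleright> c"
proof -
  note [simp] = D_arr[OF assms(1)] assms(2,3)
  obtain i p where e: "D i p e" using D_exists[OF assms(2)] by blast
  have [simp]: "arr i" "arr p" "dm p = cd i" "cd p = eb e" "dm i = dm x"
    using D_arr[OF e] assms(3) by simp_all
  obtain g where g: "arr g" "dm g = cd i" "cd g = cd x" "x = g \<cdot> i"
    using factor_left[OF e, of x] assms(4) by auto
  show ?thesis
    using D_ET3[OF e assms(1), of "ident K (dm x)" g] that g(1-3) g(4)[symmetric] by auto
qed

lemma ext_pushout:
  assumes "D x y d" "xt e" "eb e = cd y" "e \<triangleright> y = ezr (cd x) (ea e)"
  obtains a where "arr a" "dm a = dm x" "cd a = ea e" "e = a \<triangleleft> d"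
proof -
  note [simp] = D_arr[OF assms(1)] assms(2,3)
  obtain i p where e: "D i p e" using D_exists[OF assms(2)] by blast
  have [simp]: "arr i" "arr p" "dm p = cd i" "cd p = cd y" "dm i = ea e"
    using D_arr[OF e] assms(3) by simp_all
  show ?thesis
  proof (rule factor_right[OF e, of y])
    show "arr y" "cd y = cd p" "e \<triangleright> y = ezr (dm y) (dm i)" using assms(4) by simp_all
  next
    fix g assume g: "arr g" "dm g = dm y" "cd g = cd i" "y = p \<cdot> g"
    have "dm g = cd x" using g(2) by simp
    then show ?thesis
      using D_ET3_op[OF assms(1) e, of g "ident K (cd y)"] that g(1,3) g(4)[symmetric] by auto
  qed
qed

text \<open>In the next two lemmas, the difference \<open>n\<close> of the given endomorphism and the identity factors
  in such a way that \<open>n \<cdot> n = 0\<close>.\<close>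

lemma mid_endo:
  assumes "D x y d" "arr b" "dm b = cd x" "cd b = cd x" "b \<cdot> x = x" "y \<cdot> b = y"
  shows "\<exists>b'. inverses b b'"
proof -
  note [simp] = D_arr[OF assms(1)] assms(2-6)
  define n where "n = b \<boxplus> ng (ident K (cd x))"
  have n: "arr n" "dm n = cd x" "cd n = cd x" by (auto simp: n_def)
  have "n \<cdot> x = zr (dm x) (cd n)" and yn: "y \<cdot> n = zr (cd x) (cd y)" by (auto simp: n_def)
  then obtain t where t: "arr t" "dm t = cd y" "cd t = cd x" "n = t \<cdot> y"
    using factor_cokernel[OF assms(1), of n] n by metis
  have "n \<cdot> n = (t \<cdot> y) \<cdot> n" by (simp only: t(4)[symmetric])
  also have "\<dots> = t \<cdot> (y \<cdot> n)" using t(1-3) n by simp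
  also have "\<dots> = zr (cd x) (cd x)" using t(1-3) by (simp add: yn)
  finally show ?thesis
    using inverses_unipotent[of b] by (simp add: n_def)
qed

lemma end_endo:
  assumes "D x y d" "arr c" "dm c = cd y" "cd c = cd y" "c \<cdot> y = y" "d \<triangleright> c = d"
  shows "\<exists>c'. inverses c c'"
proof -
  note [simp] = D_arr[OF assms(1)] assms(2-6)
  define n where "n = c \<boxplus> ng (ident K (cd y))"
  have n: "arr n" "dm n = cd y" "cd n = cd y" by (auto simp: n_def)
  have ny: "n \<cdot> y = zr (dm y) (cd y)" by (auto simp: n_def)
  have "d \<triangleright> n = ezr (dm n) (dm x)" by (auto simp: n_def)
  then obtain t where t: "arr t" "dm t = cd y" "cd t = cd x" "n = y \<cdot> t"
    using factor_right[OF assms(1), of n] n by metis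
  have "n \<cdot> n = n \<cdot> (y \<cdot> t)" by (simp only: t(4)[symmetric])
  also have "\<dots> = (n \<cdot> y) \<cdot> t" using t(1-3) n by simp
  also have "\<dots> = zr (cd y) (cd y)" unfolding ny using t(1-3) by simp
  finally show ?thesis
    using inverses_unipotent[of c] by (simp add: n_def)
qed

text \<open>\<open>u \<cdot> g\<close> is a left inverse of \<open>f\<close> and
  \<open>g \<cdot> v\<close> a right inverse, so the two coincide.\<close>

lemma inverses_from_endos:
  assumes "arr f" "arr g" "dm g = cd f" "cd g = dm f"
    and "inverses (g \<cdot> f) u" "inverses (f \<cdot> g) v"
  shows "\<exists>f'. inverses f f'"
proof -
  note [simp] = assms(1-4)
  note U = inversesD[OF assms(5)] and V = inversesD[OF assms(6)]
  have "inverses f (u \<cdot> g)"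
    by (rule inverses_left_right[of _ _ "g \<cdot> v"]) (use U V in simp_all)
  then show ?thesis by blast
qed

text \<open>Lifting gives middle maps in both directions. The round trips are compatible with the
  identities at both ends, so \<open>mid_endo\<close> makes them invertible, although they need not
  be identities.\<close>

lemma mid_iso:
  assumes "D x y d" "D x' y' d'" "inverses a a'" "dm a = dm x" "cd a = dm x'"
    and "inverses c c'" "dm c = cd y" "cd c = cd y'" "a \<triangleleft> d = d' \<triangleright> c"
  obtains b b' where "inverses b b'" "dm b = cd x" "cd b = cd x'" "b \<cdot> x = x' \<cdot> a" "y' \<cdot> b = c \<cdot> y"
proof -
  note [simp] = D_arr[OF assms(1)] D_arr[OF assms(2)] assms(4,5,7,8)
  note a = inversesD[OF assms(3)] and c = inversesD[OF assms(6)]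
  note [simp] = a(1-4) c(1-4)
  obtain b where b: "arr b" "dm b = cd x" "cd b = cd x'" "b \<cdot> x = x' \<cdot> a" "y' \<cdot> b = c \<cdot> y"
    using D_lift[OF assms(1,2), of a c] assms(9) by auto
  \<comment> \<open>The inverse pair is again a morphism of extensions: \<open>c \<cdot> c'\<close>
    is inserted, after which the hypothesis turns \<open>d' \<triangleright> c\<close> into
    \<open>a \<triangleleft> d\<close>.\<close>
  have "a' \<triangleleft> d' = a' \<triangleleft> (d' \<triangleright> (c \<cdot> c'))" using c(6) by (simp del: ra_comp)
  also have "\<dots> = a' \<triangleleft> (d' \<triangleright> c) \<triangleright> c'" by simp
  also have "\<dots> = (a' \<cdot> a) \<triangleleft> d \<triangleright> c'" by (simp add: assms(9)[symmetric])
  finally have "a' \<triangleleft> d' = d \<triangleright> c'" using a(5) by (simp del: la_comp)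
  then obtain g where g: "arr g" "dm g = cd x'" "cd g = cd x" "g \<cdot> x' = x \<cdot> a'" "y \<cdot> g = c' \<cdot> y'"
    using D_lift[OF assms(2,1), of a' c'] by auto
  have "g \<cdot> (b \<cdot> x) = x" "y \<cdot> (g \<cdot> b) = y" "b \<cdot> (g \<cdot> x') = x'" "y' \<cdot> (b \<cdot> g) = y'"
    using b g a c comp_eqD[OF g(4), of a] comp_eqD[OF g(5), of b] comp_eqD[OF b(4), of a']
      comp_eqD[OF b(5), of g] by simp_all
  then obtain u v where "inverses (g \<cdot> b) u" "inverses (b \<cdot> g) v"
    using mid_endo[OF assms(1), of "g \<cdot> b"] mid_endo[OF assms(2), of "b \<cdot> g"] b g by auto
  then show ?thesis using inverses_from_endos[of b g] b g that by auto
qed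

text \<open>The argument of \<open>mid_iso\<close> with (ET3) in place of lifting. Here
  \<open>end_endo\<close> also requires that the round trips fix the extensions, which is why both
  composites are computed on \<open>d\<close> and \<open>d'\<close>.\<close>

lemma end_iso:
  assumes "D x y d" "D x' y' d'" "inverses a a'" "dm a = dm x" "cd a = dm x'"
    and "inverses b b'" "dm b = cd x" "cd b = cd x'" "b \<cdot> x = x' \<cdot> a"
  obtains c c' where "inverses c c'" "dm c = cd y" "cd c = cd y'" "c \<cdot> y = y' \<cdot> b" "a \<triangleleft> d = d' \<triangleright> c"
proof -
  note [simp] = D_arr[OF assms(1)] D_arr[OF assms(2)] assms(4,5,7,8)
  note a = inversesD[OF assms(3)] and b = inversesD[OF assms(6)]
  note [simp] = a(1-4) b(1-4)
  obtain c where c: "arr c" "dm c = cd y" "cd c = cd y'" "y' \<cdot> b = c \<cdot> y" "a \<triangleleft> d = d' \<triangleright> c"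
    using D_ET3[OF assms(1,2), of a b] assms(9) by auto
  have "b' \<cdot> (x' \<cdot> (a \<cdot> a')) = b' \<cdot> (b \<cdot> (x \<cdot> a'))"
    using comp_eqD[OF assms(9), of a'] by simp
  then have "b' \<cdot> x' = x \<cdot> a'" using a b by simp
  then obtain g where g: "arr g" "dm g = cd y'" "cd g = cd y" "y \<cdot> b' = g \<cdot> y'" "a' \<triangleleft> d' = d \<triangleright> g"
    using D_ET3[OF assms(2,1), of a' b'] by auto
  have "d \<triangleright> g \<triangleright> c = a' \<triangleleft> (d' \<triangleright> c)" "d' \<triangleright> c \<triangleright> g = a \<triangleleft> (d \<triangleright> g)"
    using c(1-3) g(1-3) by (simp_all flip: c(5) g(5))
  then have "d \<triangleright> g \<triangleright> c = (a' \<cdot> a) \<triangleleft> d" "d' \<triangleright> c \<triangleright> g = (a \<cdot> a') \<triangleleft> d'"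
    using c(1-3) g(1-3) by (simp_all flip: c(5) g(5))
  then have "d \<triangleright> g \<triangleright> c = d" "d' \<triangleright> c \<triangleright> g = d'"
    using a(5,6) by (simp_all del: la_comp)
  moreover have "g \<cdot> (c \<cdot> y) = y" "c \<cdot> (g \<cdot> y') = y'"
  proof -
    have "g \<cdot> (c \<cdot> y) = g \<cdot> (y' \<cdot> b)" by (simp only: c(4))
    also have "\<dots> = (y \<cdot> b') \<cdot> b"
      unfolding g(4) using g(1-3) by simp
    also have "\<dots> = y" using b by simp
    finally show "g \<cdot> (c \<cdot> y) = y" .
    have "c \<cdot> (g \<cdot> y') = c \<cdot> (y \<cdot> b')" by (simp only: g(4))
    also have "\<dots> = (y' \<cdot> b) \<cdot> b'"
      unfolding c(4) using c(1-3) by simp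
    also have "\<dots> = y'" using b by simp
    finally show "c \<cdot> (g \<cdot> y') = y'" .
  qed
  ultimately obtain u v where "inverses (g \<cdot> c) u" "inverses (c \<cdot> g) v"
    using end_endo[OF assms(1), of "g \<cdot> c"] end_endo[OF assms(2), of "c \<cdot> g"] c(1-3) g(1-3) by auto
  then show ?thesis using inverses_from_endos[of c g] c g(1-3) that by auto
qed

text \<open>\<open>mid_iso\<close> over two identities. It recovers for the relation
  \<open>D\<close> that an extension has only one equivalence class of realizing sequences.\<close>

lemma mid_unique:
  assumes "D x y d" "D x' y' d"
  shows "\<exists>b b'. inverses b b' \<and> dm b = cd x \<and> cd b = cd x' \<and> b \<cdot> x = x' \<and> y' \<cdot> b = y"
proof -
  note a = D_arr[OF assms(1)] D_arr[OF assms(2)]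
  have e: "ea d \<in> obj K" "eb d \<in> obj K" "dm x = ea d" "dm x' = ea d" "cd y = eb d" "cd y' = eb d"
    using a by simp_all
  have i: "ident K (ea d) \<triangleleft> d = d \<triangleright> ident K (eb d)" using a by simp
  obtain b b' where "inverses b b'" "dm b = cd x" "cd b = cd x'"
    "b \<cdot> x = x' \<cdot> ident K (ea d)" "y' \<cdot> b = ident K (eb d) \<cdot> y"
    by (rule mid_iso[OF assms inverses_ident[OF e(1)] _ _ inverses_ident[OF e(2)] _ _ i])
      (use e in simp_all)
  then show ?thesis using a e comp_ident by metis
qed

text \<open>\<open>end_iso\<close> over two identities: the cone of \<open>x\<close>, together with
  its extension, is determined up to isomorphism. Cones produced by (ET4) or by completion are
  identified with prescribed ones in this way.\<close>

lemma end_unique: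
  assumes "D x y d" "D x y' d'"
  shows "\<exists>c c'. inverses c c' \<and> dm c = cd y \<and> cd c = cd y' \<and> c \<cdot> y = y' \<and> d = d' \<triangleright> c"
proof -
  note a = D_arr[OF assms(1)] D_arr[OF assms(2)]
  have e: "dm x \<in> obj K" "cd x \<in> obj K" using a by simp_all
  have i: "ident K (cd x) \<cdot> x = x \<cdot> ident K (dm x)" using a by simp
  obtain c c' where "inverses c c'" "dm c = cd y" "cd c = cd y'"
    "c \<cdot> y = y' \<cdot> ident K (cd x)" "ident K (dm x) \<triangleleft> d = d' \<triangleright> c"
    by (rule end_iso[OF assms inverses_ident[OF e(1)] _ _ inverses_ident[OF e(2)] _ _ i])
      (use e in simp_all)
  then show ?thesis using a comp_ident(1)[of y' "cd x"] la_ident[of d "dm x"] by metis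
qed

text \<open>Some sequence realizes \<open>d'\<close>; \<open>mid_iso\<close> compares it with the
  given one, and a change of its middle term then yields \<open>x'\<close> and
  \<open>y'\<close>.\<close>

lemma D_iso:
  assumes "D x y d" "inverses a a'" "dm a = dm x" "inverses b b'" "dm b = cd x"
    and "inverses c c'" "dm c = cd y"
    and "arr x'" "arr y'" "dm y' = cd x'" "dm x' = cd a" "cd x' = cd b" "cd y' = cd c"
    and "xt d'" "ea d' = cd a" "eb d' = cd c"
    and "b \<cdot> x = x' \<cdot> a" "c \<cdot> y = y' \<cdot> b" "a \<triangleleft> d = d' \<triangleright> c"
  shows "D x' y' d'"
proof -
  note [simp] = D_arr[OF assms(1)] assms(3,5,7-16)
  note a = inversesD[OF assms(2)] and b = inversesD[OF assms(4)] and c = inversesD[OF assms(6)]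
  note [simp] = a(1-4) b(1-4) c(1-4)
  obtain i p where e: "D i p d'" using D_exists[of d'] by auto
  note [simp] = D_arr[OF e]
  have [simp]: "dm i = cd a" "cd p = cd c" using D_arr[OF e] by simp_all
  obtain h h' where h: "inverses h h'" "dm h = cd x" "cd h = cd i" "h \<cdot> x = i \<cdot> a" "p \<cdot> h = c \<cdot> y"
    using mid_iso[OF assms(1) e assms(2) _ _ assms(6)] assms(19) by auto
  note H = inversesD[OF h(1)]
  note [simp] = H(1-4) h(2,3)
  \<comment> \<open>\<open>b \<cdot> h'\<close> leads from the auxiliary middle term back to
    \<open>cd x\<close> and on to the prescribed middle term \<open>cd x'\<close>.\<close>
  have "D (b \<cdot> h' \<cdot> i) (p \<cdot> (h \<cdot> b')) d'"
    by (rule D_mid[OF e inverses_comp[OF inverses_sym[OF h(1)] assms(4)]]) simp_all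
  moreover have "b \<cdot> h' \<cdot> i = x'"
  proof -
    have "b \<cdot> h' \<cdot> i = b \<cdot> h' \<cdot> (i \<cdot> a) \<cdot> a'" using a(6) by simp
    also have "\<dots> = b \<cdot> x \<cdot> a'" using H(7) by (simp flip: h(4))
    also have "\<dots> = x'" using assms(17) a by simp
    finally show ?thesis .
  qed
  moreover have "p \<cdot> (h \<cdot> b') = y'"
  proof -
    have "p \<cdot> (h \<cdot> b') = (p \<cdot> h) \<cdot> b'" by simp
    also have "\<dots> = (y' \<cdot> b) \<cdot> b'" by (simp only: h(5) assms(18))
    also have "\<dots> = y'" using b by simp
    finally show ?thesis .
  qed
  ultimately show ?thesis by simp
qed

end

section \<open>Rotation and the shift\<close>

locale weak_extriangulated = pre_extriangulated K Ex EM D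
  for K :: "('o, 'm, 'z) cat_scheme" (structure)
    and Ex :: "'o \<Rightarrow> 'o \<Rightarrow> 'e monoid" and EM :: "'m \<Rightarrow> 'm \<Rightarrow> 'e \<Rightarrow> 'e"
    and D :: "'m \<Rightarrow> 'm \<Rightarrow> 'o \<times> 'o \<times> 'e \<Rightarrow> bool" +
  assumes D_ET4: "\<lbrakk>D f f' d; D g g' d'; dm g = cd f\<rbrakk> \<Longrightarrow> \<exists>h' d'' u v. D (g \<cdot> f) h' d'' \<and>
      arr u \<and> dm u = cd f' \<and> cd u = cd h' \<and> arr v \<and> dm v = cd h' \<and> cd v = cd g' \<and>
      u \<cdot> f' = h' \<cdot> g \<and> v \<cdot> h' = g' \<and> D u v (f' \<triangleleft> d') \<and> d'' \<triangleright> u = d \<and> f \<triangleleft> d'' = d' \<triangleright> v"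
begin

text \<open>A zero middle term makes the neighbouring terms in both long exact sequences vanish, so
  that the connecting maps become bijections; the next four lemmas are surjectivity and injectivity
  on either side.\<close>

definition universal :: "'o \<times> 'o \<times> 'e \<Rightarrow> bool" where
  "universal w \<longleftrightarrow> (\<exists>x y. D x y w \<and> is_zero_obj K (cd x))"

lemma universal_xt [simp]: "universal w \<Longrightarrow> xt w"
  unfolding universal_def using D_arr by blast

text \<open>\<open>x \<triangleleft> e\<close> lies in a group of extensions at the zero object
  \<open>cd x\<close>, hence vanishes, and exactness presents \<open>e\<close> as a pullback of
  \<open>w\<close>.\<close>

lemma universal_ra:
  assumes "universal w" "xt e" "ea e = ea w"
  shows "\<exists>c. arr c \<and> dm c = eb e \<and> cd c = eb w \<and> w \<triangleright> c = e"
proof -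
  obtain x y where D: "D x y w" and Z: "is_zero_obj K (cd x)"
    using assms(1) unfolding universal_def by blast
  have x: "arr x" "ea w = dm x" "eb w = cd y" using D_arr[OF D] by simp_all
  have "x \<triangleleft> e = ezr (eb e) (cd x)"
    using xt_zero_obj(1)[OF Z, of "x \<triangleleft> e"] x assms by simp
  then obtain c where "arr c" "dm c = eb e" "cd c = cd y" "e = w \<triangleright> c"
    using ext_pullback[OF D assms(2)] assms(3) x by metis
  then show ?thesis using x by auto
qed

lemma universal_la:
  assumes "universal w" "xt e" "eb e = eb w"
  shows "\<exists>a. arr a \<and> dm a = ea w \<and> cd a = ea e \<and> a \<triangleleft> w = e"
proof -
  obtain x y where D: "D x y w" and Z: "is_zero_obj K (cd x)"
    using assms(1) unfolding universal_def by blast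
  have x: "arr y" "dm y = cd x" "ea w = dm x" "eb w = cd y" using D_arr[OF D] by simp_all
  have "e \<triangleright> y = ezr (cd x) (ea e)"
    using xt_zero_obj(2)[OF Z, of "e \<triangleright> y"] x assms by simp
  then obtain a where "arr a" "dm a = dm x" "cd a = ea e" "e = a \<triangleleft> w"
    using ext_pushout[OF D assms(2)] assms(3) x by metis
  then show ?thesis using x by auto
qed

text \<open>The difference of the two morphisms is annihilated by \<open>w\<close>, so it factors
  through the zero middle term.\<close>

lemma universal_ra_inj:
  assumes "universal w" "w \<triangleright> c = w \<triangleright> c'"
    "arr c" "cd c = eb w" "arr c'" "cd c' = eb w" "dm c' = dm c"
  shows "c = c'"
proof -
  obtain x y where D: "D x y w" and Z: "is_zero_obj K (cd x)"
    using assms(1) unfolding universal_def by blast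
  note [simp] = D_arr[OF D] assms(2-7)
  have *: "arr (c \<boxplus> ng c')" "cd (c \<boxplus> ng c') = cd y" "dm (c \<boxplus> ng c') = dm c"
    "w \<triangleright> (c \<boxplus> ng c') = ezr (dm c) (dm x)" by simp_all
  then obtain g where g: "arr g" "dm g = dm c" "cd g = cd x" "c \<boxplus> ng c' = y \<cdot> g"
    using factor_right[OF D *(1,2)] *(3,4) by metis
  have "g = zr (dm c) (cd x)" using zero_objD(2)[OF Z g(1,3)] unfolding g(2) .
  then have "c \<boxplus> ng c' = zr (dm c) (cd c)" by (subst g(4)) simp
  then show ?thesis by (rule diff_zr_iff[THEN iffD1, rotated 4]) simp_all
qed

lemma universal_la_inj:
  assumes "universal w" "a \<triangleleft> w = a' \<triangleleft> w"
    "arr a" "dm a = ea w" "arr a'" "dm a' = ea w" "cd a' = cd a"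
  shows "a = a'"
proof -
  obtain x y where D: "D x y w" and Z: "is_zero_obj K (cd x)"
    using assms(1) unfolding universal_def by blast
  note [simp] = D_arr[OF D] assms(2-7)
  have *: "arr (a \<boxplus> ng a')" "dm (a \<boxplus> ng a') = dm x" "cd (a \<boxplus> ng a') = cd a"
    "(a \<boxplus> ng a') \<triangleleft> w = ezr (cd y) (cd a)" by simp_all
  then obtain g where g: "arr g" "dm g = cd x" "cd g = cd a" "a \<boxplus> ng a' = g \<cdot> x"
    using factor_left[OF D *(1,2)] *(3,4) by metis
  have "g = zr (cd x) (cd a)" using zero_objD(1)[OF Z g(1,2)] unfolding g(3) .
  then have "a \<boxplus> ng a' = zr (dm a) (cd a)" by (subst g(4)) simp
  then show ?thesis by (rule diff_zr_iff[THEN iffD1, rotated 4]) simp_all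
qed

lemma is_zero_obj_iso:
  assumes "inverses b b'" "is_zero_obj K (cd b)"
  shows "is_zero_obj K (dm b)"
proof (rule zero_objI)
  note b = inversesD[OF assms(1)]
  show "dm b \<in> obj K" using b by simp
  have "ident K (dm b) = b' \<cdot> zr (dm b) (cd b)"
    using zero_objD(2)[OF assms(2), of b] b(1,5) by simp
  then show "ident K (dm b) = zr (dm b) (dm b)" using b(1-4) by simp
qed

text \<open>The extension vanishes because \<open>cd y\<close> is zero, which gives \<open>x\<close>
  a left inverse; \<open>y\<close> vanishes as well, so the identity of \<open>cd x\<close> factors
  through \<open>x\<close> and gives a right inverse.\<close>

lemma D_end_zero:
  assumes "D x y d" "is_zero_obj K (cd y)"
  shows "\<exists>x'. inverses x x'"
proof -
  note [simp] = D_arr[OF assms(1)]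
  have d: "d = ezr (cd y) (dm x)"
    using xt_zero_obj(2)[OF assms(2), of d] by simp
  have "ident K (dm x) \<triangleleft> d = ezr (cd y) (cd (ident K (dm x)))"
    by simp (rule d)
  moreover have *: "dm x \<in> obj K" "cd x \<in> obj K" by simp_all
  ultimately obtain s where s: "arr s" "dm s = cd x" "cd s = dm x" "ident K (dm x) = s \<cdot> x"
    using factor_left[OF assms(1) arr_ident dm_ident, OF *(1) *(1)] cd_ident[OF *(1)] by metis
  have "y \<cdot> ident K (cd x) = zr (dm (ident K (cd x))) (cd y)"
    using zero_objD(2)[OF assms(2), of y] by simp
  then obtain t where t: "arr t" "dm t = cd x" "cd t = dm x" "ident K (cd x) = x \<cdot> t"
    using factor_kernel[OF assms(1) arr_ident cd_ident, OF *(2) *(2)] dm_ident[OF *(2)] by metis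
  have "inverses x s" by (rule inverses_left_right[of _ _ t])
      (use s(1-3) s(4)[symmetric] t(1-3) t(4)[symmetric] in simp_all)
  then show ?thesis by blast
qed

text \<open>The sum of \<open>d\<close> and \<open>w\<close> along the two inclusions into \<open>dm x \<oplus> ea w\<close> is realized by a
  single sequence; (ET4) applied to it and to either inclusion compares it with both.\<close>

lemma rotate_back:
  assumes D: "D x y d" and w: "universal w" and ebw: "eb w = cd y"
  shows "\<exists>r. arr r \<and> dm r = ea w \<and> cd r = dm x \<and> r \<triangleleft> w = eng d \<and> D r x (w \<triangleright> y)"
proof -
  note [simp] = D_arr[OF D] ebw universal_xt[OF w]
  obtain i p where ip: "D i p w" and Z: "is_zero_obj K (cd i)"
    using w unfolding universal_def by blast
  obtain S where S: "is_biproduct K (dm x) (ea w) S"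
    "D (inl S) (prr S) (ezr (ea w) (dm x))" "D (inr S) (prl S) (ezr (dm x) (ea w))"
    using D_split[of "dm x" "ea w"] by auto
  note [simp] = biproductD[OF S(1)]
  \<comment> \<open>The two projections carry \<open>m\<close> to \<open>d\<close> and to
    \<open>w\<close>, so a single sequence serves both applications of (ET4).\<close>
  define m where "m = inl S \<triangleleft> d \<oplus> inr S \<triangleleft> w"
  have m [simp]: "xt m" "ea m = dsum S" "eb m = cd y" unfolding m_def by simp_all
  have prm: "prl S \<triangleleft> m = d" "prr S \<triangleleft> m = w"
    unfolding m_def by (simp_all del: la_comp add: la_comp[symmetric])
  obtain g g' where g: "D g g' m" using D_exists[OF m(1)] by blast
  have [simp]: "arr g" "arr g'" "dm g = dsum S" "dm g' = cd g" "cd g' = cd y"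
    using D_arr[OF g] by simp_all

  have "dm g = cd (inl S)" "dm g = cd (inr S)" by simp_all
  note ET4 = D_ET4[OF S(2) g this(1)] D_ET4[OF S(3) g this(2)]
  \<comment> \<open>Along the first inclusion the third sequence of (ET4) realizes \<open>w\<close>.
    Its middle term, the cone of \<open>g \<cdot> inl S\<close>, is therefore zero, and
    \<open>g \<cdot> inl S\<close> is invertible.\<close>
  obtain k e u v where 1: "D (g \<cdot> inl S) k e" "cd u = cd k" "D u v w"
    using ET4(1) unfolding prm by blast
  have [simp]: "arr k" "dm k = cd g" using D_arr[OF 1(1)] by simp_all
  obtain b b' where "inverses b b'" "dm b = cd u" "cd b = cd i"
    using mid_unique[OF 1(3) ip] by blast
  then have "is_zero_obj K (cd k)" using is_zero_obj_iso Z 1(2) by metis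
  then obtain hi where hi: "inverses (g \<cdot> inl S) hi" using D_end_zero[OF 1(1)] by blast
  note Hi = inversesD[OF hi]
  have [simp]: "arr hi" "dm hi = cd g" "cd hi = dm x" using Hi by simp_all

  \<comment> \<open>Along the second inclusion the third sequence realizes \<open>d\<close>, so the
    cone of \<open>g \<cdot> inr S\<close> is identified with \<open>cd x\<close>, by
    \<open>b\<close>.\<close>
  obtain q e u v where 2: "D (g \<cdot> inr S) q e" "arr u" "dm u = dm x" "cd u = cd q"
    "arr v" "dm v = cd q" "cd v = cd y" "u \<cdot> prl S = q \<cdot> g" "D u v d" "inr S \<triangleleft> e = m \<triangleright> v"
    using ET4(2) unfolding prm \<open>cd g' = cd y\<close> \<open>cd (prl S) = dm x\<close> by blast
  have q [simp]: "arr q" "dm q = cd g" "xt e" "ea e = ea w" "eb e = cd q"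
    using D_arr[OF 2(1)] by simp_all
  obtain b b' where b: "inverses b b'" "dm b = cd u" "cd b = cd x" "b \<cdot> u = x" "y \<cdot> b = v"
    using mid_unique[OF 2(9) D] by blast
  note B = inversesD[OF b(1)]
  have [simp]: "arr b" "dm b = cd q" "cd b = cd x" using B b 2 by simp_all

  \<comment> \<open>\<open>prr S\<close> retracts \<open>inr S\<close>, so \<open>e\<close> is
    recovered from the relation \<open>inr S \<triangleleft> e = m \<triangleright> v\<close> of
    (ET4).\<close>
  have "e = prr S \<triangleleft> (inr S \<triangleleft> e)" by (simp del: la_comp add: la_comp[symmetric])
  also have "\<dots> = (prr S \<triangleleft> m) \<triangleright> v" using 2 by simp
  also have "\<dots> = w \<triangleright> y \<triangleright> b" unfolding prm b(5)[symmetric] by simp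
  finally have e: "e = w \<triangleright> y \<triangleright> b" .
  have "b \<cdot> (q \<cdot> (g \<cdot> inl S)) = b \<cdot> ((q \<cdot> g) \<cdot> inl S)" by simp
  also have "\<dots> = b \<cdot> ((u \<cdot> prl S) \<cdot> inl S)" by (simp only: 2)
  also have "\<dots> = x" using 2(2-4) by (simp add: b(4))
  finally have bq: "b \<cdot> (q \<cdot> (g \<cdot> inl S)) = x" .
  have "b \<cdot> q = b \<cdot> (q \<cdot> ((g \<cdot> inl S) \<cdot> hi))" using Hi(6) by (simp del: assoc)
  also have "\<dots> = (b \<cdot> (q \<cdot> (g \<cdot> inl S))) \<cdot> hi" by simp
  also have "\<dots> = x \<cdot> hi" unfolding bq ..
  finally have bq': "b \<cdot> q = x \<cdot> hi" .
  \<comment> \<open>\<open>hi\<close> identifies the middle term \<open>cd g\<close> with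
    \<open>dm x\<close>, which turns \<open>g \<cdot> inr S\<close> into a map from
    \<open>ea w\<close> to \<open>dm x\<close>.\<close>
  define r where "r = hi \<cdot> (g \<cdot> inr S)"
  have r [simp]: "arr r" "dm r = ea w" "cd r = dm x" by (simp_all add: r_def)
  have "D r x (w \<triangleright> y)"
  proof (rule D_iso[OF 2(1) inverses_ident[of "ea w"] _ inverses_sym[OF hi] _ b(1)])
    show "hi \<cdot> (g \<cdot> inr S) = r \<cdot> ident K (ea w)" by (simp add: r_def)
    show "b \<cdot> q = x \<cdot> hi" by (fact bq')
    show "ident K (ea w) \<triangleleft> e = w \<triangleright> y \<triangleright> b" using e by simp
  qed simp_all
  \<comment> \<open>\<open>g\<close> annihilates the extension \<open>m\<close> that it realizes.
    After applying \<open>hi\<close>, the two summands of \<open>m\<close> contribute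
    \<open>d\<close> and \<open>r \<triangleleft> w\<close>, so these add up to zero; this is the
    origin of the sign in (TR2).\<close>
  moreover have "r \<triangleleft> w = eng d"
  proof (rule eng_unique)
    have "g \<triangleleft> m = ezr (cd y) (cd g)" using D_zero(2)[OF g] by simp
    then have "hi \<triangleleft> (g \<triangleleft> m) = ezr (cd y) (dm x)" by simp
    moreover have "hi \<triangleleft> (g \<triangleleft> (inl S \<triangleleft> d)) = (hi \<cdot> (g \<cdot> inl S)) \<triangleleft> d" by simp
    then have "hi \<triangleleft> (g \<triangleleft> (inl S \<triangleleft> d)) = d" using Hi(5) by (simp del: la_comp)
    ultimately show "d \<oplus> r \<triangleleft> w = ezr (eb d) (ea d)" by (simp add: m_def r_def)
  qed simp_all
  ultimately show ?thesis using r by blast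
qed

end

text \<open>\<open>cone\<close> is what enough injectives become once the middle terms in \<I> are
  zero, and \<open>cocone\<close> is the same for enough projectives.\<close>

locale stable_extriangulated = weak_extriangulated K Ex EM D
  for K :: "('o, 'm, 'z) cat_scheme" (structure)
    and Ex :: "'o \<Rightarrow> 'o \<Rightarrow> 'e monoid" and EM :: "'m \<Rightarrow> 'm \<Rightarrow> 'e \<Rightarrow> 'e"
    and D :: "'m \<Rightarrow> 'm \<Rightarrow> 'o \<times> 'o \<times> 'e \<Rightarrow> bool" +
  assumes cone: "A \<in> obj K \<Longrightarrow> \<exists>w. universal w \<and> ea w = A"
    and cocone: "C \<in> obj K \<Longrightarrow> \<exists>w. universal w \<and> eb w = C"
begin

section \<open>The shift and its quasi-inverse, from chosen universal extensions\<close>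

definition om :: "'o \<Rightarrow> 'o \<times> 'o \<times> 'e" where
  "om A = (SOME w. universal w \<and> ea w = A)"

definition so :: "'o \<Rightarrow> 'o" where
  "so A = eb (om A)"

text \<open>By \<open>universal_ra\<close> and \<open>universal_ra_inj\<close> exactly one morphism
  qualifies when \<open>f\<close> is an arrow, so the only real choice is that of
  \<open>om\<close>.\<close>

definition sm :: "'m \<Rightarrow> 'm" where
  "sm f = (SOME s. arr s \<and> dm s = so (dm f) \<and> cd s = so (cd f) \<and>
    om (cd f) \<triangleright> s = f \<triangleleft> om (dm f))"

text \<open>A universal extension chosen by its end term instead of its first term;
  \<open>lo\<close> and \<open>lm\<close> form the loop functor.\<close>

definition om' :: "'o \<Rightarrow> 'o \<times> 'o \<times> 'e" where
  "om' C = (SOME w. universal w \<and> eb w = C)"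

definition lo :: "'o \<Rightarrow> 'o" where
  "lo C = ea (om' C)"

definition lm :: "'m \<Rightarrow> 'm" where
  "lm f = (SOME s. arr s \<and> dm s = lo (dm f) \<and> cd s = lo (cd f) \<and>
    s \<triangleleft> om' (dm f) = om' (cd f) \<triangleright> f)"

definition Dist :: "('o \<times> 'o \<times> 'o \<times> 'm \<times> 'm \<times> 'm) set" where
  "Dist = {(X, Y, Z, u, v, w). X \<in> obj K \<and> Y \<in> obj K \<and> Z \<in> obj K \<and> arr u \<and> dm u = X \<and>
    cd u = Y \<and> arr v \<and> dm v = Y \<and> cd v = Z \<and> arr w \<and> dm w = Z \<and> cd w = so X \<and>
    D u v (om X \<triangleright> w)}"

lemma om [simp]:
  assumes "A \<in> obj K"
  shows "universal (om A)" "ea (om A) = A" "eb (om A) = so A" "so A \<in> obj K"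
proof -
  have "universal (om A) \<and> ea (om A) = A"
    unfolding om_def by (rule someI_ex[OF cone[OF assms]])
  then show "universal (om A)" "ea (om A) = A" "eb (om A) = so A" "so A \<in> obj K"
    unfolding so_def by simp_all
qed

lemma om' [simp]:
  assumes "C \<in> obj K"
  shows "universal (om' C)" "eb (om' C) = C" "ea (om' C) = lo C" "lo C \<in> obj K"
proof -
  have "universal (om' C) \<and> eb (om' C) = C"
    unfolding om'_def by (rule someI_ex[OF cocone[OF assms]])
  then show "universal (om' C)" "eb (om' C) = C" "ea (om' C) = lo C" "lo C \<in> obj K"
    unfolding lo_def by simp_all
qed

lemma sm [simp]:
  assumes "arr f"
  shows "arr (sm f)" "dm (sm f) = so (dm f)" "cd (sm f) = so (cd f)"
    "om (cd f) \<triangleright> sm f = f \<triangleleft> om (dm f)"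
proof -
  have "\<exists>s. arr s \<and> dm s = so (dm f) \<and> cd s = so (cd f) \<and> om (cd f) \<triangleright> s = f \<triangleleft> om (dm f)"
    using universal_ra[of "om (cd f)" "f \<triangleleft> om (dm f)"] assms by simp
  from someI_ex[OF this]
  show "arr (sm f)" "dm (sm f) = so (dm f)" "cd (sm f) = so (cd f)"
    "om (cd f) \<triangleright> sm f = f \<triangleleft> om (dm f)"
    unfolding sm_def by simp_all
qed

lemma lm [simp]:
  assumes "arr f"
  shows "arr (lm f)" "dm (lm f) = lo (dm f)" "cd (lm f) = lo (cd f)"
    "lm f \<triangleleft> om' (dm f) = om' (cd f) \<triangleright> f"
proof -
  have "\<exists>s. arr s \<and> dm s = lo (dm f) \<and> cd s = lo (cd f) \<and> s \<triangleleft> om' (dm f) = om' (cd f) \<triangleright> f"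
    using universal_la[of "om' (dm f)" "om' (cd f) \<triangleright> f"] assms by simp
  from someI_ex[OF this]
  show "arr (lm f)" "dm (lm f) = lo (dm f)" "cd (lm f) = lo (cd f)"
    "lm f \<triangleleft> om' (dm f) = om' (cd f) \<triangleright> f"
    unfolding lm_def by simp_all
qed

text \<open>Equality of morphisms into \<open>so A\<close> is tested on \<open>om A\<close>.
  Functoriality and additivity of the shift, and later all squares ending in a shifted object, are
  verified this way.\<close>

lemma om_inj:
  "\<lbrakk>om A \<triangleright> c = om A \<triangleright> c'; A \<in> obj K; arr c; cd c = so A; arr c'; cd c' = so A; dm c' = dm c\<rbrakk>
    \<Longrightarrow> c = c'"
  using universal_ra_inj[of "om A" c c'] by simp

lemma om'_inj:
  "\<lbrakk>a \<triangleleft> om' C = a' \<triangleleft> om' C; C \<in> obj K; arr a; dm a = lo C; arr a'; dm a' = lo C; cd a' = cd a\<rbrakk>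
    \<Longrightarrow> a = a'"
  using universal_la_inj[of "om' C" a a'] by simp

lemma sm_ident [simp]: "A \<in> obj K \<Longrightarrow> sm (ident K A) = ident K (so A)"
  using sm(4)[of "ident K A"] by (intro om_inj[of A]) simp_all

lemma sm_comp [simp]:
  assumes "arr f" "arr g" "dm g = cd f"
  shows "sm (g \<cdot> f) = sm g \<cdot> sm f"
proof (rule om_inj[of "cd g"])
  show "om (cd g) \<triangleright> sm (g \<cdot> f) = om (cd g) \<triangleright> (sm g \<cdot> sm f)"
    using assms sm(4)[of "g \<cdot> f"] sm(4)[of g] sm(4)[of f] by simp
qed (use assms in simp_all)

lemma sm_pl:
  assumes "arr f" "arr g" "dm g = dm f" "cd g = cd f"
  shows "sm (f \<boxplus> g) = sm f \<boxplus> sm g"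
  using assms sm(4)[of "f \<boxplus> g"] sm(4)[of f] sm(4)[of g] by (intro om_inj[of "cd f"]) simp_all

lemma lm_ident [simp]: "A \<in> obj K \<Longrightarrow> lm (ident K A) = ident K (lo A)"
  using lm(4)[of "ident K A"] by (intro om'_inj[of _ A]) simp_all

lemma lm_comp [simp]:
  assumes "arr f" "arr g" "dm g = cd f"
  shows "lm (g \<cdot> f) = lm g \<cdot> lm f"
proof (rule om'_inj[of _ "dm f"])
  have "(lm g \<cdot> lm f) \<triangleleft> om' (dm f) = lm g \<triangleleft> om' (cd f) \<triangleright> f" using assms by simp
  also have "\<dots> = (lm g \<triangleleft> om' (dm g)) \<triangleright> f" using assms by (simp del: lm(4))
  also have "\<dots> = om' (cd g) \<triangleright> (g \<cdot> f)" using assms unfolding lm(4)[OF assms(2)] by simp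
  finally show "lm (g \<cdot> f) \<triangleleft> om' (dm f) = (lm g \<cdot> lm f) \<triangleleft> om' (dm f)"
    using assms lm(4)[of "g \<cdot> f"] by simp
qed (use assms in simp_all)

lemma lm_pl:
  assumes "arr f" "arr g" "dm g = dm f" "cd g = cd f"
  shows "lm (f \<boxplus> g) = lm f \<boxplus> lm g"
  using assms lm(4)[of "f \<boxplus> g"] lm(4)[of f] lm(4)[of g] by (intro om'_inj[of _ "dm f"]) simp_all

end

section \<open>The triangulation\<close>

context preadditive_category
begin

lemma ng_eq: "dm f = A \<Longrightarrow> cd f = B \<Longrightarrow> inv\<^bsub>Hom K A B\<^esub> f = ng f"
  by (simp add: ng_def)

lemma is_isoE:
  assumes "is_iso K A B f" "A \<in> obj K" "B \<in> obj K"
  obtains g where "inverses f g" "dm f = A" "cd f = B"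
  using assms by (auto simp: is_iso_iff)

lemma is_additive_endofunctorI:
  assumes "\<And>A. A \<in> obj K \<Longrightarrow> So A \<in> obj K"
    and "\<And>A. A \<in> obj K \<Longrightarrow> Sm (ident K A) = ident K (So A)"
    and Sm: "\<And>f. arr f \<Longrightarrow> arr (Sm f)" "\<And>f. arr f \<Longrightarrow> dm (Sm f) = So (dm f)"
      "\<And>f. arr f \<Longrightarrow> cd (Sm f) = So (cd f)"
    and pl: "\<And>f g. \<lbrakk>arr f; arr g; dm g = dm f; cd g = cd f\<rbrakk> \<Longrightarrow> Sm (f \<boxplus> g) = Sm f \<boxplus> Sm g"
    and comp: "\<And>f g. \<lbrakk>arr f; arr g; dm g = cd f\<rbrakk> \<Longrightarrow> Sm (g \<cdot> f) = Sm g \<cdot> Sm f"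
  shows "is_additive_endofunctor K So Sm"
proof -
  have "Sm (f \<otimes>\<^bsub>Hom K A B\<^esub> g) = Sm f \<otimes>\<^bsub>Hom K (So A) (So B)\<^esub> Sm g"
    if "A \<in> obj K" "B \<in> obj K" "f \<in> Mor K A B" "g \<in> Mor K A B" for A B f g
    using that pl[of f g] Sm[of f] by (auto simp: Mor_iff pl_def)
  then show ?thesis
    using assms unfolding is_additive_endofunctor_def hom_def by (auto simp: Mor_iff)
qed

end

context stable_extriangulated
begin

text \<open>\<open>om A\<close> and \<open>om' (so A)\<close> are universal extensions with the same
  end \<open>so A\<close>, and comparing them gives the unit \<open>h\<close>. Likewise
  \<open>om' C\<close> and \<open>om (lo C)\<close> share the first term \<open>lo C\<close>, and
  their comparison is the counit \<open>e\<close>.\<close>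

lemma so_autoequivalence: "is_additive_autoequivalence K so sm"
proof -
  have so: "is_additive_endofunctor K so sm"
    by (rule is_additive_endofunctorI) (simp_all add: sm_pl)
  have lo: "is_additive_endofunctor K lo lm"
    by (rule is_additive_endofunctorI) (simp_all add: lm_pl)

  have "\<exists>h. arr h \<and> dm h = A \<and> cd h = lo (so A) \<and> h \<triangleleft> om A = om' (so A)"
    if "A \<in> obj K" for A
    using universal_la[of "om A" "om' (so A)"] that by simp
  then obtain h where h: "\<And>A. A \<in> obj K \<Longrightarrow>
      arr (h A) \<and> dm (h A) = A \<and> cd (h A) = lo (so A) \<and> h A \<triangleleft> om A = om' (so A)"
    by metis
  have hi: "is_iso K A (lo (so A)) (h A)" if A: "A \<in> obj K" for A
  proof -
    obtain g where g: "arr g" "dm g = lo (so A)" "cd g = A" "g \<triangleleft> om' (so A) = om A"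
      using universal_la[OF om'(1), of "so A" "om A"] A by auto
    \<comment> \<open>Both round trips fix a universal extension, so by injectivity they are
      identities.\<close>
    have "inverses (h A) g"
      unfolding inverses_def using universal_la_inj[of "om A" "g \<cdot> h A" "ident K A"]
        universal_la_inj[of "om' (so A)" "h A \<cdot> g" "ident K (lo (so A))"] g h[OF A] A by simp
    then show ?thesis using A h[OF A] by (auto simp: is_iso_iff)
  qed
  have hn: "h (cd f) \<cdot> f = lm (sm f) \<cdot> h (dm f)" if f: "arr f" for f
  proof (rule universal_la_inj[of "om (dm f)"])
    \<comment> \<open>Naturality is tested on \<open>om (dm f)\<close>, which both paths carry to
      the pullback of \<open>om' (so (cd f))\<close> along \<open>sm f\<close>.\<close>
    have "lm (sm f) \<triangleleft> om' (so (dm f)) = om' (so (cd f)) \<triangleright> sm f"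
      using lm(4)[of "sm f"] f by simp
    also have "\<dots> = h (cd f) \<triangleleft> (om (cd f) \<triangleright> sm f)"
      using h[of "cd f"] f by (simp del: sm(4) flip: la_ra(2))
    finally show "(h (cd f) \<cdot> f) \<triangleleft> om (dm f) = (lm (sm f) \<cdot> h (dm f)) \<triangleleft> om (dm f)"
      using h[of "cd f"] h[of "dm f"] f by simp
  qed (use f h[of "dm f"] h[of "cd f"] in simp_all)

  have "\<exists>e. arr e \<and> dm e = so (lo C) \<and> cd e = C \<and> om' C \<triangleright> e = om (lo C)"
    if "C \<in> obj K" for C
    using universal_ra[of "om' C" "om (lo C)"] that by simp
  then obtain e where e: "\<And>C. C \<in> obj K \<Longrightarrow>
      arr (e C) \<and> dm (e C) = so (lo C) \<and> cd (e C) = C \<and> om' C \<triangleright> e C = om (lo C)"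
    by metis
  have ei: "is_iso K (so (lo C)) C (e C)" if C: "C \<in> obj K" for C
  proof -
    obtain g where g: "arr g" "dm g = C" "cd g = so (lo C)" "om (lo C) \<triangleright> g = om' C"
      using universal_ra[OF om(1), of "lo C" "om' C"] C by auto
    have "inverses (e C) g"
      unfolding inverses_def using universal_ra_inj[of "om' C" "e C \<cdot> g" "ident K C"]
        universal_ra_inj[of "om (lo C)" "g \<cdot> e C" "ident K (so (lo C))"] g e[OF C] C by simp
    then show ?thesis using C e[OF C] by (auto simp: is_iso_iff)
  qed
  have en: "e (cd f) \<cdot> sm (lm f) = f \<cdot> e (dm f)" if f: "arr f" for f
  proof (rule universal_ra_inj[of "om' (cd f)"])
    have "om (lo (cd f)) \<triangleright> sm (lm f) = (om' (cd f) \<triangleright> f) \<triangleright> e (dm f)"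
      using sm(4)[of "lm f"] e[of "dm f"] f by (simp flip: lm(4))
    then show "om' (cd f) \<triangleright> (e (cd f) \<cdot> sm (lm f)) = om' (cd f) \<triangleright> (f \<cdot> e (dm f))"
      using e[of "cd f"] e[of "dm f"] f by simp
  qed (use f e[of "dm f"] e[of "cd f"] in simp_all)

  have "is_natural_iso K id id (lo \<circ> so) (lm \<circ> sm) h"
    unfolding is_natural_iso_def using hi hn by (auto simp: Mor_iff)
  moreover have "is_natural_iso K (so \<circ> lo) (sm \<circ> lm) id id e"
    unfolding is_natural_iso_def using ei en by (auto simp: Mor_iff)
  ultimately show ?thesis
    unfolding is_additive_autoequivalence_def using so lo by blast
qed

lemma Dist_iff: "(X, Y, Z, u, v, w) \<in> Dist \<longleftrightarrow> arr u \<and> arr v \<and> arr w \<and> dm u = X \<and>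
    cd u = Y \<and> dm v = Y \<and> cd v = Z \<and> dm w = Z \<and> cd w = so X \<and> D u v (om X \<triangleright> w)"
  unfolding Dist_def by auto

lemma triangles_iff: "(X, Y, Z, u, v, w) \<in> triangles K so \<longleftrightarrow> arr u \<and> arr v \<and> arr w \<and>
    dm u = X \<and> cd u = Y \<and> dm v = Y \<and> cd v = Z \<and> dm w = Z \<and> cd w = so X"
  unfolding triangles_def by (auto simp: Mor_iff)

text \<open>The third object is the middle term of a sequence realizing the negative of
  \<open>u \<triangleleft> om (dm u)\<close>. Rotating it back gives a first map with the same
  action as \<open>u\<close> on a universal extension, hence \<open>u\<close> itself. The unrotated
  sequence is recorded too, because the forward rotation starts from it.\<close>

lemma complete:
  assumes "arr u"
  shows "\<exists>v w. arr v \<and> arr w \<and> dm v = cd u \<and> dm w = cd v \<and> cd w = so (dm u) \<and>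
    D u v (om (dm u) \<triangleright> w) \<and> D v w (eng (u \<triangleleft> om (dm u)))"
proof -
  let ?d = "eng (u \<triangleleft> om (dm u))"
  have xt: "xt ?d" using assms by simp
  obtain v w where D: "D v w ?d" using D_exists[OF xt] by blast
  have vw: "arr v" "arr w" "dm w = cd v" "dm v = cd u" "cd w = so (dm u)"
    using D_arr[OF D] assms by simp_all
  obtain r where r: "arr r" "dm r = dm u" "cd r = cd u" "r \<triangleleft> om (dm u) = eng ?d"
    "D r v (om (dm u) \<triangleright> w)"
    using rotate_back[OF D, of "om (dm u)"] vw assms by auto
  have "r = u"
    using universal_la_inj[of "om (dm u)" r u] r assms by simp
  then show ?thesis using r(5) vw D by blast
qed

text \<open>Backwards this is \<open>rotate_back\<close>, with \<open>u\<close> recovered by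
  injectivity. Forwards, the statement is known for the triangle that \<open>complete\<close> builds
  on \<open>u\<close>, and uniqueness of the cone transfers it to any other.\<close>

lemma rotation:
  assumes "arr u" "arr v" "arr w" "dm v = cd u" "dm w = cd v" "cd w = so (dm u)"
  shows "D u v (om (dm u) \<triangleright> w) \<longleftrightarrow> D v w (om (cd u) \<triangleright> ng (sm u))"
proof -
  note [simp] = assms
  \<comment> \<open>The sign prescribed by (TR2) is the one produced by
    \<open>rotate_back\<close>.\<close>
  have s: "om (cd u) \<triangleright> ng (sm u) = eng (u \<triangleleft> om (dm u))" by simp
  show ?thesis unfolding s
  proof
    assume D: "D v w (eng (u \<triangleleft> om (dm u)))"
    obtain r where r: "arr r" "dm r = dm u" "cd r = cd u" "r \<triangleleft> om (dm u) = u \<triangleleft> om (dm u)"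
      "D r v (om (dm u) \<triangleright> w)"
      using rotate_back[OF D, of "om (dm u)"] by auto
    have "r = u"
      using universal_la_inj[of "om (dm u)" r u] r by simp
    then show "D u v (om (dm u) \<triangleright> w)" using r(5) by simp
  next
    assume D: "D u v (om (dm u) \<triangleright> w)"
    obtain m q where m: "arr m" "arr q" "dm m = cd u" "dm q = cd m" "cd q = so (dm u)"
      "D u m (om (dm u) \<triangleright> q)" "D m q (eng (u \<triangleleft> om (dm u)))"
      using complete[of u] by auto
    obtain c c' where c: "inverses c c'" "dm c = cd m" "cd c = cd v" "c \<cdot> m = v"
      "om (dm u) \<triangleright> q = om (dm u) \<triangleright> w \<triangleright> c"
      using end_unique[OF m(6) D] by blast
    note C = inversesD[OF c(1)]
    \<comment> \<open>The isomorphism of cones respects the extensions, and testing on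
      \<open>om (dm u)\<close> turns this into an equation between the last maps.\<close>
    have "q = w \<cdot> c"
      using om_inj[of "dm u" q "w \<cdot> c"] c(2,3,5) C m by simp
    then have "q \<cdot> c' = w" using c(2,3) C m by simp
    then show "D v w (eng (u \<triangleleft> om (dm u)))"
      using D_mid[OF m(7) c(1,2)] c(4) by simp
  qed
qed

theorem triangulated: "triangulated_category K so sm Dist"
proof (intro triangulated_category.intro triangulated_category_axioms.intro)
  show "additive_category K" ..
  show "is_additive_autoequivalence K so sm" by (rule so_autoequivalence)
  show "Dist \<subseteq> triangles K so" by (auto simp: Dist_iff triangles_iff)
next
  fix X Y Z u v w X' Y' Z' u' v' w' a b c
  assume T: "(X, Y, Z, u, v, w) \<in> Dist" "(X', Y', Z', u', v', w') \<in> triangles K so"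
    and I: "is_iso K X X' a" "is_iso K Y Y' b" "is_iso K Z Z' c"
    and c: "b \<cdot> u = u' \<cdot> a" "c \<cdot> v = v' \<cdot> b" "sm a \<cdot> w = w' \<cdot> c"
  note t [simp] = T(1)[unfolded Dist_iff] T(2)[unfolded triangles_iff]
  have ob: "X \<in> obj K" "X' \<in> obj K" "Y \<in> obj K" "Y' \<in> obj K" "Z \<in> obj K" "Z' \<in> obj K"
    using t dm_obj cd_obj by metis+
  obtain a' where a: "inverses a a'" "dm a = X" "cd a = X'" by (rule is_isoE[OF I(1) ob(1,2)])
  obtain b' where b: "inverses b b'" "dm b = Y" "cd b = Y'" by (rule is_isoE[OF I(2) ob(3,4)])
  obtain c' where c': "inverses c c'" "dm c = Z" "cd c = Z'" by (rule is_isoE[OF I(3) ob(5,6)])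
  note [simp] = ob a(2,3) b(2,3) c'(2,3) inversesD(1)[OF a(1)] inversesD(1)[OF b(1)]
    inversesD(1)[OF c'(1)]
  \<comment> \<open>Read on \<open>om X'\<close>, the last square of an isomorphism of triangles
    says that \<open>a\<close> and \<open>c\<close> form a morphism of extensions.\<close>
  have "om X' \<triangleright> (w' \<cdot> c) = (om X' \<triangleright> sm a) \<triangleright> w" unfolding c(3)[symmetric] by simp
  also have "\<dots> = a \<triangleleft> (om X \<triangleright> w)" using sm(4)[of a] by simp
  finally have *: "a \<triangleleft> (om X \<triangleright> w) = om X' \<triangleright> w' \<triangleright> c" by simp
  have "D u' v' (om X' \<triangleright> w')"
    by (rule D_iso[OF _ a(1) _ b(1) _ c'(1) _ _ _ _ _ _ _ _ _ _ c(1,2) *]) simp_all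
  then show "(X', Y', Z', u', v', w') \<in> Dist" by (simp add: Dist_iff)
next
  fix X Z assume "X \<in> obj K" "is_zero_obj K Z"
  then show "(X, X, Z, ident K X, mzero K X Z, mzero K Z (so X)) \<in> Dist"
    using D_trivial(1)[of X Z] zero_obj_ident(1) by (simp add: Dist_iff)
next
  fix X Y u assume "X \<in> obj K" "Y \<in> obj K" "u \<in> Mor K X Y"
  then show "\<exists>Z v w. (X, Y, Z, u, v, w) \<in> Dist"
    using complete[of u] by (auto simp: Dist_iff Mor_iff)
next
  fix X Y Z u v w assume "(X, Y, Z, u, v, w) \<in> triangles K so"
  then show "(X, Y, Z, u, v, w) \<in> Dist \<longleftrightarrow>
      (Y, Z, so X, v, w, inv\<^bsub>Hom K (so X) (so Y)\<^esub> (sm u)) \<in> Dist"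
    using rotation[of u v w] by (auto simp: Dist_iff triangles_iff ng_eq)
next
  fix X Y Z u v w X' Y' Z' u' v' w' a b
  assume T: "(X, Y, Z, u, v, w) \<in> Dist" "(X', Y', Z', u', v', w') \<in> Dist"
    and ab: "a \<in> Mor K X X'" "b \<in> Mor K Y Y'" and c: "b \<cdot> u = u' \<cdot> a"
  note t [simp] = T[unfolded Dist_iff]
  have ob [simp]: "X \<in> obj K" "X' \<in> obj K" "Y \<in> obj K" "Y' \<in> obj K" "Z \<in> obj K" "Z' \<in> obj K"
    using t dm_obj cd_obj by metis+
  have ab [simp]: "arr a" "dm a = X" "cd a = X'" "arr b" "dm b = Y" "cd b = Y'"
    using ab by (simp_all add: Mor_iff)
  have D: "D u v (om X \<triangleright> w)" "D u' v' (om X' \<triangleright> w')" by simp_all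
  obtain c where c: "arr c" "dm c = Z" "cd c = Z'" "v' \<cdot> b = c \<cdot> v"
    "a \<triangleleft> (om X \<triangleright> w) = om X' \<triangleright> w' \<triangleright> c"
    using D_ET3[OF D, of a b] c by auto
  \<comment> \<open>(ET3) provides compatibility of \<open>a\<close> and \<open>c\<close> with the
    extensions; cancelling \<open>om X'\<close> gives the last square of (TR3).\<close>
  have "om X' \<triangleright> (sm a \<cdot> w) = (om X' \<triangleright> sm a) \<triangleright> w" by simp
  also have "\<dots> = om X' \<triangleright> (w' \<cdot> c)" using sm(4)[of a] c(1-3,5) by simp
  finally have "sm a \<cdot> w = w' \<cdot> c"
    using om_inj[of X' "sm a \<cdot> w" "w' \<cdot> c"] c(1-3) by simp
  then show "\<exists>c\<in>Mor K Z Z'. c \<cdot> v = v' \<cdot> b \<and> sm a \<cdot> w = w' \<cdot> c"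
    using c(1-4) by (auto simp: Mor_iff)
next
  fix X Y Z X' Y' Z' u v i i' j j' k k'
  assume T: "(X, Y, Z', u, i, i') \<in> Dist" "(Y, Z, X', v, j, j') \<in> Dist"
    "(X, Z, Y', v \<cdot> u, k, k') \<in> Dist"
  note t [simp] = T(1,2)[unfolded Dist_iff]
  have ob [simp]: "X \<in> obj K" "Y \<in> obj K" "Z \<in> obj K" "X' \<in> obj K" "Z' \<in> obj K"
    using t dm_obj cd_obj by metis+
  have [simp]: "arr k" "dm k = Z" "cd k = Y'" "arr k'" "dm k' = Y'" "cd k' = so X"
    using T(3) by (simp_all add: Dist_iff)
  have [simp]: "Y' \<in> obj K" using dm_obj[of k'] by simp
  have D: "D u i (om X \<triangleright> i')" "D v j (om Y \<triangleright> j')" "D (v \<cdot> u) k (om X \<triangleright> k')"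
    using T by (simp_all add: Dist_iff)
  have "dm v = cd u" by simp
  from D_ET4[OF D(1,2) this] obtain h d p q where 1: "D (v \<cdot> u) h d" "arr p" "dm p = cd i"
    "cd p = cd h" "arr q" "dm q = cd h" "cd q = cd j" "p \<cdot> i = h \<cdot> v" "q \<cdot> h = j"
    "D p q (i \<triangleleft> (om Y \<triangleright> j'))" "d \<triangleright> p = om X \<triangleright> i'" "u \<triangleleft> d = om Y \<triangleright> j' \<triangleright> q"
    by blast
  have [simp]: "arr h" "dm h = Z" "xt d" "ea d = X" "eb d = cd h" using D_arr[OF 1(1)] by simp_all
  \<comment> \<open>(ET4) chooses its own cone of \<open>v \<cdot> u\<close>. It is isomorphic to
    the prescribed one by \<open>c\<close>, along which both maps of the octahedron are
    transported.\<close>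
  obtain c c' where c: "inverses c c'" "dm c = cd h" "cd c = cd k" "c \<cdot> h = k"
    "d = om X \<triangleright> k' \<triangleright> c"
    using end_unique[OF 1(1) D(3)] by blast
  note C = inversesD[OF c(1)]
  have [simp]: "arr c" "arr c'" "dm c = cd h" "cd c = Y'" "dm c' = Y'" "cd c' = cd h"
    using C c by simp_all
  have [simp]: "arr p" "dm p = Z'" "cd p = cd h" "arr q" "dm q = cd h" "cd q = X'"
    using 1 by simp_all
  define f where "f = c \<cdot> p"
  define g where "g = q \<cdot> c'"
  have [simp]: "arr f" "dm f = Z'" "cd f = Y'" "arr g" "dm g = Y'" "cd g = X'"
    by (simp_all add: f_def g_def)
  \<comment> \<open>The extension \<open>i \<triangleleft> (om Y \<triangleright> j')\<close>
    delivered by (ET4) is classified by \<open>sm i \<cdot> j'\<close>, since the shift of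
    \<open>i\<close> carries pushout along \<open>i\<close> to a pullback of
    \<open>om Z'\<close>.\<close>
  have Dfg: "D f g (om Z' \<triangleright> (sm i \<cdot> j'))"
  proof -
    have "om Z' \<triangleright> (sm i \<cdot> j') = (om Z' \<triangleright> sm i) \<triangleright> j'" by simp
    also have "\<dots> = i \<triangleleft> (om Y \<triangleright> j')" using sm(4)[of i] by simp
    finally show ?thesis
      using D_mid[OF 1(10) c(1)] by (simp add: f_def g_def)
  qed
  have "f \<cdot> i = c \<cdot> (h \<cdot> v)" by (simp add: f_def 1(8))
  then have fi: "f \<cdot> i = k \<cdot> v" by (simp flip: c(4))
  have "om X \<triangleright> (k' \<cdot> f) = (om X \<triangleright> k' \<triangleright> c) \<triangleright> p" by (simp add: f_def)
  also have "\<dots> = om X \<triangleright> i'" using 1(11) unfolding c(5) .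
  finally have kf: "k' \<cdot> f = i'" using om_inj[of X "k' \<cdot> f" i'] by simp
  have "g \<cdot> k = q \<cdot> (c' \<cdot> (c \<cdot> h))" by (simp add: g_def c(4))
  also have "\<dots> = j" using C(7)[of h] 1(9) by simp
  finally have gk: "g \<cdot> k = j" .
  \<comment> \<open>The last relation of (ET4) equates two extensions; both are rewritten as
    pullbacks of \<open>om Y\<close>, which is then cancelled.\<close>
  have "om Y \<triangleright> (j' \<cdot> g) = (om Y \<triangleright> j' \<triangleright> q) \<triangleright> c'" by (simp add: g_def)
  also have "\<dots> = u \<triangleleft> (om X \<triangleright> k' \<triangleright> (c \<cdot> c'))"
    unfolding 1(12)[symmetric] by (subst c(5)) simp
  also have "\<dots> = (om Y \<triangleright> sm u) \<triangleright> k'" using C(6) sm(4)[of u] by (simp del: ra_comp)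
  also have "\<dots> = om Y \<triangleright> (sm u \<cdot> k')" by simp
  finally have jg: "j' \<cdot> g = sm u \<cdot> k'" using om_inj[of Y "j' \<cdot> g" "sm u \<cdot> k'"] by simp
  show "\<exists>f\<in>Mor K Z' Y'. \<exists>g\<in>Mor K Y' X'. (Z', Y', X', f, g, sm i \<cdot> j') \<in> Dist \<and>
      f \<cdot> i = k \<cdot> v \<and> k' \<cdot> f = i' \<and> g \<cdot> k = j \<and> j' \<cdot> g = sm u \<cdot> k'"
    by (rule bexI[of _ f], rule bexI[of _ g]) (simp_all add: Dist_iff Mor_iff Dfg[simplified] fi kf gk jg)
qed

end

section \<open>Ideal quotients of additive categories\<close>

text \<open>Closure under direct sums makes the morphisms through \<open>I\<close> closed under
  addition, and a member of \<open>I\<close> is what zero morphisms factor through.\<close>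

locale additive_ideal = additive_category K
  for K :: "('o, 'm, 'z) cat_scheme" (structure) +
  fixes I :: "'o set"
  assumes I_obj: "I \<subseteq> obj K"
    and I_nonempty: "I \<noteq> {}"
    and I_dsum: "\<lbrakk>A \<in> I; B \<in> I; is_biproduct K A B S\<rbrakk> \<Longrightarrow> dsum S \<in> I"
begin

abbreviation "Q \<equiv> ideal_quotient K I"

definition null :: "'m \<Rightarrow> bool" where
  "null f \<longleftrightarrow> (\<exists>h k. arr h \<and> arr k \<and> cd k = dm h \<and> dm h \<in> I \<and> f = h \<cdot> k)"

definition cl :: "'m \<Rightarrow> 'm set" where
  "cl f = fact_ideal K I (dm f) (cd f) #>\<^bsub>Hom K (dm f) (cd f)\<^esub> f"

lemma null_arr: "null f \<Longrightarrow> arr f"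
  unfolding null_def by auto

lemma fact_ideal_iff:
  assumes "A \<in> obj K" "B \<in> obj K"
  shows "f \<in> fact_ideal K I A B \<longleftrightarrow> null f \<and> dm f = A \<and> cd f = B"
proof
  assume "f \<in> fact_ideal K I A B"
  then obtain h k X where *: "f = h \<cdot> k" "X \<in> I" "k \<in> Mor K A X" "h \<in> Mor K X B"
    unfolding fact_ideal_def by blast
  then have "X \<in> obj K" using I_obj by blast
  then have h: "arr h" "arr k" "cd k = dm h" "dm h \<in> I" "dm k = A" "cd h = B"
    using * assms by (simp_all add: Mor_iff)
  then have "null f" unfolding null_def using *(1) by blast
  then show "null f \<and> dm f = A \<and> cd f = B" using h *(1) by simp
next
  assume "null f \<and> dm f = A \<and> cd f = B"
  then obtain h k where *: "arr h" "arr k" "cd k = dm h" "dm h \<in> I" "f = h \<cdot> k" "dm f = A" "cd f = B"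
    unfolding null_def by blast
  then have "k \<in> Mor K A (dm h)" "h \<in> Mor K (dm h) B"
    using arr_mem[of h] arr_mem[of k] by auto
  then show "f \<in> fact_ideal K I A B"
    unfolding fact_ideal_def using * by blast
qed

lemma null_comp:
  assumes "null f" "arr g"
  shows "dm g = cd f \<Longrightarrow> null (g \<cdot> f)" "cd g = dm f \<Longrightarrow> null (f \<cdot> g)"
proof -
  obtain h k where f: "arr h" "arr k" "cd k = dm h" "dm h \<in> I" "f = h \<cdot> k"
    using assms(1) unfolding null_def by blast
  show "null (g \<cdot> f)" if "dm g = cd f"
    unfolding null_def by (rule exI[of _ "g \<cdot> h"], rule exI[of _ k]) (use f that assms in auto)
  show "null (f \<cdot> g)" if "cd g = dm f"
    unfolding null_def by (rule exI[of _ h], rule exI[of _ "k \<cdot> g"]) (use f that assms in auto)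
qed

lemma null_zr: "A \<in> obj K \<Longrightarrow> B \<in> obj K \<Longrightarrow> null (zr A B)"
proof -
  assume AB: "A \<in> obj K" "B \<in> obj K"
  obtain X where "X \<in> I" "X \<in> obj K" using I_nonempty I_obj by blast
  then show ?thesis
    unfolding null_def using AB by (intro exI[of _ "zr X B"] exI[of _ "zr A X"]) simp
qed

lemma null_ng: "null f \<Longrightarrow> null (ng f)"
  using null_comp(1)[of f "ng (ident K (cd f))"] null_arr[of f] by simp

text \<open>The two factorizations combine into a row and a column through the direct sum of the
  intermediate objects.\<close>

lemma null_pl:
  assumes "null f" "null g" "dm g = dm f" "cd g = cd f"
  shows "null (f \<boxplus> g)"
proof -
  obtain h k where f: "arr h" "arr k" "cd k = dm h" "dm h \<in> I" "f = h \<cdot> k"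
    using assms(1) unfolding null_def by blast
  obtain h' k' where g: "arr h'" "arr k'" "cd k' = dm h'" "dm h' \<in> I" "g = h' \<cdot> k'"
    using assms(2) unfolding null_def by blast
  have k: "dm k' = dm k" "cd h' = cd h" using assms f g by auto
  obtain S where S: "is_biproduct K (dm h) (dm h') S"
    using biproduct_exists[of "dm h" "dm h'"] f(1) g(1) by auto
  note [simp] = biproductD[OF S] f(1-3) g(1-3) k
  have 1: "prl S \<cdot> (inl S \<cdot> k) = k" "prr S \<cdot> (inr S \<cdot> k') = k'"
    using comp_ident_cancel[of "prl S" "inl S" k] comp_ident_cancel[of "prr S" "inr S" k'] by simp_all
  have 2: "prl S \<cdot> (inr S \<cdot> k') = zr (dm k) (dm h)" "prr S \<cdot> (inl S \<cdot> k) = zr (dm k) (dm h')"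
    using assoc[of k' "inr S" "prl S"] assoc[of k "inl S" "prr S"] by simp_all
  have "f \<boxplus> g = (h \<cdot> prl S \<boxplus> h' \<cdot> prr S) \<cdot> (inl S \<cdot> k \<boxplus> inr S \<cdot> k')"
    by (simp add: f g 1 2)
  moreover have "dsum S \<in> I" using I_dsum[OF f(4) g(4) S] .
  ultimately show ?thesis
    unfolding null_def
    by (intro exI[of _ "h \<cdot> prl S \<boxplus> h' \<cdot> prr S"] exI[of _ "inl S \<cdot> k \<boxplus> inr S \<cdot> k'"]) simp
qed

lemma fact_ideal_normal:
  assumes "A \<in> obj K" "B \<in> obj K"
  shows "fact_ideal K I A B \<lhd> Hom K A B"
proof -
  interpret comm_group "Hom K A B" using assms by (rule Hom_group)
  have "subgroup (fact_ideal K I A B) (Hom K A B)"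
  proof (rule subgroupI)
    show "fact_ideal K I A B \<subseteq> Mor K A B"
      using assms by (auto simp: fact_ideal_iff Mor_iff null_arr)
    show "fact_ideal K I A B \<noteq> {}"
      using assms null_zr[of A B] fact_ideal_iff[of A B "zr A B"] by auto
  next
    fix f assume "f \<in> fact_ideal K I A B"
    then show "inv\<^bsub>Hom K A B\<^esub> f \<in> fact_ideal K I A B"
      using assms by (simp add: fact_ideal_iff ng_eq null_ng null_arr)
  next
    fix f g assume "f \<in> fact_ideal K I A B" "g \<in> fact_ideal K I A B"
    then show "f \<otimes>\<^bsub>Hom K A B\<^esub> g \<in> fact_ideal K I A B"
      using assms by (simp add: fact_ideal_iff mult_eq null_pl null_arr)
  qed
  then show ?thesis by (rule subgroup_imp_normal)
qed

lemma mem_cl_iff: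
  assumes "arr f"
  shows "g \<in> cl f \<longleftrightarrow> arr g \<and> dm g = dm f \<and> cd g = cd f \<and> null (g \<boxplus> ng f)"
proof -
  interpret normal "fact_ideal K I (dm f) (cd f)" "Hom K (dm f) (cd f)"
    using assms by (simp add: fact_ideal_normal)
  have G: "group (Hom K (dm f) (cd f))" ..
  show ?thesis
  proof
    assume g: "g \<in> cl f"
    then have "g \<in> Mor K (dm f) (cd f)"
      unfolding cl_def using elemrcos_carrier[OF G arr_mem[OF assms]] by blast
    moreover from this have "g \<otimes>\<^bsub>Hom K (dm f) (cd f)\<^esub> inv\<^bsub>Hom K (dm f) (cd f)\<^esub> f
        \<in> fact_ideal K I (dm f) (cd f)"
      using g rcos_module[OF G arr_mem[OF assms]] unfolding cl_def by blast
    ultimately show "arr g \<and> dm g = dm f \<and> cd g = cd f \<and> null (g \<boxplus> ng f)"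
      using assms by (simp add: Mor_iff fact_ideal_iff mult_eq ng_eq)
  next
    assume g: "arr g \<and> dm g = dm f \<and> cd g = cd f \<and> null (g \<boxplus> ng f)"
    then have "g \<in> Mor K (dm f) (cd f)" "g \<otimes>\<^bsub>Hom K (dm f) (cd f)\<^esub> inv\<^bsub>Hom K (dm f) (cd f)\<^esub> f
        \<in> fact_ideal K I (dm f) (cd f)"
      using assms by (simp_all add: Mor_iff fact_ideal_iff mult_eq ng_eq)
    then show "g \<in> cl f" unfolding cl_def using rcos_module[OF G arr_mem[OF assms]] by blast
  qed
qed

lemma cl_self: "arr f \<Longrightarrow> f \<in> cl f"
  by (simp add: mem_cl_iff null_zr)

lemma cl_eqI:
  assumes "arr f" "g \<in> cl f"
  shows "cl g = cl f"
proof -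
  interpret normal "fact_ideal K I (dm f) (cd f)" "Hom K (dm f) (cd f)"
    using assms by (simp add: fact_ideal_normal)
  have "dm g = dm f" "cd g = cd f" using assms by (simp_all add: mem_cl_iff)
  then show ?thesis
    using repr_independence[OF _ arr_mem[OF assms(1)] is_subgroup] assms(2)
    unfolding cl_def by simp
qed

lemma cl_eq_iff:
  assumes "arr f" "arr g"
  shows "cl g = cl f \<longleftrightarrow> dm g = dm f \<and> cd g = cd f \<and> null (g \<boxplus> ng f)"
  using cl_eqI[of f g] cl_self[of g] mem_cl_iff[of f g] assms by blast

lemma obj_Q [simp]: "obj Q = obj K"
  by (simp add: ideal_quotient_def)

lemma Mor_Q:
  assumes "A \<in> obj K" "B \<in> obj K"
  shows "P \<in> Mor Q A B \<longleftrightarrow> (\<exists>f. arr f \<and> dm f = A \<and> cd f = B \<and> P = cl f)"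
  using assms
  by (auto simp: ideal_quotient_def carrier_FactGroup Mor_iff cl_def image_iff)

lemma cl_Mor: "\<lbrakk>arr f; dm f = A; cd f = B\<rbrakk> \<Longrightarrow> cl f \<in> Mor Q A B"
  using Mor_Q[of "dm f" "cd f"] by auto

lemma ident_Q: "A \<in> obj K \<Longrightarrow> ident Q A = cl (ident K A)"
  by (simp add: ideal_quotient_def cl_def)

lemma mzero_Q:
  assumes "A \<in> obj K" "B \<in> obj K"
  shows "mzero Q A B = cl (zr A B)"
proof -
  interpret normal "fact_ideal K I A B" "Hom K A B"
    using assms by (rule fact_ideal_normal)
  show ?thesis
    using assms coset_join2[OF _ is_subgroup subgroup.one_closed[OF is_subgroup]] arr_mem[of "zr A B"]
    by (simp add: ideal_quotient_def cl_def)
qed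

lemma mult_Q:
  assumes "arr f" "arr g" "dm g = dm f" "cd g = cd f" "A = dm f" "B = cd f"
  shows "cl f \<otimes>\<^bsub>Hom Q A B\<^esub> cl g = cl (f \<boxplus> g)"
proof -
  interpret normal "fact_ideal K I (dm f) (cd f)" "Hom K (dm f) (cd f)"
    using assms by (simp add: fact_ideal_normal)
  show ?thesis
    using assms rcos_sum[OF arr_mem[of f], of g] arr_mem[of g]
    by (simp add: ideal_quotient_def cl_def mult_eq)
qed

text \<open>Composition in the quotient is a union over all representatives, so the point is that
  every choice yields the same coset.\<close>

lemma comp_Q:
  assumes "arr f" "arr g" "dm g = cd f"
  shows "cl g \<cdot>\<^bsub>Q\<^esub> cl f = cl (g \<cdot> f)"
proof -
  have eq: "cl (g' \<cdot> f') = cl (g \<cdot> f)" if "f' \<in> cl f" "g' \<in> cl g" for f' g'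
  proof -
    have f': "arr f'" "dm f' = dm f" "cd f' = cd f" "null (f' \<boxplus> ng f)"
      and g': "arr g'" "dm g' = dm g" "cd g' = cd g" "null (g' \<boxplus> ng g)"
      using that assms by (simp_all add: mem_cl_iff)
    \<comment> \<open>The representatives are changed one at a time; the intermediate composite is
      \<open>g' \<cdot> f\<close>.\<close>
    have "null (g' \<cdot> f' \<boxplus> ng (g' \<cdot> f))" "null (g' \<cdot> f \<boxplus> ng (g \<cdot> f))"
      using null_comp(1)[OF f'(4) g'(1)] null_comp(2)[OF g'(4) assms(1)] f'(1-3) g'(1-3) assms
      by simp_all
    then have "null (g' \<cdot> f' \<boxplus> ng (g' \<cdot> f) \<boxplus> (g' \<cdot> f \<boxplus> ng (g \<cdot> f)))"
      using f'(1-3) g'(1-3) assms by - (rule null_pl, simp_all)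
    then show ?thesis
      using f' g' assms by (simp add: cl_eq_iff pl_assoc)
  qed
  have *: "fact_ideal K I A C #>\<^bsub>Hom K A C\<^esub> (g' \<cdot> f') = cl (g \<cdot> f)"
    if "A \<in> obj K" "C \<in> obj K" "f' \<in> cl f" "g' \<in> cl g" "g' \<cdot> f' \<in> Mor K A C" for A C f' g'
    using eq[OF that(3,4)] that(1,2,5) by (simp add: Mor_iff cl_def)
  have "dm f \<in> obj K" "cd g \<in> obj K" "g \<cdot> f \<in> Mor K (dm f) (cd g)"
    using assms by (simp_all add: Mor_iff)
  then have "{fact_ideal K I A C #>\<^bsub>Hom K A C\<^esub> (g' \<cdot> f') | A C f' g'.
      A \<in> obj K \<and> C \<in> obj K \<and> f' \<in> cl f \<and> g' \<in> cl g \<and> g' \<cdot> f' \<in> Mor K A C} = {cl (g \<cdot> f)}"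
    using * cl_self[OF assms(1)] cl_self[OF assms(2)] by blast
  then show ?thesis by (simp add: ideal_quotient_def)
qed

lemma category_Q: "category Q"
proof
  fix A B A' B' P
  assume *: "A \<in> obj Q" "B \<in> obj Q" "A' \<in> obj Q" "B' \<in> obj Q" "P \<in> Mor Q A B" "P \<in> Mor Q A' B'"
  then obtain f g where "arr f" "dm f = A" "cd f = B" "P = cl f" "arr g" "dm g = A'" "cd g = B'" "P = cl g"
    by (auto simp: Mor_Q)
  then show "A = A' \<and> B = B'" using cl_eq_iff[of f g] by simp
next
  fix A B C P R assume *: "A \<in> obj Q" "B \<in> obj Q" "C \<in> obj Q" "P \<in> Mor Q A B" "R \<in> Mor Q B C"
  then obtain f g where "arr f" "dm f = A" "cd f = B" "P = cl f" "arr g" "dm g = B" "cd g = C" "R = cl g"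
    by (auto simp: Mor_Q)
  then show "R \<cdot>\<^bsub>Q\<^esub> P \<in> Mor Q A C"
    using * by (auto simp: Mor_Q comp_Q intro!: exI[of _ "g \<cdot> f"])
next
  fix A assume "A \<in> obj Q"
  then show "ident Q A \<in> Mor Q A A"
    by (auto simp: Mor_Q ident_Q intro!: exI[of _ "ident K A"])
qed (auto simp: Mor_Q comp_Q ident_Q)

text \<open>Zero objects and biproducts are given by equations between morphisms, and passing to
  classes preserves these.\<close>

lemma additive_Q: "additive_category Q"
proof -
  interpret Q: category Q by (rule category_Q)
  have "comm_group (Hom Q A B)" if "A \<in> obj Q" "B \<in> obj Q" for A B
  proof -
    interpret comm_group "Hom K A B" using that by (simp add: Hom_group)
    show ?thesis
      using abelian_FactGroup[OF normal_imp_subgroup[OF fact_ideal_normal]] that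
      by (simp add: ideal_quotient_def)
  qed
  then have "preadditive_category_axioms Q"
    by (intro preadditive_category_axioms.intro) (simp_all add: Mor_Q, auto simp: comp_Q mult_Q)
  then interpret Q: preadditive_category Q
    by (intro preadditive_category.intro category_Q)
  show ?thesis
  proof
    obtain Z where Z: "is_zero_obj K Z" using zero_obj_exists by blast
    then have "is_zero_obj Q Z"
      using zero_obj_ident[OF Z] by (intro Q.zero_objI) (simp_all add: ident_Q mzero_Q)
    then show "\<exists>Z. is_zero_obj Q Z" by blast
  next
    fix A B assume "A \<in> obj Q" "B \<in> obj Q"
    then obtain S where S: "is_biproduct K A B S" using biproduct_exists by auto
    note [simp] = biproductD[OF S]
    have "is_biproduct Q A B \<lparr>dsum = dsum S, inl = cl (inl S), inr = cl (inr S),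
        prl = cl (prl S), prr = cl (prr S)\<rparr>"
      unfolding is_biproduct_def by (simp add: cl_Mor comp_Q ident_Q mzero_Q mult_Q)
    then show "\<exists>S. is_biproduct Q A B S" by blast
  qed
qed

end

section \<open>The stable category\<close>

context pre_extriangulated
begin

text \<open>Both lifting properties are required at once: extension along first maps corrects
  squares at the beginning of a sequence, and lifting along second maps corrects them at its
  end.\<close>

definition projinj :: "'o set" where
  "projinj = {J \<in> obj K. \<forall>x y d. D x y d \<longrightarrow>
    (\<forall>k. arr k \<longrightarrow> dm k = dm x \<longrightarrow> cd k = J \<longrightarrow>
      (\<exists>g. arr g \<and> dm g = cd x \<and> cd g = J \<and> g \<cdot> x = k)) \<and>
    (\<forall>k. arr k \<longrightarrow> dm k = J \<longrightarrow> cd k = cd y \<longrightarrow>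
      (\<exists>g. arr g \<and> dm g = J \<and> cd g = cd x \<and> y \<cdot> g = k))}"

lemma projinj_extend:
  "\<lbrakk>J \<in> projinj; D x y d; arr k; dm k = dm x; cd k = J\<rbrakk>
    \<Longrightarrow> \<exists>g. arr g \<and> dm g = cd x \<and> cd g = J \<and> g \<cdot> x = k"
  unfolding projinj_def by blast

lemma projinj_lift:
  "\<lbrakk>J \<in> projinj; D x y d; arr k; dm k = J; cd k = cd y\<rbrakk>
    \<Longrightarrow> \<exists>g. arr g \<and> dm g = J \<and> cd g = cd x \<and> y \<cdot> g = k"
  unfolding projinj_def by blast

lemma zero_obj_projinj:
  assumes "is_zero_obj K Z"
  shows "Z \<in> projinj"
proof -
  note Z [simp] = zero_obj_ident(1)[OF assms]
  have "\<exists>g. arr g \<and> dm g = cd x \<and> cd g = Z \<and> g \<cdot> x = k"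
    if "D x y d" "arr k" "dm k = dm x" "cd k = Z" for x y d k
    using that D_arr[OF that(1)] zero_objD(2)[OF assms that(2,4)]
    by (intro exI[of _ "zr (cd x) Z"]) simp
  moreover have "\<exists>g. arr g \<and> dm g = Z \<and> cd g = cd x \<and> y \<cdot> g = k"
    if "D x y d" "arr k" "dm k = Z" "cd k = cd y" for x y d k
    using that D_arr[OF that(1)] zero_objD(1)[OF assms that(2,3)]
    by (intro exI[of _ "zr Z (cd x)"]) simp
  ultimately show ?thesis unfolding projinj_def using Z by blast
qed

text \<open>Extensions and lifts are found for the two summands separately and reassembled by the
  decomposition of the identity of the direct sum.\<close>

lemma dsum_projinj:
  assumes "A \<in> projinj" "B \<in> projinj" "is_biproduct K A B S"
  shows "dsum S \<in> projinj"
proof -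
  note [simp] = biproductD[OF assms(3)]
  have "\<exists>g. arr g \<and> dm g = cd x \<and> cd g = dsum S \<and> g \<cdot> x = k"
    if k: "D x y d" "arr k" "dm k = dm x" "cd k = dsum S" for x y d k
  proof -
    note [simp] = D_arr[OF k(1)] k(2-4)
    obtain g h where g: "arr g" "dm g = cd x" "cd g = A" "g \<cdot> x = prl S \<cdot> k"
      and h: "arr h" "dm h = cd x" "cd h = B" "h \<cdot> x = prr S \<cdot> k"
      using projinj_extend[OF assms(1) k(1), of "prl S \<cdot> k"]
        projinj_extend[OF assms(2) k(1), of "prr S \<cdot> k"] by auto
    have "(inl S \<cdot> g \<boxplus> inr S \<cdot> h) \<cdot> x = (inl S \<cdot> prl S \<boxplus> inr S \<cdot> prr S) \<cdot> k"
      using g h by (simp del: biproductD(20)[OF assms(3)])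
    then show ?thesis using g h by (intro exI[of _ "inl S \<cdot> g \<boxplus> inr S \<cdot> h"]) simp
  qed
  moreover have "\<exists>g. arr g \<and> dm g = dsum S \<and> cd g = cd x \<and> y \<cdot> g = k"
    if k: "D x y d" "arr k" "dm k = dsum S" "cd k = cd y" for x y d k
  proof -
    note [simp] = D_arr[OF k(1)] k(2-4)
    obtain g h where g: "arr g" "dm g = A" "cd g = cd x" "y \<cdot> g = k \<cdot> inl S"
      and h: "arr h" "dm h = B" "cd h = cd x" "y \<cdot> h = k \<cdot> inr S"
      using projinj_lift[OF assms(1) k(1), of "k \<cdot> inl S"]
        projinj_lift[OF assms(2) k(1), of "k \<cdot> inr S"] by auto
    have "y \<cdot> (g \<cdot> prl S) = k \<cdot> (inl S \<cdot> prl S)" "y \<cdot> (h \<cdot> prr S) = k \<cdot> (inr S \<cdot> prr S)"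
      using g h comp_eqD[OF g(4), of "prl S"] comp_eqD[OF h(4), of "prr S"] by simp_all
    then have "y \<cdot> (g \<cdot> prl S \<boxplus> h \<cdot> prr S) = k \<cdot> (inl S \<cdot> prl S \<boxplus> inr S \<cdot> prr S)"
      using g h by (simp del: biproductD(20)[OF assms(3)])
    then show ?thesis using g h by (intro exI[of _ "g \<cdot> prl S \<boxplus> h \<cdot> prr S"]) simp
  qed
  ultimately show ?thesis unfolding projinj_def by (simp, blast)
qed

end

sublocale pre_extriangulated \<subseteq> additive_ideal K projinj
proof
  show "projinj \<noteq> {}" using zero_obj_exists zero_obj_projinj by blast
qed (use dsum_projinj in \<open>auto simp: projinj_def\<close>)

context additive_ideal
begin

interpretation Q: additive_category Q by (rule additive_Q)

lemma arr_cl: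
  assumes "arr f"
  shows "Q.arr (cl f)" "Q.dm (cl f) = dm f" "Q.cd (cl f) = cd f"
  using cl_Mor[of f "dm f" "cd f"] Q.Mor_iff[of "dm f" "cd f" "cl f"] assms by simp_all

lemma arr_QE:
  assumes "Q.arr P"
  obtains f where "arr f" "Q.dm P = dm f" "Q.cd P = cd f" "P = cl f"
  using Q.arr_mem[OF assms] Q.dm_obj[OF assms] Q.cd_obj[OF assms] by (auto simp: Mor_Q)

lemma pl_Q: "\<lbrakk>arr f; arr g; dm g = dm f; cd g = cd f\<rbrakk> \<Longrightarrow> Q.pl (cl f) (cl g) = cl (f \<boxplus> g)"
  by (simp add: Q.pl_def arr_cl mult_Q)

text \<open>The identity of \<open>J\<close> factors through \<open>J\<close>, so its class is
  zero.\<close>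

lemma zero_obj_Q: "J \<in> I \<Longrightarrow> is_zero_obj Q J"
proof (rule Q.zero_objI)
  assume J: "J \<in> I"
  then have [simp]: "J \<in> obj K" using I_obj by blast
  have "null (ident K J)"
    unfolding null_def by (intro exI[of _ "ident K J"]) (use J in simp)
  then have "null (ident K J \<boxplus> ng (zr J J))" by simp
  then show "ident Q J = mzero Q J J" by (simp add: ident_Q mzero_Q cl_eq_iff)
qed (use I_obj in auto)

lemma mem_cl_SOME: "arr f \<Longrightarrow> (SOME g. g \<in> cl f) \<in> cl f"
  by (rule someI[where P = "\<lambda>g. g \<in> cl f"]) (rule cl_self)

lemma biproduct_Q:
  assumes "is_biproduct K A B S"
  shows "is_biproduct Q A B \<lparr>dsum = dsum S, inl = cl (inl S), inr = cl (inr S),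
        prl = cl (prl S), prr = cl (prr S)\<rparr>"
  using biproductD[OF assms]
  unfolding is_biproduct_def by (simp add: cl_Mor comp_Q ident_Q mzero_Q mult_Q)

end

section \<open>The action of the quotient on extensions\<close>

context pre_extriangulated
begin

text \<open>Well defined because null morphisms act as zero on extensions (see \<open>QEM_cl\<close>).\<close>

definition QEM :: "'m set \<Rightarrow> 'm set \<Rightarrow> 'e \<Rightarrow> 'e" where
  "QEM P R = EM (SOME c. c \<in> P) (SOME a. a \<in> R)"

text \<open>If the first term is projective-injective, its identity factors as
  \<open>g \<cdot> x\<close>, and \<open>x \<triangleleft> d\<close> vanishes. For the end term the
  argument is dual.\<close>

lemma ext_projinj:
  assumes "xt d"
  shows "ea d \<in> projinj \<Longrightarrow> d = ezr (eb d) (ea d)" "eb d \<in> projinj \<Longrightarrow> d = ezr (eb d) (ea d)"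
proof -
  obtain x y where D: "D x y d" using D_exists[OF assms] by blast
  have x: "arr x" "arr y" "dm x = ea d" "cd y = eb d" "dm y = cd x" using D_arr[OF D] by simp_all
  show "d = ezr (eb d) (ea d)" if J: "ea d \<in> projinj"
  proof -
    obtain g where g: "arr g" "dm g = cd x" "cd g = ea d" "g \<cdot> x = ident K (ea d)"
      using projinj_extend[OF J D, of "ident K (ea d)"] x assms by auto
    have "ident K (ea d) \<triangleleft> d = g \<triangleleft> (x \<triangleleft> d)" using g(1-3) x assms by (simp flip: g(4))
    then show ?thesis using D_zero(2)[OF D] g(1-3) x assms by simp
  qed
  show "d = ezr (eb d) (ea d)" if J: "eb d \<in> projinj"
  proof -
    obtain g where g: "arr g" "dm g = eb d" "cd g = cd x" "y \<cdot> g = ident K (eb d)"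
      using projinj_lift[OF J D, of "ident K (eb d)"] x assms by auto
    have "d \<triangleright> ident K (eb d) = (d \<triangleright> y) \<triangleright> g" using g(1-3) x assms by (simp flip: g(4))
    then show ?thesis using D_zero(3)[OF D] g(1-3) x assms by simp
  qed
qed

text \<open>The action of \<open>f\<close> passes through a group of extensions at an object of
  \<open>projinj\<close>, which is zero. Hence morphisms of one class act alike.\<close>

lemma null_la:
  assumes "null f" "xt d" "dm f = ea d"
  shows "f \<triangleleft> d = ezr (eb d) (cd f)"
proof -
  obtain h k where f: "arr h" "arr k" "cd k = dm h" "dm h \<in> projinj" "f = h \<cdot> k"
    using assms(1) unfolding null_def by blast
  have "dm k = ea d" using f assms(3) by simp
  moreover from this have "k \<triangleleft> d = ezr (eb d) (dm h)"
    using ext_projinj(1)[of "k \<triangleleft> d"] f(1-4) assms(2) by simp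
  ultimately show ?thesis using f assms(2) by simp
qed

lemma null_ra:
  assumes "null f" "xt d" "cd f = eb d"
  shows "d \<triangleright> f = ezr (dm f) (ea d)"
proof -
  obtain h k where f: "arr h" "arr k" "cd k = dm h" "dm h \<in> projinj" "f = h \<cdot> k"
    using assms(1) unfolding null_def by blast
  have "cd h = eb d" using f assms(3) by simp
  moreover from this have "d \<triangleright> h = ezr (dm h) (ea d)"
    using ext_projinj(2)[of "d \<triangleright> h"] f(1-4) assms(2) by simp
  ultimately show ?thesis using f assms(2) by simp
qed

lemma mem_cl_la:
  assumes "g \<in> cl f" "arr f" "xt d" "dm f = ea d"
  shows "g \<triangleleft> d = f \<triangleleft> d"
proof -
  have g: "arr g" "dm g = dm f" "cd g = cd f" "null (g \<boxplus> ng f)"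
    using assms by (simp_all add: mem_cl_iff)
  then have "(g \<boxplus> ng f) \<triangleleft> d = ezr (eb d) (cd f)"
    using null_la[OF g(4)] assms(2-) by simp
  then show ?thesis using g(1-3) assms(2-) by - (rule diff_ezrD, simp_all)
qed

lemma mem_cl_ra:
  assumes "g \<in> cl f" "arr f" "xt d" "cd f = eb d"
  shows "d \<triangleright> g = d \<triangleright> f"
proof -
  have g: "arr g" "dm g = dm f" "cd g = cd f" "null (g \<boxplus> ng f)"
    using assms by (simp_all add: mem_cl_iff)
  then have "d \<triangleright> (g \<boxplus> ng f) = ezr (dm f) (ea d)"
    using null_ra[OF g(4)] assms(2-) by simp
  then show ?thesis using g(1-3) assms(2-) by - (rule diff_ezrD, simp_all)
qed

lemma QEM_cl:
  assumes "arr c" "arr a" "e \<in> carrier (Ex (cd c) (dm a))"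
  shows "QEM (cl c) (cl a) e = EM c a e"
proof -
  define c' where "c' = (SOME g. g \<in> cl c)"
  define a' where "a' = (SOME g. g \<in> cl a)"
  have c': "c' \<in> cl c" and a': "a' \<in> cl a"
    using assms mem_cl_SOME by (auto simp: c'_def a'_def)
  let ?d = "(cd c, dm a, e)"
  have [simp]: "xt ?d" using assms by (simp add: xt_triple)
  have [simp]: "arr c'" "dm c' = dm c" "cd c' = cd c" "arr a'" "dm a' = dm a" "cd a' = cd a"
    using c' a' assms by (simp_all add: mem_cl_iff)
  have "a' \<triangleleft> ?d \<triangleright> c' = a \<triangleleft> ?d \<triangleright> c"
    using mem_cl_la[OF a', of "?d \<triangleright> c"] mem_cl_ra[OF c', of ?d] assms by simp
  then show ?thesis
    using la_ra(1)[of ?d a' c'] la_ra(1)[of ?d a c] assms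
    by (simp add: QEM_def flip: c'_def a'_def)
qed

interpretation Q: additive_category Q by (rule additive_Q)

lemma biadditive_Q: "biadditive Q Ex QEM"
proof (intro biadditive.intro additive_Q biadditive_axioms.intro)
  fix A C assume "C \<in> obj Q" "A \<in> obj Q"
  then show "comm_group (Ex C A)" by (simp add: Ex_group)
next
  fix P R assume "Q.arr P" "Q.arr R"
  then obtain c a where ca: "arr c" "P = cl c" "arr a" "R = cl a" by (metis arr_QE)
  then show "QEM P R \<in> hom (Ex (Q.cd P) (Q.dm R)) (Ex (Q.dm P) (Q.cd R))"
    using EM_hom[of c a] Ex_group[of "cd c" "dm a"]
    by (auto simp: arr_cl hom_def QEM_cl comm_group_def comm_monoid_def monoid.m_closed)
next
  fix A C e assume "A \<in> obj Q" "C \<in> obj Q" "e \<in> carrier (Ex C A)"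
  then show "QEM (ident Q C) (ident Q A) e = e"
    by (simp add: ident_Q QEM_cl EM_ident)
next
  fix P P' R R' e
  assume *: "Q.arr P" "Q.arr P'" "Q.cd P' = Q.dm P" "Q.arr R" "Q.arr R'" "Q.dm R' = Q.cd R"
    "e \<in> carrier (Ex (Q.cd P) (Q.dm R))"
  obtain c c' a a' where "arr c" "P = cl c" "arr a" "R = cl a" "arr c'" "P' = cl c'"
    "arr a'" "R' = cl a'" using *(1,2,4,5) by (metis arr_QE)
  then show "QEM (P \<cdot>\<^bsub>Q\<^esub> P') (R' \<cdot>\<^bsub>Q\<^esub> R) e = QEM P' R' (QEM P R e)"
    using *(3,6,7) EM_comp[of c c' a a' e] EM_closed[of c a e]
    by (simp add: arr_cl comp_Q QEM_cl)
next
  fix R R' C e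
  assume *: "Q.arr R" "Q.arr R'" "Q.dm R' = Q.dm R" "Q.cd R' = Q.cd R" "C \<in> obj Q"
    "e \<in> carrier (Ex C (Q.dm R))"
  obtain a a' where "arr a" "R = cl a" "arr a'" "R' = cl a'" using *(1,2) by (metis arr_QE)
  then show "QEM (ident Q C) (Q.pl R R') e =
      QEM (ident Q C) R e \<otimes>\<^bsub>Ex C (Q.cd R)\<^esub> QEM (ident Q C) R' e"
    using *(3-) EM_covariant[of a a' C e] by (simp add: arr_cl pl_Q ident_Q QEM_cl)
next
  fix P P' A e
  assume *: "Q.arr P" "Q.arr P'" "Q.dm P' = Q.dm P" "Q.cd P' = Q.cd P" "A \<in> obj Q"
    "e \<in> carrier (Ex (Q.cd P) A)"
  obtain c c' where "arr c" "P = cl c" "arr c'" "P' = cl c'" using *(1,2) by (metis arr_QE)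
  then show "QEM (Q.pl P P') (ident Q A) e =
      QEM P (ident Q A) e \<otimes>\<^bsub>Ex (Q.dm P) A\<^esub> QEM P' (ident Q A) e"
    using *(3-) EM_contravariant[of c c' A e] by (simp add: arr_cl pl_Q ident_Q QEM_cl)
qed

end

section \<open>The realization in the quotient\<close>

context pre_extriangulated
begin

interpretation Q: biadditive Q Ex QEM by (rule biadditive_Q)

lemma xt_Q: "Q.xt d \<longleftrightarrow> xt d"
  unfolding Q.xt_def xt_def by simp

lemma la_Q: "\<lbrakk>xt d; arr a; dm a = ea d\<rbrakk> \<Longrightarrow> Q.la (cl a) d = a \<triangleleft> d"
  by (simp add: Q.la_def la_def arr_cl ident_Q QEM_cl xt_und)

lemma ra_Q: "\<lbrakk>xt d; arr c; cd c = eb d\<rbrakk> \<Longrightarrow> Q.ra d (cl c) = d \<triangleright> c"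
  by (simp add: Q.ra_def ra_def arr_cl ident_Q QEM_cl xt_und)

text \<open>The realization keeps its end terms; only the middle term is replaced by a stably isomorphic
  one.\<close>

definition QD :: "'m set \<Rightarrow> 'm set \<Rightarrow> 'o \<times> 'o \<times> 'e \<Rightarrow> bool" where
  "QD U V d \<longleftrightarrow> (\<exists>x y b b'. D x y d \<and> Q.inverses b b' \<and> Q.dm b = cd x \<and>
    U = b \<cdot>\<^bsub>Q\<^esub> cl x \<and> V = cl y \<cdot>\<^bsub>Q\<^esub> b')"

lemma QD_cl:
  assumes "D x y d"
  shows "QD (cl x) (cl y) d"
  unfolding QD_def
proof (intro exI conjI)
  note [simp] = D_arr[OF assms]
  show "Q.inverses (ident Q (cd x)) (ident Q (cd x))" by (rule Q.inverses_ident) simp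
  show "D x y d" by fact
qed (use D_arr[OF assms] in \<open>simp_all add: arr_cl\<close>)

lemma QDE:
  assumes "QD U V d"
  obtains x y b b' where "D x y d" "Q.inverses b b'" "Q.dm b = cd x" "U = b \<cdot>\<^bsub>Q\<^esub> cl x"
    "V = cl y \<cdot>\<^bsub>Q\<^esub> b'" "Q.dm U = dm x" "Q.cd U = Q.cd b" "Q.dm V = Q.cd b" "Q.cd V = cd y"
    "Q.arr U" "Q.arr V" "b' \<cdot>\<^bsub>Q\<^esub> U = cl x" "V \<cdot>\<^bsub>Q\<^esub> b = cl y"
proof -
  obtain x y b b' where *: "D x y d" "Q.inverses b b'" "Q.dm b = cd x" "U = b \<cdot>\<^bsub>Q\<^esub> cl x"
    "V = cl y \<cdot>\<^bsub>Q\<^esub> b'"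
    using assms unfolding QD_def by blast
  note b = Q.inversesD[OF *(2)]
  show ?thesis
    by (rule that[OF *]) (use b * D_arr[OF *(1)] in \<open>simp_all add: arr_cl\<close>)
qed

text \<open>A square that commutes in the quotient can be made to commute on the nose, by extending (or,
  in the next lemma, lifting) the error term along \<open>x\<close> (or \<open>y\<close>).\<close>

lemma strict_left:
  assumes "D x y d" "arr h" "dm h = cd x" "arr g" "dm g = dm x" "cd g = cd h"
    and "cl h \<cdot>\<^bsub>Q\<^esub> cl x = cl g"
  shows "\<exists>h'. arr h' \<and> dm h' = cd x \<and> cd h' = cd h \<and> cl h' = cl h \<and> h' \<cdot> x = g"
proof -
  note [simp] = D_arr[OF assms(1)] assms(2-6)
  have "null (h \<cdot> x \<boxplus> ng g)" using assms(7) by (simp add: comp_Q cl_eq_iff)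
  then obtain p k where k: "arr p" "arr k" "cd k = dm p" "dm p \<in> projinj" "h \<cdot> x \<boxplus> ng g = p \<cdot> k"
    unfolding null_def by blast
  have pk: "dm k = dm x" "cd p = cd h"
    using arg_cong[OF k(5), of dm] arg_cong[OF k(5), of cd] k(1-3) by simp_all
  obtain k' where k': "arr k'" "dm k' = cd x" "cd k' = dm p" "k' \<cdot> x = k"
    using projinj_extend[OF k(4) assms(1) k(2)] pk k(3) by auto
  note [simp] = k(1-3) pk k'
  \<comment> \<open>\<open>n\<close> is null and its restriction along \<open>x\<close> is the whole
    error, so subtracting it from \<open>h\<close> corrects the square and preserves the
    class.\<close>
  define n where "n = p \<cdot> k'"
  have "null n" unfolding n_def null_def using k(4) by (intro exI[of _ p] exI[of _ k']) simp
  have [simp]: "arr n" "dm n = cd x" "cd n = cd h" by (simp_all add: n_def)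
  have nx: "n \<cdot> x = h \<cdot> x \<boxplus> ng g" by (simp add: n_def k(5))
  have "(h \<boxplus> ng n) \<cdot> x \<boxplus> ng g = zr (dm x) (cd h)"
  proof -
    have "(h \<boxplus> ng n) \<cdot> x \<boxplus> ng g = ng (n \<cdot> x) \<boxplus> (h \<cdot> x \<boxplus> ng g)" by (simp add: pl_ac)
    then show ?thesis by (simp flip: nx)
  qed
  then have "(h \<boxplus> ng n) \<cdot> x = g"
    by - (rule diff_zr_iff[THEN iffD1], simp_all)
  moreover have "cl (h \<boxplus> ng n) = cl h"
  proof -
    have "h \<boxplus> ng n \<boxplus> ng h = ng n" by (simp add: pl_ac)
    then show ?thesis using null_ng[OF \<open>null n\<close>] by (simp add: cl_eq_iff)
  qed
  ultimately show ?thesis by (intro exI[of _ "h \<boxplus> ng n"]) simp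
qed

lemma strict_right:
  assumes "D x y d" "arr h" "cd h = cd x" "arr g" "dm g = dm h" "cd g = cd y"
    and "cl y \<cdot>\<^bsub>Q\<^esub> cl h = cl g"
  shows "\<exists>h'. arr h' \<and> dm h' = dm h \<and> cd h' = cd x \<and> cl h' = cl h \<and> y \<cdot> h' = g"
proof -
  note [simp] = D_arr[OF assms(1)] assms(2-6)
  have "null (y \<cdot> h \<boxplus> ng g)" using assms(7) by (simp add: comp_Q cl_eq_iff)
  then obtain p k where k: "arr p" "arr k" "cd k = dm p" "dm p \<in> projinj" "y \<cdot> h \<boxplus> ng g = p \<cdot> k"
    unfolding null_def by blast
  have pk: "dm k = dm h" "cd p = cd y"
    using arg_cong[OF k(5), of dm] arg_cong[OF k(5), of cd] k(1-3) by simp_all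
  obtain p' where p': "arr p'" "dm p' = dm p" "cd p' = cd x" "y \<cdot> p' = p"
    using projinj_lift[OF k(4) assms(1) k(1)] pk k(3) by auto
  note [simp] = k(1-3) pk p'(1-3)
  \<comment> \<open>Dually, the second factor \<open>p\<close> of the error has been lifted along
    \<open>y\<close>, so that \<open>y \<cdot> n\<close> is the error.\<close>
  define n where "n = p' \<cdot> k"
  have "null n" unfolding n_def null_def using k(4) by (intro exI[of _ p'] exI[of _ k]) simp
  have [simp]: "arr n" "dm n = dm h" "cd n = cd x" by (simp_all add: n_def)
  have nx: "y \<cdot> n = y \<cdot> h \<boxplus> ng g"
    using assoc[of k p' y] by (simp add: n_def k(5) p'(4))
  have "y \<cdot> (h \<boxplus> ng n) \<boxplus> ng g = zr (dm h) (cd y)"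
  proof -
    have "y \<cdot> (h \<boxplus> ng n) \<boxplus> ng g = ng (y \<cdot> n) \<boxplus> (y \<cdot> h \<boxplus> ng g)" by (simp add: pl_ac)
    then show ?thesis by (simp flip: nx)
  qed
  then have "y \<cdot> (h \<boxplus> ng n) = g"
    by - (rule diff_zr_iff[THEN iffD1], simp_all)
  moreover have "cl (h \<boxplus> ng n) = cl h"
  proof -
    have "h \<boxplus> ng n \<boxplus> ng h = ng n" by (simp add: pl_ac)
    then show ?thesis using null_ng[OF \<open>null n\<close>] by (simp add: cl_eq_iff)
  qed
  ultimately show ?thesis by (intro exI[of _ "h \<boxplus> ng n"]) simp
qed

text \<open>The groups of extensions are unchanged, so the compatibility condition already holds for
  representatives of \<open>a\<close> and \<open>c\<close>, and lifting in \<open>F\<close> applies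
  without correction. The result is conjugated by the stable isomorphisms of the middle
  terms.\<close>

lemma QD_lift:
  assumes U: "QD U V d" and U': "QD U' V' d'" and a: "Q.arr a" "Q.dm a = Q.dm U" "Q.cd a = Q.dm U'"
    and c: "Q.arr c" "Q.dm c = Q.cd V" "Q.cd c = Q.cd V'" and eq: "Q.la a d = Q.ra d' c"
  shows "\<exists>b. Q.arr b \<and> Q.dm b = Q.cd U \<and> Q.cd b = Q.cd U' \<and> b \<cdot>\<^bsub>Q\<^esub> U = U' \<cdot>\<^bsub>Q\<^esub> a \<and>
    V' \<cdot>\<^bsub>Q\<^esub> b = c \<cdot>\<^bsub>Q\<^esub> V"
proof -
  obtain x y b bi where x: "D x y d" "Q.inverses b bi" "Q.dm b = cd x" "U = b \<cdot>\<^bsub>Q\<^esub> cl x"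
    "V = cl y \<cdot>\<^bsub>Q\<^esub> bi" "Q.dm U = dm x" "Q.cd U = Q.cd b" "Q.dm V = Q.cd b" "Q.cd V = cd y"
    "Q.arr U" "Q.arr V" "bi \<cdot>\<^bsub>Q\<^esub> U = cl x" "V \<cdot>\<^bsub>Q\<^esub> b = cl y"
    by (rule QDE[OF U])
  obtain x' y' b' bi' where x': "D x' y' d'" "Q.inverses b' bi'" "Q.dm b' = cd x'"
    "U' = b' \<cdot>\<^bsub>Q\<^esub> cl x'" "V' = cl y' \<cdot>\<^bsub>Q\<^esub> bi'" "Q.dm U' = dm x'" "Q.cd U' = Q.cd b'"
    "Q.dm V' = Q.cd b'" "Q.cd V' = cd y'" "Q.arr U'" "Q.arr V'" "bi' \<cdot>\<^bsub>Q\<^esub> U' = cl x'"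
    "V' \<cdot>\<^bsub>Q\<^esub> b' = cl y'"
    by (rule QDE[OF U'])
  note [simp] = D_arr[OF x(1)] D_arr[OF x'(1)] x(3,6-11) x'(3,6-11) arr_cl
  note B = Q.inversesD[OF x(2)] and B' = Q.inversesD[OF x'(2)]
  note [simp] = B(1-4) B'(1-4)
  obtain a0 where a0: "arr a0" "Q.dm a = dm a0" "Q.cd a = cd a0" "a = cl a0"
    by (rule arr_QE[OF a(1)])
  obtain c0 where c0: "arr c0" "Q.dm c = dm c0" "Q.cd c = cd c0" "c = cl c0"
    by (rule arr_QE[OF c(1)])
  have t: "dm a0 = dm x" "cd a0 = dm x'" "dm c0 = cd y" "cd c0 = cd y'"
    using a c a0(2,3) c0(2,3) by simp_all
  note [simp] = a0(1) c0(1) t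
  have "a0 \<triangleleft> d = d' \<triangleright> c0" using eq unfolding a0(4) c0(4) by (simp add: la_Q ra_Q)
  then obtain h where h: "arr h" "dm h = cd x" "cd h = cd x'" "h \<cdot> x = x' \<cdot> a0" "y' \<cdot> h = c0 \<cdot> y"
    using D_lift[OF x(1) x'(1), of a0 c0] by auto
  note [simp] = h(1-3)
  have e: "cl h \<cdot>\<^bsub>Q\<^esub> cl x = cl x' \<cdot>\<^bsub>Q\<^esub> a" "cl y' \<cdot>\<^bsub>Q\<^esub> cl h = c \<cdot>\<^bsub>Q\<^esub> cl y"
    by (simp_all add: comp_Q a0(4) c0(4) h(4,5))
  let ?b = "b' \<cdot>\<^bsub>Q\<^esub> (cl h \<cdot>\<^bsub>Q\<^esub> bi)"
  have "?b \<cdot>\<^bsub>Q\<^esub> U = b' \<cdot>\<^bsub>Q\<^esub> (cl h \<cdot>\<^bsub>Q\<^esub> (bi \<cdot>\<^bsub>Q\<^esub> U))" by simp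
  also have "\<dots> = U' \<cdot>\<^bsub>Q\<^esub> a" unfolding x(12) e x'(4) using a by simp
  finally have 1: "?b \<cdot>\<^bsub>Q\<^esub> U = U' \<cdot>\<^bsub>Q\<^esub> a" .
  have "V' \<cdot>\<^bsub>Q\<^esub> ?b = ((V' \<cdot>\<^bsub>Q\<^esub> b') \<cdot>\<^bsub>Q\<^esub> cl h) \<cdot>\<^bsub>Q\<^esub> bi" by simp
  also have "\<dots> = c \<cdot>\<^bsub>Q\<^esub> V" unfolding x'(13) e x(5) using c by simp
  finally have 2: "V' \<cdot>\<^bsub>Q\<^esub> ?b = c \<cdot>\<^bsub>Q\<^esub> V" .
  show ?thesis by (rule exI[of _ ?b]) (use 1 2 in simp)
qed

text \<open>Conjugated to the strict sequences, the given square commutes only up to a null map;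
  \<open>strict_left\<close> replaces the representative of the middle map so that (ET3) of
  \<open>F\<close> can be used.\<close>

lemma QD_ET3:
  assumes U: "QD U V d" and U': "QD U' V' d'" and a: "Q.arr a" "Q.dm a = Q.dm U" "Q.cd a = Q.dm U'"
    and m: "Q.arr m" "Q.dm m = Q.cd U" "Q.cd m = Q.cd U'" and eq: "m \<cdot>\<^bsub>Q\<^esub> U = U' \<cdot>\<^bsub>Q\<^esub> a"
  shows "\<exists>c. Q.arr c \<and> Q.dm c = Q.cd V \<and> Q.cd c = Q.cd V' \<and> V' \<cdot>\<^bsub>Q\<^esub> m = c \<cdot>\<^bsub>Q\<^esub> V \<and>
    Q.la a d = Q.ra d' c"
proof -
  obtain x y b bi where x: "D x y d" "Q.inverses b bi" "Q.dm b = cd x" "U = b \<cdot>\<^bsub>Q\<^esub> cl x"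
    "V = cl y \<cdot>\<^bsub>Q\<^esub> bi" "Q.dm U = dm x" "Q.cd U = Q.cd b" "Q.dm V = Q.cd b" "Q.cd V = cd y"
    "Q.arr U" "Q.arr V" "bi \<cdot>\<^bsub>Q\<^esub> U = cl x" "V \<cdot>\<^bsub>Q\<^esub> b = cl y"
    by (rule QDE[OF U])
  obtain x' y' b' bi' where x': "D x' y' d'" "Q.inverses b' bi'" "Q.dm b' = cd x'"
    "U' = b' \<cdot>\<^bsub>Q\<^esub> cl x'" "V' = cl y' \<cdot>\<^bsub>Q\<^esub> bi'" "Q.dm U' = dm x'" "Q.cd U' = Q.cd b'"
    "Q.dm V' = Q.cd b'" "Q.cd V' = cd y'" "Q.arr U'" "Q.arr V'" "bi' \<cdot>\<^bsub>Q\<^esub> U' = cl x'"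
    "V' \<cdot>\<^bsub>Q\<^esub> b' = cl y'"
    by (rule QDE[OF U'])
  note [simp] = D_arr[OF x(1)] D_arr[OF x'(1)] x(3,6-11) x'(3,6-11) arr_cl
  note B = Q.inversesD[OF x(2)] and B' = Q.inversesD[OF x'(2)]
  note [simp] = B(1-4) B'(1-4)
  have mt: "Q.dm m = Q.cd b" "Q.cd m = Q.cd b'" using m by simp_all
  note [simp] = m(1) mt
  obtain a0 where a0: "arr a0" "Q.dm a = dm a0" "Q.cd a = cd a0" "a = cl a0"
    by (rule arr_QE[OF a(1)])
  have n: "Q.arr (bi' \<cdot>\<^bsub>Q\<^esub> (m \<cdot>\<^bsub>Q\<^esub> b))" by simp
  obtain h0 where h0: "arr h0" "Q.dm (bi' \<cdot>\<^bsub>Q\<^esub> (m \<cdot>\<^bsub>Q\<^esub> b)) = dm h0"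
    "Q.cd (bi' \<cdot>\<^bsub>Q\<^esub> (m \<cdot>\<^bsub>Q\<^esub> b)) = cd h0" "bi' \<cdot>\<^bsub>Q\<^esub> (m \<cdot>\<^bsub>Q\<^esub> b) = cl h0"
    by (rule arr_QE[OF n])
  have t: "dm a0 = dm x" "cd a0 = dm x'" "dm h0 = cd x" "cd h0 = cd x'"
    using a a0(2,3) h0(2,3) by simp_all
  note [simp] = a0(1) h0(1) t
  have "cl h0 \<cdot>\<^bsub>Q\<^esub> cl x = bi' \<cdot>\<^bsub>Q\<^esub> (m \<cdot>\<^bsub>Q\<^esub> U)"
    unfolding h0(4)[symmetric] x(4) by simp
  also have "\<dots> = (bi' \<cdot>\<^bsub>Q\<^esub> U') \<cdot>\<^bsub>Q\<^esub> a" unfolding eq using a by simp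
  also have "\<dots> = cl (x' \<cdot> a0)" unfolding x'(12) a0(4) by (simp add: comp_Q)
  finally obtain h where h: "arr h" "dm h = cd x" "cd h = cd x'" "cl h = cl h0" "h \<cdot> x = x' \<cdot> a0"
    using strict_left[OF x(1), of h0 "x' \<cdot> a0"] by auto
  obtain c where c: "arr c" "dm c = cd y" "cd c = cd y'" "y' \<cdot> h = c \<cdot> y" "a0 \<triangleleft> d = d' \<triangleright> c"
    using D_ET3[OF x(1) x'(1), of a0 h] h by auto
  note [simp] = h(1-3) c(1-3)
  have "cl c \<cdot>\<^bsub>Q\<^esub> V = (cl c \<cdot>\<^bsub>Q\<^esub> cl y) \<cdot>\<^bsub>Q\<^esub> bi" unfolding x(5) by simp
  also have "\<dots> = (cl y' \<cdot>\<^bsub>Q\<^esub> cl h) \<cdot>\<^bsub>Q\<^esub> bi" by (simp add: comp_Q c(4))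
  also have "\<dots> = (cl y' \<cdot>\<^bsub>Q\<^esub> (bi' \<cdot>\<^bsub>Q\<^esub> (m \<cdot>\<^bsub>Q\<^esub> b))) \<cdot>\<^bsub>Q\<^esub> bi" unfolding h(4) h0(4) ..
  also have "\<dots> = V' \<cdot>\<^bsub>Q\<^esub> m" unfolding x'(5) using B(6) by simp
  finally show ?thesis
    by (intro exI[of _ "cl c"]) (simp add: a0(4) la_Q ra_Q c(5))
qed

text \<open>Dual to \<open>QD_ET3\<close>: the square now lies over the second maps and is corrected
  by \<open>strict_right\<close>.\<close>

lemma QD_ET3_op:
  assumes U: "QD U V d" and U': "QD U' V' d'"
    and m: "Q.arr m" "Q.dm m = Q.cd U" "Q.cd m = Q.cd U'"
    and c: "Q.arr c" "Q.dm c = Q.cd V" "Q.cd c = Q.cd V'" and eq: "V' \<cdot>\<^bsub>Q\<^esub> m = c \<cdot>\<^bsub>Q\<^esub> V"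
  shows "\<exists>a. Q.arr a \<and> Q.dm a = Q.dm U \<and> Q.cd a = Q.dm U' \<and> m \<cdot>\<^bsub>Q\<^esub> U = U' \<cdot>\<^bsub>Q\<^esub> a \<and>
    Q.la a d = Q.ra d' c"
proof -
  obtain x y b bi where x: "D x y d" "Q.inverses b bi" "Q.dm b = cd x" "U = b \<cdot>\<^bsub>Q\<^esub> cl x"
    "V = cl y \<cdot>\<^bsub>Q\<^esub> bi" "Q.dm U = dm x" "Q.cd U = Q.cd b" "Q.dm V = Q.cd b" "Q.cd V = cd y"
    "Q.arr U" "Q.arr V" "bi \<cdot>\<^bsub>Q\<^esub> U = cl x" "V \<cdot>\<^bsub>Q\<^esub> b = cl y"
    by (rule QDE[OF U])
  obtain x' y' b' bi' where x': "D x' y' d'" "Q.inverses b' bi'" "Q.dm b' = cd x'"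
    "U' = b' \<cdot>\<^bsub>Q\<^esub> cl x'" "V' = cl y' \<cdot>\<^bsub>Q\<^esub> bi'" "Q.dm U' = dm x'" "Q.cd U' = Q.cd b'"
    "Q.dm V' = Q.cd b'" "Q.cd V' = cd y'" "Q.arr U'" "Q.arr V'" "bi' \<cdot>\<^bsub>Q\<^esub> U' = cl x'"
    "V' \<cdot>\<^bsub>Q\<^esub> b' = cl y'"
    by (rule QDE[OF U'])
  note [simp] = D_arr[OF x(1)] D_arr[OF x'(1)] x(3,6-11) x'(3,6-11) arr_cl
  note B = Q.inversesD[OF x(2)] and B' = Q.inversesD[OF x'(2)]
  note [simp] = B(1-4) B'(1-4)
  have mt: "Q.dm m = Q.cd b" "Q.cd m = Q.cd b'" using m by simp_all
  note [simp] = m(1) mt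
  obtain c0 where c0: "arr c0" "Q.dm c = dm c0" "Q.cd c = cd c0" "c = cl c0"
    by (rule arr_QE[OF c(1)])
  have n: "Q.arr (bi' \<cdot>\<^bsub>Q\<^esub> (m \<cdot>\<^bsub>Q\<^esub> b))" by simp
  obtain h0 where h0: "arr h0" "Q.dm (bi' \<cdot>\<^bsub>Q\<^esub> (m \<cdot>\<^bsub>Q\<^esub> b)) = dm h0"
    "Q.cd (bi' \<cdot>\<^bsub>Q\<^esub> (m \<cdot>\<^bsub>Q\<^esub> b)) = cd h0" "bi' \<cdot>\<^bsub>Q\<^esub> (m \<cdot>\<^bsub>Q\<^esub> b) = cl h0"
    by (rule arr_QE[OF n])
  have t: "dm c0 = cd y" "cd c0 = cd y'" "dm h0 = cd x" "cd h0 = cd x'"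
    using c c0(2,3) h0(2,3) by simp_all
  note [simp] = c0(1) h0(1) t
  have "cl y' \<cdot>\<^bsub>Q\<^esub> cl h0 = (V' \<cdot>\<^bsub>Q\<^esub> m) \<cdot>\<^bsub>Q\<^esub> b"
    unfolding h0(4)[symmetric] x'(5) by simp
  also have "\<dots> = c \<cdot>\<^bsub>Q\<^esub> (V \<cdot>\<^bsub>Q\<^esub> b)" unfolding eq using c by simp
  also have "\<dots> = cl (c0 \<cdot> y)" unfolding x(13) c0(4) by (simp add: comp_Q)
  finally obtain h where h: "arr h" "dm h = cd x" "cd h = cd x'" "cl h = cl h0" "y' \<cdot> h = c0 \<cdot> y"
    using strict_right[OF x'(1), of h0 "c0 \<cdot> y"] by auto
  obtain a where a: "arr a" "dm a = dm x" "cd a = dm x'" "h \<cdot> x = x' \<cdot> a" "a \<triangleleft> d = d' \<triangleright> c0"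
    using D_ET3_op[OF x(1) x'(1), of h c0] h by auto
  note [simp] = h(1-3) a(1-3)
  have "U' \<cdot>\<^bsub>Q\<^esub> cl a = b' \<cdot>\<^bsub>Q\<^esub> (cl x' \<cdot>\<^bsub>Q\<^esub> cl a)" unfolding x'(4) by simp
  also have "\<dots> = b' \<cdot>\<^bsub>Q\<^esub> (cl h \<cdot>\<^bsub>Q\<^esub> cl x)" by (simp add: comp_Q a(4))
  also have "\<dots> = b' \<cdot>\<^bsub>Q\<^esub> ((bi' \<cdot>\<^bsub>Q\<^esub> (m \<cdot>\<^bsub>Q\<^esub> b)) \<cdot>\<^bsub>Q\<^esub> cl x)" unfolding h(4) h0(4) ..
  also have "\<dots> = m \<cdot>\<^bsub>Q\<^esub> U" unfolding x(4) using B'(8) by simp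
  finally show ?thesis
    by (intro exI[of _ "cl a"]) (simp add: c0(4) la_Q ra_Q a(5))
qed

lemma pre_extriangulated_Q: "pre_extriangulated Q Ex QEM QD"
proof (intro pre_extriangulated.intro biadditive_Q pre_extriangulated_axioms.intro)
  fix U V d assume "QD U V d"
  then obtain x y b bi where x: "D x y d" "Q.inverses b bi" "Q.dm b = cd x" "U = b \<cdot>\<^bsub>Q\<^esub> cl x"
    "V = cl y \<cdot>\<^bsub>Q\<^esub> bi" "Q.dm U = dm x" "Q.cd U = Q.cd b" "Q.dm V = Q.cd b" "Q.cd V = cd y"
    "Q.arr U" "Q.arr V" "bi \<cdot>\<^bsub>Q\<^esub> U = cl x" "V \<cdot>\<^bsub>Q\<^esub> b = cl y"
    by (rule QDE)
  then show "Q.arr U \<and> Q.arr V \<and> Q.dm V = Q.cd U \<and> Q.xt d \<and> ea d = Q.dm U \<and> eb d = Q.cd V"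
    using D_arr[OF x(1)] xt_Q by simp
next
  fix d assume "Q.xt d"
  then show "\<exists>U V. QD U V d" using D_exists[of d] QD_cl xt_Q by blast
next
  fix U V d b b' assume "QD U V d" and b: "Q.inverses b b'" "Q.dm b = Q.cd U"
  then obtain x y h hi where x: "D x y d" "Q.inverses h hi" "Q.dm h = cd x" "U = h \<cdot>\<^bsub>Q\<^esub> cl x"
    "V = cl y \<cdot>\<^bsub>Q\<^esub> hi" "Q.cd U = Q.cd h"
    by (elim QDE) blast
  note [simp] = D_arr[OF x(1)] arr_cl x(3,6) b(2)
  note B = Q.inversesD[OF b(1)] and H = Q.inversesD[OF x(2)]
  show "QD (b \<cdot>\<^bsub>Q\<^esub> U) (V \<cdot>\<^bsub>Q\<^esub> b') d"
    unfolding QD_def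
  proof (intro exI conjI)
    show "Q.inverses (b \<cdot>\<^bsub>Q\<^esub> h) (hi \<cdot>\<^bsub>Q\<^esub> b')"
      using Q.inverses_comp[OF x(2) b(1)] by simp
    show "D x y d" by fact
  qed (use B(1-4) H(1-4) x in simp_all)
next
  fix A C assume "A \<in> obj Q" "C \<in> obj Q"
  then obtain S where S: "is_biproduct K A C S"
    "D (inl S) (prr S) (ezr C A)" "D (inr S) (prl S) (ezr A C)"
    using D_split[of A C] by auto
  show "\<exists>S. is_biproduct Q A C S \<and> QD (inl S) (prr S) (ezr C A) \<and> QD (inr S) (prl S) (ezr A C)"
    using biproduct_Q[OF S(1)] QD_cl[OF S(2)] QD_cl[OF S(3)]
    by (intro exI[of _ "\<lparr>dsum = dsum S, inl = cl (inl S), inr = cl (inr S),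
        prl = cl (prl S), prr = cl (prr S)\<rparr>"]) simp
qed (fact QD_lift QD_ET3 QD_ET3_op)+

end

section \<open>The octahedral axiom in the quotient\<close>

context weak_extriangulated
begin

interpretation Q: pre_extriangulated Q Ex QEM QD by (rule pre_extriangulated_Q)

text \<open>The obstacle is that strict sequences behind \<open>f\<close> and \<open>g\<close> need
  not be composable: the middle term of the first is only stably isomorphic to the first term of the
  second. The second extension is therefore pushed forward to start at \<open>cd x\<close>, (ET4) of
  \<open>F\<close> is applied there, and the outcome is carried back.\<close>

lemma QD_ET4:
  assumes U: "QD f f' d" and W: "QD g g' d'" and gf: "Q.dm g = Q.cd f"
  shows "\<exists>h' d'' u v. QD (g \<cdot>\<^bsub>Q\<^esub> f) h' d'' \<and>
      Q.arr u \<and> Q.dm u = Q.cd f' \<and> Q.cd u = Q.cd h' \<and> Q.arr v \<and> Q.dm v = Q.cd h' \<and>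
      Q.cd v = Q.cd g' \<and> u \<cdot>\<^bsub>Q\<^esub> f' = h' \<cdot>\<^bsub>Q\<^esub> g \<and> v \<cdot>\<^bsub>Q\<^esub> h' = g' \<and>
      QD u v (Q.la f' d') \<and> Q.ra d'' u = d \<and> Q.la f d'' = Q.ra d' v"
proof -
  obtain x y b bi where x: "D x y d" "Q.inverses b bi" "Q.dm b = cd x" "f = b \<cdot>\<^bsub>Q\<^esub> cl x"
    "f' = cl y \<cdot>\<^bsub>Q\<^esub> bi" "Q.dm f = dm x" "Q.cd f = Q.cd b" "Q.dm f' = Q.cd b" "Q.cd f' = cd y"
    "Q.arr f" "Q.arr f'" "bi \<cdot>\<^bsub>Q\<^esub> f = cl x" "f' \<cdot>\<^bsub>Q\<^esub> b = cl y"
    by (rule QDE[OF U])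
  have g: "Q.arr g" "Q.arr g'" "Q.dm g' = Q.cd g" "xt d'" "ea d' = Q.cd b" "eb d' = Q.cd g'"
    "Q.dm g = Q.cd b"
    using Q.D_arr[OF W] gf x(7) by (simp_all add: xt_Q)
  note [simp] = D_arr[OF x(1)] x(3,6-11) g arr_cl
  note B = Q.inversesD[OF x(2)]
  note [simp] = B(1-4)
  obtain bo where bo: "arr bo" "Q.dm b = dm bo" "Q.cd b = cd bo" "b = cl bo"
    by (rule arr_QE[OF B(1)])
  obtain bj where bj: "arr bj" "Q.dm bi = dm bj" "Q.cd bi = cd bj" "bi = cl bj"
    by (rule arr_QE[OF B(2)])
  have t: "dm bo = cd x" "dm bj = Q.cd b" "cd bj = cd x" "cd bo = Q.cd b"
    using bo(2,3) bj(2,3) B(3,4) x(3) by metis+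
  note [simp] = bo(1) bj(1) t
  \<comment> \<open>\<open>bj\<close> represents the inverse stable isomorphism and need not be
    invertible in \<open>F\<close>; pushing forward along it is enough to make the first term of the
    new extension equal to \<open>cd x\<close>.\<close>
  define e where "e = bj \<triangleleft> d'"
  have xte: "xt e" by (simp add: e_def)
  then obtain x2 y2 where x2: "D x2 y2 e" using D_exists by blast
  have [simp]: "arr x2" "arr y2" "dm y2 = cd x2" "dm x2 = cd x" "cd y2 = Q.cd g'"
    using D_arr[OF x2] by (simp_all add: e_def)
  have ob: "Q.cd g' \<in> obj Q" "Q.cd g' \<in> obj K" using Q.cd_obj[OF g(2)] by simp_all
  have "Q.la bi d' = Q.ra e (ident Q (Q.cd g'))"
    using ob by (simp add: bj(4) la_Q ident_Q ra_Q e_def)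
  \<comment> \<open>In the quotient, \<open>bi\<close> and an identity form an isomorphism of
    extensions from \<open>d'\<close> to \<open>e\<close>, so \<open>mid_iso\<close> identifies the
    codomain of \<open>g\<close> with \<open>cd x2\<close>.\<close>
  then obtain c ci where c: "Q.inverses c ci" "Q.dm c = Q.cd g" "Q.cd c = cd x2"
    "c \<cdot>\<^bsub>Q\<^esub> g = cl x2 \<cdot>\<^bsub>Q\<^esub> bi" "cl y2 \<cdot>\<^bsub>Q\<^esub> c = g'"
    using Q.mid_iso[OF W QD_cl[OF x2] Q.inverses_sym[OF x(2)] _ _ Q.inverses_ident[OF ob(1)]] ob
    by auto
  note C = Q.inversesD[OF c(1)]
  note [simp] = C(1-4) c(2,3)
  have "dm x2 = cd x" by simp
  from D_ET4[OF x(1) x2 this] obtain h' d'' u v where 1: "D (x2 \<cdot> x) h' d''"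
    "arr u" "dm u = cd y" "cd u = cd h'" "arr v" "dm v = cd h'" "cd v = cd y2"
    "u \<cdot> y = h' \<cdot> x2" "v \<cdot> h' = y2" "D u v (y \<triangleleft> e)" "d'' \<triangleright> u = d" "x \<triangleleft> d'' = e \<triangleright> v"
    by blast
  have [simp]: "arr h'" "dm h' = cd x2" "xt d''" "ea d'' = dm x" "eb d'' = cd h'"
    using D_arr[OF 1(1)] by simp_all
  have 17: "cd v = Q.cd g'" using 1(7) by simp
  note [simp] = 1(2-6) 17
  have "g \<cdot>\<^bsub>Q\<^esub> f = ci \<cdot>\<^bsub>Q\<^esub> ((c \<cdot>\<^bsub>Q\<^esub> g) \<cdot>\<^bsub>Q\<^esub> f)" using C(7) by simp
  also have "\<dots> = ci \<cdot>\<^bsub>Q\<^esub> (cl x2 \<cdot>\<^bsub>Q\<^esub> (bi \<cdot>\<^bsub>Q\<^esub> f))" unfolding c(4) by simp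
  also have "\<dots> = ci \<cdot>\<^bsub>Q\<^esub> cl (x2 \<cdot> x)" unfolding x(12) by (simp add: comp_Q)
  finally have gf': "g \<cdot>\<^bsub>Q\<^esub> f = ci \<cdot>\<^bsub>Q\<^esub> cl (x2 \<cdot> x)" .
  let ?h = "cl h' \<cdot>\<^bsub>Q\<^esub> c"
  have D: "QD (g \<cdot>\<^bsub>Q\<^esub> f) ?h d''"
    unfolding gf' by (rule Q.D_mid[OF QD_cl[OF 1(1)] Q.inverses_sym[OF c(1)]]) simp
  have "cl u \<cdot>\<^bsub>Q\<^esub> f' = (cl u \<cdot>\<^bsub>Q\<^esub> cl y) \<cdot>\<^bsub>Q\<^esub> bi" unfolding x(5) by simp
  also have "\<dots> = cl h' \<cdot>\<^bsub>Q\<^esub> (cl x2 \<cdot>\<^bsub>Q\<^esub> bi)"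
    using Q.assoc[of bi "cl x2" "cl h'"] by (simp add: comp_Q 1(8))
  finally have uf: "cl u \<cdot>\<^bsub>Q\<^esub> f' = ?h \<cdot>\<^bsub>Q\<^esub> g" by (simp flip: c(4))
  have "cl v \<cdot>\<^bsub>Q\<^esub> ?h = (cl v \<cdot>\<^bsub>Q\<^esub> cl h') \<cdot>\<^bsub>Q\<^esub> c" by simp
  also have "\<dots> = g'" by (simp add: comp_Q 1(9) c(5))
  finally have vh: "cl v \<cdot>\<^bsub>Q\<^esub> ?h = g'" .
  have "f' = cl (y \<cdot> bj)" unfolding x(5) bj(4) by (simp add: comp_Q)
  then have "Q.la f' d' = y \<triangleleft> e" by (simp add: la_Q e_def)
  then have Duv: "QD (cl u) (cl v) (Q.la f' d')" using QD_cl[OF 1(10)] by simp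
  have "f = cl (bo \<cdot> x)" unfolding x(4) bo(4) by (simp add: comp_Q)
  then have "Q.la f d'' = bo \<triangleleft> (x \<triangleleft> d'')" by (simp add: la_Q)
  also have "\<dots> = (bo \<cdot> bj) \<triangleleft> d' \<triangleright> v" by (simp add: 1(12) e_def)
  \<comment> \<open>\<open>bo \<cdot> bj\<close> need not be an identity in \<open>F\<close>, but
    its class is one, and the action on extensions depends only on the class.\<close>
  also have "\<dots> = Q.la (b \<cdot>\<^bsub>Q\<^esub> bi) (d' \<triangleright> v)"
    unfolding bo(4) bj(4) by (simp add: comp_Q la_Q)
  also have "\<dots> = Q.ra d' (cl v)" using B(6) by (simp add: xt_Q ra_Q)
  finally have fd: "Q.la f d'' = Q.ra d' (cl v)" .
  show ?thesis
    by (rule exI[of _ ?h], rule exI[of _ d''], rule exI[of _ "cl u"], rule exI[of _ "cl v"])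
      (use D uf vh Duv fd in \<open>simp add: ra_Q 1(11)\<close>)
qed

lemma weak_extriangulated_Q: "weak_extriangulated Q Ex QEM QD"
  by (intro weak_extriangulated.intro pre_extriangulated_Q weak_extriangulated_axioms.intro QD_ET4)

text \<open>Sequences with middle term in \<open>projinj\<close> become universal extensions of the
  quotient, because that middle term becomes zero.\<close>

theorem stable_triangulated:
  assumes "\<And>A. A \<in> obj K \<Longrightarrow> \<exists>x y d. D x y d \<and> dm x = A \<and> cd x \<in> projinj"
    and "\<And>C. C \<in> obj K \<Longrightarrow> \<exists>x y d. D x y d \<and> cd y = C \<and> cd x \<in> projinj"
  shows "\<exists>So Sm Dist. triangulated_category (ideal_quotient K projinj) So Sm Dist"
proof -
  interpret W: weak_extriangulated Q Ex QEM QD by (rule weak_extriangulated_Q)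
  have u: "W.universal d" if "D x y d" "cd x \<in> projinj" for x y d
    unfolding W.universal_def using QD_cl[OF that(1)] zero_obj_Q[OF that(2)] D_arr[OF that(1)]
    by (metis arr_cl(3))
  interpret S: stable_extriangulated Q Ex QEM QD
  proof
    fix A assume "A \<in> obj Q"
    then show "\<exists>w. W.universal w \<and> ea w = A" "\<exists>w. W.universal w \<and> eb w = A"
      using assms[of A] u D_arr by (metis obj_Q)+
  qed
  show ?thesis using S.triangulated by blast
qed

end

section \<open>Extriangulated categories\<close>

context extriangulated_category
begin

lemma biadditive_F: "biadditive F (Ext F) (ExtMap F)"
proof (intro biadditive.intro biadditive_axioms.intro)
  show "additive_category F" ..
  show "comm_group (Ext F C A)" if "C \<in> obj F" "A \<in> obj F" for C A
    using that by (rule Ext_group)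
  show "ExtMap F (ident F C) (ident F A) e = e"
    if "A \<in> obj F" "C \<in> obj F" "e \<in> Exts F C A" for A C e
    using that by (rule ExtMap_ident)
  show "ExtMap F c a \<in> hom (Ext F (cd c) (dm a)) (Ext F (dm c) (cd a))"
    if "arr c" "arr a" for c a
    using that by (intro ExtMap_hom) (simp_all add: Mor_iff)
  show "ExtMap F (c \<cdot> c') (a' \<cdot> a) e = ExtMap F c' a' (ExtMap F c a e)"
    if "arr c" "arr c'" "cd c' = dm c" "arr a" "arr a'" "dm a' = cd a" "e \<in> Exts F (cd c) (dm a)"
    for c c' a a' e
    using that by (intro ExtMap_comp[of "dm a" "cd a" "cd a'" "cd c" "dm c" "dm c'"])
      (simp_all add: Mor_iff)
  show "ExtMap F (ident F C) (pl a a') e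
      = ExtMap F (ident F C) a e \<otimes>\<^bsub>Ext F C (cd a)\<^esub> ExtMap F (ident F C) a' e"
    if "arr a" "arr a'" "dm a' = dm a" "cd a' = cd a" "C \<in> obj F" "e \<in> Exts F C (dm a)"
    for a a' C e
    using that ET1_covariant[of "dm a" "cd a" C a a' e] by (simp add: Mor_iff push_def pl_def)
  show "ExtMap F (pl c c') (ident F A) e
      = ExtMap F c (ident F A) e \<otimes>\<^bsub>Ext F (dm c) A\<^esub> ExtMap F c' (ident F A) e"
    if "arr c" "arr c'" "dm c' = dm c" "cd c' = cd c" "A \<in> obj F" "e \<in> Exts F (cd c) A"
    for c c' A e
    using that ET1_contravariant[of A "cd c" "dm c" c c' e] by (simp add: Mor_iff pull_def pl_def)
qed

end

sublocale extriangulated_category \<subseteq> biadditive F "Ext F" "ExtMap F"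
  by (rule biadditive_F)

context extriangulated_category
begin

definition DF :: "'m \<Rightarrow> 'm \<Rightarrow> 'o \<times> 'o \<times> 'e \<Rightarrow> bool" where
  "DF x y d \<longleftrightarrow> (\<exists>B. etriangle F (ea d) B (eb d) x y (und d))"

lemma etriangle_arr:
  assumes "etriangle F A B C x y \<delta>"
  shows "A \<in> obj F" "B \<in> obj F" "C \<in> obj F" "\<delta> \<in> Exts F C A" "arr x" "dm x = A" "cd x = B"
    "arr y" "dm y = B" "cd y = C"
  using assms unfolding etriangle_def realizes_def seqs_def by (auto simp: Mor_iff)

lemma DF_arr: "DF x y d \<Longrightarrow> arr x \<and> arr y \<and> dm y = cd x \<and> xt d \<and> ea d = dm x \<and> eb d = cd y"
  unfolding DF_def xt_def using etriangle_arr by metis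

lemma DF_etriangle: "DF x y d \<Longrightarrow> etriangle F (ea d) (cd x) (eb d) x y (und d)"
  unfolding DF_def using etriangle_arr by metis

lemma DF_I: "etriangle F (ea d) B (eb d) x y (und d) \<Longrightarrow> DF x y d"
  unfolding DF_def by blast

lemma seqs_iff: "A \<in> obj F \<Longrightarrow> C \<in> obj F \<Longrightarrow> (B, x, y) \<in> seqs F A C \<longleftrightarrow>
    arr x \<and> arr y \<and> dm x = A \<and> cd x = B \<and> dm y = B \<and> cd y = C"
  unfolding seqs_def by (auto simp: Mor_iff)

lemma seq_equiv_iff:
  assumes "A \<in> obj F" "C \<in> obj F"
  shows "((B, x, y), (B', x', y')) \<in> seq_equiv F A C \<longleftrightarrow>
    (B, x, y) \<in> seqs F A C \<and> (B', x', y') \<in> seqs F A C \<and>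
    (\<exists>b b'. inverses b b' \<and> dm b = B \<and> cd b = B' \<and> b \<cdot> x = x' \<and> y' \<cdot> b = y)"
proof -
  have "(\<exists>b. is_iso F B B' b \<and> b \<cdot> x = x' \<and> y' \<cdot> b = y) \<longleftrightarrow>
      (\<exists>b b'. inverses b b' \<and> dm b = B \<and> cd b = B' \<and> b \<cdot> x = x' \<and> y' \<cdot> b = y)"
    if "B \<in> obj F" "B' \<in> obj F"
    using is_iso_iff[OF that] by blast
  then show ?thesis
    unfolding seq_equiv_def seqs_def by blast
qed

text \<open>These two properties make equivalent sequences generate equal classes, so the
  class-valued realization becomes a relation closed under change of middle term.\<close>

lemma seq_equiv_sym_trans:
  assumes "A \<in> obj F" "C \<in> obj F"
  shows "sym (seq_equiv F A C)" "trans (seq_equiv F A C)"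
proof -
  show "sym (seq_equiv F A C)"
  proof (rule symI)
    fix s t assume "(s, t) \<in> seq_equiv F A C"
    moreover obtain B x y B' x' y' where st: "s = (B, x, y)" "t = (B', x', y')"
      by (cases s, cases t) auto
    ultimately obtain b b' where s: "(B, x, y) \<in> seqs F A C" "(B', x', y') \<in> seqs F A C"
      and b: "inverses b b'" "dm b = B" "cd b = B'" "b \<cdot> x = x'" "y' \<cdot> b = y"
      using seq_equiv_iff[OF assms] by metis
    note i = inversesD[OF b(1)]
    have "b' \<cdot> x' = x" "y \<cdot> b' = y'"
      using s b(2,3) i assms unfolding seqs_iff[OF assms] by (auto simp flip: b(4,5))
    then show "(t, s) \<in> seq_equiv F A C"
      unfolding st seq_equiv_iff[OF assms] using s i inverses_sym[OF b(1)] b(2,3) by metis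
  qed
  show "trans (seq_equiv F A C)"
  proof (rule transI)
    fix s t r assume "(s, t) \<in> seq_equiv F A C" "(t, r) \<in> seq_equiv F A C"
    moreover obtain B x y B' x' y' B'' x'' y'' where
      st: "s = (B, x, y)" "t = (B', x', y')" "r = (B'', x'', y'')"
      by (cases s, cases t, cases r) auto
    ultimately obtain b b' c c' where s: "(B, x, y) \<in> seqs F A C" "(B', x', y') \<in> seqs F A C"
      "(B'', x'', y'') \<in> seqs F A C"
      and b: "inverses b b'" "dm b = B" "cd b = B'" "b \<cdot> x = x'" "y' \<cdot> b = y"
      and c: "inverses c c'" "dm c = B'" "cd c = B''" "c \<cdot> x' = x''" "y'' \<cdot> c = y'"
      using seq_equiv_iff[OF assms] by metis
    have a: "arr b" "arr c" using inversesD(1) b(1) c(1) by blast+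
    have "(c \<cdot> b) \<cdot> x = c \<cdot> (b \<cdot> x)" "y'' \<cdot> (c \<cdot> b) = (y'' \<cdot> c) \<cdot> b"
      using s a b(2,3) c(2,3) unfolding seqs_iff[OF assms] by auto
    then have "(c \<cdot> b) \<cdot> x = x''" "y'' \<cdot> (c \<cdot> b) = y" by (simp_all only: b c)
    moreover have "inverses (c \<cdot> b) (b' \<cdot> c')" "dm (c \<cdot> b) = B" "cd (c \<cdot> b) = B''"
      using inverses_comp[OF b(1) c(1)] a b(2,3) c(2,3) by simp_all
    ultimately show "(s, r) \<in> seq_equiv F A C"
      unfolding st seq_equiv_iff[OF assms] using s by blast
  qed
qed

lemma DF_mid:
  assumes "DF x y d" "inverses b b'" "dm b = cd x"
  shows "DF (b \<cdot> x) (y \<cdot> b') d"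
proof -
  note [simp] = DF_arr[OF assms(1)] assms(3)
  note b = inversesD[OF assms(2)]
  note [simp] = b(1-4)
  have o: "ea d \<in> obj F" "eb d \<in> obj F" using xt_obj DF_arr[OF assms(1)] by blast+
  have "((cd x, x, y), (cd b, b \<cdot> x, y \<cdot> b')) \<in> seq_equiv F (ea d) (eb d)"
    unfolding seq_equiv_iff[OF o] using assms(2) b(5) by (auto simp: seqs_iff)
  then have "seq_equiv F (ea d) (eb d) `` {(cd x, x, y)}
      = seq_equiv F (ea d) (eb d) `` {(cd b, b \<cdot> x, y \<cdot> b')}"
    using seq_equiv_sym_trans[OF o] by (blast dest: symD transD)
  then have "etriangle F (ea d) (cd b) (eb d) (b \<cdot> x) (y \<cdot> b') (und d)"
    using DF_etriangle[OF assms(1)] o unfolding etriangle_def realizes_def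
    by (simp add: seqs_iff)
  then show ?thesis by (rule DF_I)
qed

lemma DF_exists:
  assumes "xt d"
  shows "\<exists>x y. DF x y d"
proof -
  have o: "ea d \<in> obj F" "eb d \<in> obj F" "und d \<in> Exts F (eb d) (ea d)"
    using assms xt_und by simp_all
  obtain s where s: "s \<in> seqs F (ea d) (eb d)"
    "Real F (eb d) (ea d) (und d) = seq_equiv F (ea d) (eb d) `` {s}"
    using ET2_class[OF o] by (elim quotientE)
  obtain B x y where "s = (B, x, y)" by (cases s)
  then have "etriangle F (ea d) B (eb d) x y (und d)"
    unfolding etriangle_def realizes_def using s o by (simp add: seqs_def)
  then show ?thesis using DF_I by blast
qed

lemma DF_split:
  assumes "A \<in> obj F" "C \<in> obj F"
  shows "\<exists>S. is_biproduct F A C S \<and> DF (inl S) (prr S) (ezr C A) \<and> DF (inr S) (prl S) (ezr A C)"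
proof -
  obtain S where S: "is_biproduct F A C S" using biproduct_exists[OF assms] by blast
  note [simp] = biproductD[OF S]
  have "pl (inr S \<cdot> prr S) (inl S \<cdot> prl S) = ident F (dsum S)"
    using pl_comm[of "inr S \<cdot> prr S" "inl S \<cdot> prl S"] by simp
  \<comment> \<open>The same direct sum with its summands exchanged. It gives the second split
    sequence on the same object, as the backward rotation requires.\<close>
  then have S': "is_biproduct F C A \<lparr>dsum = dsum S, inl = inr S, inr = inl S, prl = prr S, prr = prl S\<rparr>"
    by (intro biproductI) simp_all
  have "und (ezr C A) \<in> Exts F C A" "und (ezr A C) \<in> Exts F A C"
    using xt_und assms by simp_all
  then have "DF (inl S) (prr S) (ezr C A)" "DF (inr S) (prl S) (ezr A C)"
    using ET2_zero[OF S] ET2_zero[OF S'] assms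
    by (auto simp: etriangle_def ezr_def intro!: DF_I[of _ "dsum S"])
  then show ?thesis using S by blast
qed

lemma ext_mor_iff:
  assumes "xt d" "xt d'"
  shows "ext_mor F (ea d) (eb d) (und d) (ea d') (eb d') (und d') a c \<longleftrightarrow>
    arr a \<and> dm a = ea d \<and> cd a = ea d' \<and> arr c \<and> dm c = eb d \<and> cd c = eb d' \<and>
    la a d = ra d' c"
  using assms unfolding ext_mor_def push_def pull_def la_def ra_def by (auto simp: Mor_iff)

end

sublocale extriangulated_category \<subseteq> weak_extriangulated F "Ext F" "ExtMap F" DF
proof
  fix x y d x' y' d' a c
  assume D: "DF x y d" "DF x' y' d'" and a: "arr a" "dm a = dm x" "cd a = dm x'"
    "arr c" "dm c = cd y" "cd c = cd y'" "la a d = ra d' c"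
  have x: "xt d" "xt d'" using D[THEN DF_arr] by simp_all
  have "ext_mor F (ea d) (eb d) (und d) (ea d') (eb d') (und d') a c"
    unfolding ext_mor_iff[OF x] using D[THEN DF_arr] a by simp
  then obtain b where "b \<in> Mor F (cd x) (cd x')" "b \<cdot> x = x' \<cdot> a" "y' \<cdot> b = c \<cdot> y"
    using ET2_realization[OF D[THEN DF_etriangle]] by blast
  then show "\<exists>b. arr b \<and> dm b = cd x \<and> cd b = cd x' \<and> b \<cdot> x = x' \<cdot> a \<and> y' \<cdot> b = c \<cdot> y"
    using D[THEN DF_arr] by (auto simp: Mor_iff)
next
  fix x y d x' y' d' a b
  assume D: "DF x y d" "DF x' y' d'" and a: "arr a" "dm a = dm x" "cd a = dm x'"
    "arr b" "dm b = cd x" "cd b = cd x'" "b \<cdot> x = x' \<cdot> a"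
  note t = D[THEN DF_arr]
  have x: "xt d" "xt d'" using t by simp_all
  have "a \<in> Mor F (ea d) (ea d')" "b \<in> Mor F (cd x) (cd x')"
    using D[THEN DF_arr] a by (simp_all add: Mor_iff)
  then obtain c where "ext_mor F (ea d) (eb d) (und d) (ea d') (eb d') (und d') a c"
    "y' \<cdot> b = c \<cdot> y"
    using ET3[OF D[THEN DF_etriangle]] a(7) by blast
  then show "\<exists>c. arr c \<and> dm c = cd y \<and> cd c = cd y' \<and> y' \<cdot> b = c \<cdot> y \<and> la a d = ra d' c"
    unfolding ext_mor_iff[OF x] using t by metis
next
  fix x y d x' y' d' b c
  assume D: "DF x y d" "DF x' y' d'" and a: "arr b" "dm b = cd x" "cd b = cd x'"
    "arr c" "dm c = cd y" "cd c = cd y'" "y' \<cdot> b = c \<cdot> y"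
  note t = D[THEN DF_arr]
  have x: "xt d" "xt d'" using t by simp_all
  have "b \<in> Mor F (cd x) (cd x')" "c \<in> Mor F (eb d) (eb d')"
    using D[THEN DF_arr] a by (simp_all add: Mor_iff)
  then obtain a where "ext_mor F (ea d) (eb d) (und d) (ea d') (eb d') (und d') a c"
    "b \<cdot> x = x' \<cdot> a"
    using ET3_op[OF D[THEN DF_etriangle]] a(7) by blast
  then show "\<exists>a. arr a \<and> dm a = dm x \<and> cd a = dm x' \<and> b \<cdot> x = x' \<cdot> a \<and> la a d = ra d' c"
    unfolding ext_mor_iff[OF x] using t by metis
next
  fix f f' d g g' d' assume D: "DF f f' d" "DF g g' d'" and gf: "dm g = cd f"
  note f = DF_arr[OF D(1)] and g = DF_arr[OF D(2)]
  have e: "ea d' = cd f" using g gf by simp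
  from ET4[OF DF_etriangle[OF D(1)] DF_etriangle[OF D(2), unfolded e]]
  obtain E h h' \<delta> u v where 1: "etriangle F (ea d) (cd g) E h h' \<delta>" "h = g \<cdot> f"
    "u \<in> Mor F (eb d) E" "v \<in> Mor F E (eb d')" "u \<cdot> f' = h' \<cdot> g" "v \<cdot> h' = g'"
    "realizes F (eb d) (eb d') (push F (eb d') f' (und d')) E u v"
    "pull F (ea d) u \<delta> = und d" "push F E f \<delta> = pull F (cd f) v (und d')" by blast
  note t = etriangle_arr[OF 1(1)]
  let ?d = "(E, ea d, \<delta>)"
  have uv: "arr u" "dm u = cd f'" "cd u = cd h'" "arr v" "dm v = cd h'" "cd v = cd g'"
    using 1(3,4) t f g by (simp_all add: Mor_iff)
  have xt: "xt ?d" using t by (simp add: xt_triple)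
  have "DF (g \<cdot> f) h' ?d" using 1(1,2) by (intro DF_I[of _ "cd g"]) simp
  moreover have "DF u v (la f' d')"
  proof (rule DF_I[of _ E])
    have "xt (la f' d')" using f g e by simp
    then show "etriangle F (ea (la f' d')) E (eb (la f' d')) u v (und (la f' d'))"
      using 1(7) f g xt_und[of "la f' d'"] t(3) unfolding etriangle_def by (simp add: la_def push_def)
  qed
  moreover have "ra ?d u = d"
    using 1(8) uv(2) f by (intro ext_eqI[of "ra ?d u" d]) (simp_all add: ra_def pull_def)
  moreover have "la f ?d = ra d' v"
    unfolding ra_def la_def using 1(9) uv(5) t(7,10) e by (simp add: pull_def push_def)
  ultimately show "\<exists>h' d'' u v. DF (g \<cdot> f) h' d'' \<and>
      arr u \<and> dm u = cd f' \<and> cd u = cd h' \<and> arr v \<and> dm v = cd h' \<and> cd v = cd g' \<and>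
      u \<cdot> f' = h' \<cdot> g \<and> v \<cdot> h' = g' \<and> DF u v (la f' d') \<and> ra d'' u = d \<and> la f d'' = ra d' v"
    using uv 1(5,6) by blast
qed (fact DF_arr DF_exists DF_mid DF_split)+

section \<open>The Frobenius hypotheses\<close>

context frobenius_extriangulated_category
begin

text \<open>An injective object has the extension half of \<open>projinj\<close> directly; the
  lifting half comes from its being projective, by \<open>Proj_eq_Inj\<close>.\<close>

lemma projinj_eq: "projinj = Inj F"
proof
  show "projinj \<subseteq> Inj F"
  proof
    fix J assume J: "J \<in> projinj"
    then have o: "J \<in> obj F" using I_obj by blast
    have "\<exists>b\<in>Mor F B J. b \<cdot> x = a"
      if x: "is_inflation F A B x" and a: "a \<in> Mor F A J" for A B x a
    proof -
      obtain C y \<delta> where e: "etriangle F A B C x y \<delta>"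
        using x unfolding is_inflation_def is_conflation_def by blast
      note t = etriangle_arr[OF e]
      have "DF x y (C, A, \<delta>)" using e by (intro DF_I[of _ B]) simp
      moreover have "arr a" "dm a = dm x" "cd a = J" using t o a by (simp_all add: Mor_iff)
      ultimately obtain g where g: "arr g" "dm g = cd x" "cd g = J" "g \<cdot> x = a"
        using projinj_extend[OF J] by blast
      then have "g \<in> Mor F B J" using t o by (simp add: Mor_iff)
      then show ?thesis using g(4) by blast
    qed
    then show "J \<in> Inj F" unfolding Inj_def using o by blast
  qed
  show "Inj F \<subseteq> projinj"
  proof
    fix J assume J: "J \<in> Inj F"
    then have o: "J \<in> obj F" unfolding Inj_def by blast
    have "\<exists>g. arr g \<and> dm g = cd x \<and> cd g = J \<and> g \<cdot> x = k"
      if D: "DF x y d" and k: "arr k" "dm k = dm x" "cd k = J" for x y d k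
    proof -
      note t = DF_arr[OF D]
      have "is_inflation F (ea d) (cd x) x"
        unfolding is_inflation_def is_conflation_def using DF_etriangle[OF D] by blast
      moreover have "k \<in> Mor F (ea d) J" using k o t by (simp add: Mor_iff)
      ultimately obtain b where "b \<in> Mor F (cd x) J" "b \<cdot> x = k"
        using J unfolding Inj_def by blast
      then show ?thesis using o t by (auto simp: Mor_iff)
    qed
    moreover have "\<exists>g. arr g \<and> dm g = J \<and> cd g = cd x \<and> y \<cdot> g = k"
      if D: "DF x y d" and k: "arr k" "dm k = J" "cd k = cd y" for x y d k
    proof -
      note t = DF_arr[OF D]
      have "is_deflation F (cd x) (eb d) y"
        unfolding is_deflation_def is_conflation_def using DF_etriangle[OF D] by blast
      moreover have "k \<in> Mor F J (eb d)" using k o t by (simp add: Mor_iff)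
      ultimately obtain b where "b \<in> Mor F J (cd x)" "y \<cdot> b = k"
        using J[folded Proj_eq_Inj] unfolding Proj_def by blast
      then show ?thesis using o t by (auto simp: Mor_iff)
    qed
    ultimately show "J \<in> projinj" unfolding projinj_def using o by blast
  qed
qed

text \<open>Enough injectives provide the universal extensions out of each object and enough
  projectives those into each object. The coincidence of the two classes puts all their middle terms
  in \<open>projinj\<close>.\<close>

lemma stable_category_triangulated:
  "\<exists>So Sm Dist. triangulated_category (ideal_quotient F (Inj F)) So Sm Dist"
  unfolding projinj_eq[symmetric]
proof (rule stable_triangulated)
  have D: "\<exists>x y d. DF x y d \<and> dm x = A \<and> cd y = C \<and> cd x = B"
    if c: "is_conflation F A B C x y" for A B C x y
  proof -
    obtain \<delta> where e: "etriangle F A B C x y \<delta>"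
      using c unfolding is_conflation_def by blast
    have "DF x y (C, A, \<delta>)" using e by (intro DF_I[of _ B]) simp
    then show ?thesis using etriangle_arr[OF e] by blast
  qed
  show "\<exists>x y d. DF x y d \<and> dm x = A \<and> cd x \<in> projinj" if "A \<in> obj F" for A
    using enough_inj D that unfolding enough_injectives_def projinj_eq by metis
  show "\<exists>x y d. DF x y d \<and> cd y = C \<and> cd x \<in> projinj" if "C \<in> obj F" for C
    using enough_proj D that unfolding enough_projectives_def projinj_eq Proj_eq_Inj by metis
qed

end

theorem corollary7p4:
  fixes F :: "('o, 'm, 'e) extcat"
  assumes "frobenius_extriangulated_category F"
    and "WIC F"
  shows "\<exists>So Sm Dist. triangulated_category (ideal_quotient F (Inj F)) So Sm Dist"
proof -
  interpret frobenius_extriangulated_category F by (rule assms(1))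
  show ?thesis by (rule stable_category_triangulated)
qed

end
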